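(* Fix an integer $b\ge 2$ and $m\in\mathbb N_0$, and let the approximation classes $N^\alpha_q(L^p)$, $C^\alpha_q(L^p)$, $S^\alpha_q(L^p)$ of tensor networks be defined with $S=\mathbb P_m$ (see context). Let $1\le p\le\infty$. Then: (1) for any $r\in\mathbb N$, $$W^{r,p}\hookrightarrow N^{2r}_\infty(L^p),\qquad W^{r,p}\hookrightarrow C^{r}_\infty(L^p)\hookrightarrow S^{r}_\infty(L^p);$$ (2) for any $0<q\le\infty$ and any $\alpha>0$, $$B^{\alpha}_{p,q}\hookrightarrow N^{2\alpha}_q(L^p),\qquad B^{\alpha}_{p,q}\hookrightarrow C^{\alpha}_q(L^p)\hookrightarrow S^{\alpha}_q(L^p).$$
   Context: All function spaces are over $[0,1)$; $\mathbb N=\{1,2,\dots\}$; $\hookrightarrow$ denotes continuous embedding. $\mathbb P_m$ is the space of polynomials of degree at most $m$. $W^{r,p}$ is the Sobolev space of $r$ times weakly differentiable functions with derivatives up to order $r$ in $L^p$. Tensor networks. Let $I_b=\{0,\dots,b-1\}$. For $d\in\mathbb N$ and $f:[0,1)\to\mathbb R$, the tensorization is $(T_{b,d}f)(i_1,\dots,i_d,y)=f\big(\sum_{k=1}^d i_kb^{-k}+b^{-d}y\big)$, $i_k\in I_b$, $y\in[0,1)$. Fix a basis $(\varphi_k)_{k=1}^{m+1}$ of $\mathbb P_m$. For $d\in\mathbb N$ and $\boldsymbol r=(r_1,\dots,r_d)\in\mathbb N^d$, a tensor network is a tuple $\mathbf v=(v_1,\dots,v_{d+1})\in\mathbb R^{b\times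 r_1}\times\mathbb R^{b\times r_1\times r_2}\times\cdots\times\mathbb R^{b\times r_{d-1}\times r_d}\times\mathbb R^{r_d\times(m+1)}$; its realization is the function $f$ with $$(T_{b,d}f)(i_1,\dots,i_d,y)=\sum_{k_1=1}^{r_1}\cdots\sum_{k_d=1}^{r_d}\sum_{k_{d+1}=1}^{m+1}v_1^{k_1}(i_1)v_2^{k_1,k_2}(i_2)\cdots v_d^{k_{d-1},k_d}(i_d)v_{d+1}^{k_d,k_{d+1}}\varphi_{k_{d+1}}(y).$$ Complexities of $\mathbf v$: $\mathrm{compl}_{\mathcal N}(\mathbf v)=\sum_{\nu=1}^d r_\nu$; $\mathrm{compl}_{\mathcal C}(\mathbf v)=br_1+b\sum_{k=2}^d r_{k-1}r_k+r_d(m+1)$; $\mathrm{compl}_{\mathcal S}(\mathbf v)=\sum_{\nu=1}^{d+1}\|v_\nu\|_{\ell_0}$ (number of non-zero entries). The complexity of a function is the minimum of the complexity over all tensor networks (all $d$, $\boldsymbol r$) realizing it. For $n\in\mathbb N$, $\Phi_n^{\mathcal N},\Phi_n^{\mathcal C},\Phi_n^{\mathcal S}$ are the sets of functions realizable by tensor networks whose respective complexity is at most $n$; moreover $0\in\Phi_n$ for all $n$ and $\Phi_0=\{0\}$. Approximation classes. For $E_n(f)=\inf_{\varphi\in\Phi_n}\|f-\varphi\|_p$, $\alpha>0$, $0<q\le\infty$, the class $A^\alpha_q(L^p,(\Phi_n))$ consists of $f\in L^p$ with $\|f\|_{A^\alpha_q}<\infty$, where $\|f\|_{A^\alpha_q}=\big(\sum_{n\ge1}[n^\alpha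 E_{n-1}(f)]^q\frac1n\big)^{1/q}$ for $q<\infty$ and $\|f\|_{A^\alpha_\infty}=\sup_{n\ge1}n^\alpha E_{n-1}(f)$. Then $N^\alpha_q(L^p)$, $C^\alpha_q(L^p)$, $S^\alpha_q(L^p)$ are the classes for $\Phi_n=\Phi_n^{\mathcal N},\Phi_n^{\mathcal C},\Phi_n^{\mathcal S}$ respectively. Besov spaces. $\Delta_h[f]=f(\cdot+h)-f$, $\Delta_h^r=\Delta_h\circ\Delta_h^{r-1}$ (defined on $[0,1-rh)$), $\omega_r(f,t)_p=\sup_{0<h\le t}\|\Delta_h^r[f]\|_p$. For $\alpha>0$, $0<p,q\le\infty$, $r=\lfloor\alpha\rfloor+1$: $|f|_{B^\alpha_{p,q}}=\big(\int_0^1[t^{-\alpha}\omega_r(f,t)_p]^q\frac{dt}{t}\big)^{1/q}$ for $q<\infty$, $|f|_{B^\alpha_{p,\infty}}=\sup_{0<t\le1}t^{-\alpha}\omega_r(f,t)_p$, and $\|f\|_{B^\alpha_{p,q}}=\|f\|_p+|f|_{B^\alpha_{p,q}}$; $B^\alpha_{p,q}=\{f\in L^p:\|f\|_{B^\alpha_{p,q}}<\infty\}$. *)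

theory Defs
  imports "HOL-Probability.Essential_Supremum" "HOL-Computational_Algebra.Polynomial"
begin

section \<open>Lebesgue spaces\<close>

text \<open>Real powers in \<^typ>\<open>ennreal\<close>; only used with positive exponents.\<close>

definition epowr :: "ennreal \<Rightarrow> real \<Rightarrow> ennreal" where
  "epowr x a = (if x = \<infinity> then \<infinity> else ennreal (enn2real x powr a))"

definition Lp_norm :: "ennreal \<Rightarrow> real set \<Rightarrow> (real \<Rightarrow> real) \<Rightarrow> ennreal" where
  "Lp_norm p A f =
     (if p = \<infinity> then esssup (lebesgue_on A) (\<lambda>x. ennreal \<bar>f x\<bar>)
      else epowr (\<integral>\<^sup>+x. ennreal (\<bar>f x\<bar> powr enn2real p) \<partial>lebesgue_on A) (1 / enn2real p))"

text \<open>Functions on \<open>[0,1)\<close> are represented by total functions on \<^typ>\<open>real\<close>; their values outside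
  \<open>[0,1)\<close> are irrelevant. Elements of \<open>L\<^sup>p\<close> are functions, not equivalence classes.\<close>

definition Lp :: "ennreal \<Rightarrow> (real \<Rightarrow> real) set" where
  "Lp p = {f \<in> borel_measurable (lebesgue_on {0..<1}). Lp_norm p {0..<1} f < \<infinity>}"

section \<open>Continuous embeddings\<close>

text \<open>A (quasi-)normed function space is a pair of its carrier set and its (quasi-)norm.\<close>

type_synonym fspace = "(real \<Rightarrow> real) set \<times> ((real \<Rightarrow> real) \<Rightarrow> ennreal)"

definition cont_embedded :: "fspace \<Rightarrow> fspace \<Rightarrow> bool"  (infix "\<hookrightarrow>" 50) where
  "X \<hookrightarrow> Y \<longleftrightarrow> fst X \<subseteq> fst Y \<and> (\<exists>C::real. C > 0 \<and> (\<forall>f\<in>fst X. snd Y f \<le> ennreal C * snd X f))"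

section \<open>Tensor networks\<close>

definition tensorization :: "nat \<Rightarrow> nat \<Rightarrow> (real \<Rightarrow> real) \<Rightarrow> (nat \<Rightarrow> nat) \<Rightarrow> real \<Rightarrow> real" where
  "tensorization b d f i y = f ((\<Sum>k=1..d. real (i k) / real b ^ k) + y / real b ^ d)"

definition poly_basis :: "nat \<Rightarrow> (nat \<Rightarrow> real poly) \<Rightarrow> bool" where
  "poly_basis m \<phi> \<longleftrightarrow>
     inj_on \<phi> {1..m+1} \<and>
     \<not> module.dependent smult (\<phi> ` {1..m+1}) \<and>
     module.span smult (\<phi> ` {1..m+1}) = {P. degree P \<le> m}"

text \<open>With \<open>v = (v\<^sub>1, \<dots>, v\<^bsub>d+1\<^esub>)\<close>: \<open>tn_first v i k\<close> is the entry of \<open>v\<^sub>1\<close> at \<open>(i,k)\<close>,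
  \<open>tn_core v \<nu> i k l\<close> that of \<open>v\<^sub>\<nu>\<close> at \<open>(i,k,l)\<close> for \<open>2 \<le> \<nu> \<le> d\<close>, and \<open>tn_last v k l\<close> that of
  \<open>v\<^bsub>d+1\<^esub>\<close> at \<open>(k,l)\<close>. Here \<open>i\<close> ranges over \<open>{..<b}\<close>, all other indices start at 1, and values at
  indices out of range are never used.\<close>

record tensor_network =
  tn_depth :: nat
  tn_rank :: "nat \<Rightarrow> nat"
  tn_first :: "nat \<Rightarrow> nat \<Rightarrow> real"
  tn_core :: "nat \<Rightarrow> nat \<Rightarrow> nat \<Rightarrow> nat \<Rightarrow> real"
  tn_last :: "nat \<Rightarrow> nat \<Rightarrow> real"

definition tn_wf :: "tensor_network \<Rightarrow> bool" where
  "tn_wf v \<longleftrightarrow> tn_depth v \<ge> 1 \<and> (\<forall>\<nu>\<in>{1..tn_depth v}. tn_rank v \<nu> \<ge> 1)"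

definition tn_value ::
    "nat \<Rightarrow> (nat \<Rightarrow> real poly) \<Rightarrow> tensor_network \<Rightarrow> (nat \<Rightarrow> nat) \<Rightarrow> real \<Rightarrow> real" where
  "tn_value m \<phi> v i y =
     (let d = tn_depth v in
      \<Sum>k \<in> PiE {1..d} (\<lambda>\<nu>. {1..tn_rank v \<nu>}). \<Sum>l=1..m+1.
        tn_first v (i 1) (k 1) * (\<Prod>\<nu>=2..d. tn_core v \<nu> (i \<nu>) (k (\<nu> - 1)) (k \<nu>))
        * tn_last v (k d) l * poly (\<phi> l) y)"

definition tn_realizes ::
    "nat \<Rightarrow> nat \<Rightarrow> (nat \<Rightarrow> real poly) \<Rightarrow> tensor_network \<Rightarrow> (real \<Rightarrow> real) \<Rightarrow> bool" where
  "tn_realizes b m \<phi> v f \<longleftrightarrow>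
     (\<forall>i. (\<forall>k\<in>{1..tn_depth v}. i k < b) \<longrightarrow>
        (\<forall>y\<in>{0..<1}. tensorization b (tn_depth v) f i y = tn_value m \<phi> v i y))"

definition compl_N :: "nat \<Rightarrow> nat \<Rightarrow> tensor_network \<Rightarrow> nat" where
  "compl_N b m v = (\<Sum>\<nu>=1..tn_depth v. tn_rank v \<nu>)"

definition compl_C :: "nat \<Rightarrow> nat \<Rightarrow> tensor_network \<Rightarrow> nat" where
  "compl_C b m v =
     b * tn_rank v 1
     + b * (\<Sum>k=2..tn_depth v. tn_rank v (k - 1) * tn_rank v k)
     + tn_rank v (tn_depth v) * (m + 1)"

definition compl_S :: "nat \<Rightarrow> nat \<Rightarrow> tensor_network \<Rightarrow> nat" where
  "compl_S b m v =
     card {(i, k). i < b \<and> k \<in> {1..tn_rank v 1} \<and> tn_first v i k \<noteq> 0}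
     + (\<Sum>\<nu>=2..tn_depth v.
          card {(i, k, l). i < b \<and> k \<in> {1..tn_rank v (\<nu> - 1)} \<and> l \<in> {1..tn_rank v \<nu>}
                           \<and> tn_core v \<nu> i k l \<noteq> 0})
     + card {(k, l). k \<in> {1..tn_rank v (tn_depth v)} \<and> l \<in> {1..m+1} \<and> tn_last v k l \<noteq> 0}"

text \<open>The argument \<open>c\<close> is one of the three complexity measures above. Without the
  zero functions, the set for \<^const>\<open>compl_C\<close> would be empty for \<open>n < b + m + 1\<close>.\<close>

definition tn_Phi ::
    "(nat \<Rightarrow> nat \<Rightarrow> tensor_network \<Rightarrow> nat) \<Rightarrow> nat \<Rightarrow> nat \<Rightarrow> (nat \<Rightarrow> real poly)
       \<Rightarrow> nat \<Rightarrow> (real \<Rightarrow> real) set" where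
  "tn_Phi c b m \<phi> n =
     {f. \<forall>x\<in>{0..<1}. f x = 0} \<union>
     (if n = 0 then {} else {f. \<exists>v. tn_wf v \<and> tn_realizes b m \<phi> v f \<and> c b m v \<le> n})"

section \<open>Approximation classes\<close>

definition best_error :: "(nat \<Rightarrow> (real \<Rightarrow> real) set) \<Rightarrow> ennreal \<Rightarrow> nat \<Rightarrow> (real \<Rightarrow> real) \<Rightarrow> ennreal" where
  "best_error \<Phi> p n f = (INF g\<in>\<Phi> n. Lp_norm p {0..<1} (\<lambda>x. f x - g x))"

definition approx_norm ::
    "(nat \<Rightarrow> (real \<Rightarrow> real) set) \<Rightarrow> ennreal \<Rightarrow> real \<Rightarrow> ennreal \<Rightarrow> (real \<Rightarrow> real) \<Rightarrow> ennreal" where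
  "approx_norm \<Phi> p \<alpha> q f =
     (if q = \<infinity> then SUP n\<in>{1..}. ennreal (real n powr \<alpha>) * best_error \<Phi> p (n - 1) f
      else epowr
        (\<Sum>n. epowr (ennreal (real (Suc n) powr \<alpha>) * best_error \<Phi> p n f) (enn2real q)
              * ennreal (1 / real (Suc n)))
        (1 / enn2real q))"

definition approx_class ::
    "(nat \<Rightarrow> (real \<Rightarrow> real) set) \<Rightarrow> ennreal \<Rightarrow> real \<Rightarrow> ennreal \<Rightarrow> fspace" where
  "approx_class \<Phi> p \<alpha> q = ({f \<in> Lp p. approx_norm \<Phi> p \<alpha> q f < \<infinity>}, approx_norm \<Phi> p \<alpha> q)"

definition N_class ::
    "nat \<Rightarrow> nat \<Rightarrow> (nat \<Rightarrow> real poly) \<Rightarrow> real \<Rightarrow> ennreal \<Rightarrow> ennreal \<Rightarrow> fspace" where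
  "N_class b m \<phi> \<alpha> q p = approx_class (tn_Phi compl_N b m \<phi>) p \<alpha> q"

definition C_class ::
    "nat \<Rightarrow> nat \<Rightarrow> (nat \<Rightarrow> real poly) \<Rightarrow> real \<Rightarrow> ennreal \<Rightarrow> ennreal \<Rightarrow> fspace" where
  "C_class b m \<phi> \<alpha> q p = approx_class (tn_Phi compl_C b m \<phi>) p \<alpha> q"

definition S_class ::
    "nat \<Rightarrow> nat \<Rightarrow> (nat \<Rightarrow> real poly) \<Rightarrow> real \<Rightarrow> ennreal \<Rightarrow> ennreal \<Rightarrow> fspace" where
  "S_class b m \<phi> \<alpha> q p = approx_class (tn_Phi compl_S b m \<phi>) p \<alpha> q"

section \<open>Sobolev spaces\<close>

definition test_function :: "(real \<Rightarrow> real) \<Rightarrow> bool" where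
  "test_function \<psi> \<longleftrightarrow>
     (\<forall>k x. (deriv ^^ k) \<psi> differentiable at x) \<and> closure {x. \<psi> x \<noteq> 0} \<subseteq> {0<..<1}"

definition locally_integrable :: "(real \<Rightarrow> real) \<Rightarrow> bool" where
  "locally_integrable f \<longleftrightarrow> (\<forall>a c. 0 < a \<and> c < 1 \<longrightarrow> integrable (lebesgue_on {a..c}) f)"

definition has_weak_deriv :: "nat \<Rightarrow> (real \<Rightarrow> real) \<Rightarrow> (real \<Rightarrow> real) \<Rightarrow> bool" where
  "has_weak_deriv k f g \<longleftrightarrow>
     locally_integrable f \<and> locally_integrable g \<and>
     (\<forall>\<psi>. test_function \<psi> \<longrightarrow>
        (\<integral>x. f x * (deriv ^^ k) \<psi> x \<partial>lebesgue_on {0<..<1})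
          = (-1) ^ k * (\<integral>x. g x * \<psi> x \<partial>lebesgue_on {0<..<1}))"

text \<open>Weak derivatives are unique up to null sets, so the choice of representative is immaterial
  below.\<close>

definition weak_deriv :: "nat \<Rightarrow> (real \<Rightarrow> real) \<Rightarrow> real \<Rightarrow> real" where
  "weak_deriv k f = (SOME g. has_weak_deriv k f g)"

definition sobolev :: "nat \<Rightarrow> ennreal \<Rightarrow> fspace" where
  "sobolev r p =
     ({f \<in> Lp p. \<forall>k\<in>{1..r}. (\<exists>g. has_weak_deriv k f g) \<and> weak_deriv k f \<in> Lp p},
      (\<lambda>f. Lp_norm p {0..<1} f + (\<Sum>k=1..r. Lp_norm p {0..<1} (weak_deriv k f))))"

section \<open>Besov spaces\<close>

definition fdiff :: "real \<Rightarrow> (real \<Rightarrow> real) \<Rightarrow> real \<Rightarrow> real" where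
  "fdiff h f x = f (x + h) - f x"

text \<open>For \<open>r * h \<ge> 1\<close> the domain \<open>[0, 1 - r * h)\<close> is empty and the norm is 0.\<close>

definition modulus :: "nat \<Rightarrow> (real \<Rightarrow> real) \<Rightarrow> real \<Rightarrow> ennreal \<Rightarrow> ennreal" where
  "modulus r f t p = (SUP h\<in>{0<..t}. Lp_norm p {0..<1 - real r * h} ((fdiff h ^^ r) f))"

definition besov_seminorm :: "real \<Rightarrow> ennreal \<Rightarrow> ennreal \<Rightarrow> (real \<Rightarrow> real) \<Rightarrow> ennreal" where
  "besov_seminorm \<alpha> p q f =
     (let r = nat \<lfloor>\<alpha>\<rfloor> + 1 in
      if q = \<infinity> then SUP t\<in>{0<..1}. ennreal (t powr (-\<alpha>)) * modulus r f t p
      else epowr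
        (\<integral>\<^sup>+t\<in>{0<..<1}. epowr (ennreal (t powr (-\<alpha>)) * modulus r f t p) (enn2real q)
                          * ennreal (1 / t) \<partial>lborel)
        (1 / enn2real q))"

definition besov_norm :: "real \<Rightarrow> ennreal \<Rightarrow> ennreal \<Rightarrow> (real \<Rightarrow> real) \<Rightarrow> ennreal" where
  "besov_norm \<alpha> p q f = Lp_norm p {0..<1} f + besov_seminorm \<alpha> p q f"

definition besov :: "real \<Rightarrow> ennreal \<Rightarrow> ennreal \<Rightarrow> fspace" where
  "besov \<alpha> p q = ({f \<in> Lp p. besov_norm \<alpha> p q f < \<infinity>}, besov_norm \<alpha> p q)"

end

theory Submission
  imports Defs "HOL-Probability.Probability_Measure"
begin

text \<open>
  A function \<open>f\<close> of smoothness order \<open>r\<close> is approximated in two steps. First it is replaced, on the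
  \<open>b\<close>-adic partition of level \<open>2e\<close>, by a discontinuous piecewise polynomial of degree less than \<open>r\<close>, where
  \<open>r\<close> may well exceed \<open>m + 1\<close>. Then each polynomial is sampled at the \<open>b\<close>-adic points of the much finer
  level \<open>D = 2e (r + 2)\<close>. The result is constant on the cells of level \<open>D\<close>, so the only polynomial of degree
  at most \<open>m\<close> that a network has to produce in its last variable is the constant 1.

  \<^emph>\<open>Complexity.\<close> Reading the digits of \<open>x\<close> from left to right, a network remembers the first \<open>e\<close> digits
  exactly (rank \<open>b\<^sup>\<nu>\<close> after \<open>\<nu>\<close> digits). During the next \<open>e\<close> digits it carries the coefficients of all
  pieces that are still possible (rank \<open>r b\<^bsup>2e-\<nu>\<^esup>\<close>). Then a single polynomial is left, and reading a further
  digit means recentring it (rank \<open>r\<close>). These ranks add up to \<open>O(b\<^sup>e)\<close> although there are \<open>b\<^bsup>2e\<^esup>\<close> pieces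
  (\<open>sampled_spline_realized\<close>). This is the origin of the exponent \<open>2\<alpha>\<close> in the classes \<open>N\<close>. As the number of
  parameters is at most a constant times the square of the sum of the ranks (\<open>compl_C_le_compl_N_squared\<close>),
  the exponent is \<open>\<alpha>\<close> in the classes \<open>C\<close>, and also in the classes \<open>S\<close>, which count nonzero parameters only.

  \<^emph>\<open>Error.\<close> Averaging \<open>\<Delta>\<^sub>s\<^sup>r f\<close> over \<open>s\<close> compares \<open>f\<close> with a combination of iterated Steklov means
  (\<open>steklov_sum_error\<close>). An increment of a Steklov mean is an integral of a difference; iterating this shows
  that an \<open>r\<close>-fold Steklov mean is, on a short cell, a polynomial of degree less than \<open>r\<close> up to an integral of
  \<open>\<bar>\<Delta>\<^sub>h\<^sup>r f\<bar>\<close> (\<open>steklov_local_polynomial\<close>). Forward differences serve the left half of the interval and the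
  reflection of \<open>x\<close> to \<open>1 - x\<close> serves the right half. The local polynomials are Lipschitz with constant
  \<open>O(b\<^bsup>4e\<^esup> \<parallel>f\<parallel>\<^sub>p)\<close>, and \<open>D\<close> is chosen such that sampling costs \<open>O(b\<^bsup>-2er\<^esup> \<parallel>f\<parallel>\<^sub>p)\<close>. This gives the direct
  estimate \<open>E\<^sub>n(f) \<le> C (\<omega>\<^sub>r(f, b\<^bsup>-2e\<^esup>)\<^sub>p + b\<^bsup>-2er\<^esup> \<parallel>f\<parallel>\<^sub>p)\<close> as soon as \<open>n\<close> exceeds a multiple of \<open>b\<^sup>e\<close> for the
  classes \<open>N\<close>, or of \<open>b\<^bsup>2e\<^esup>\<close> for the classes \<open>C\<close> (\<open>best_error_le\<close>).

  \<^emph>\<open>Embeddings.\<close> Grouping the indices \<open>n\<close> into geometric blocks turns the direct estimate into a bound of the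
  approximation norm by the values of the modulus at \<open>t = b\<^bsup>-2e\<^esup>\<close> (\<open>weighted_sup_bound\<close> and
  \<open>weighted_sum_bound\<close>). As the modulus is monotone, these are dominated by the Besov integral
  (\<open>besov_sum_le\<close>). For Sobolev functions the modulus is at most \<open>t\<^sup>r\<close> times the norm of the \<open>r\<close>-th weak
  derivative (\<open>sobolev_modulus\<close>), because a first difference is the integral of the weak derivative
  (\<open>weak_deriv_difference\<close>).
\<close>

section \<open>Upper bounds for Lebesgue norms\<close>

text \<open>
  The inequality between the \<open>L\<^sup>p\<close> norm of \<open>f\<close> on \<open>A\<close> and a real \<open>M\<close> (\<open>Lp_norm_le_iff\<close>), stated for the
  \<open>p\<close>-th power of the norm and the uncompleted Lebesgue measure. In this form Fubini's theorem applies
  directly, and the lemmas below hide the distinction between \<open>p < \<infinity>\<close> and \<open>p = \<infinity>\<close> from all later arguments.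
\<close>

definition Lp_le :: "ennreal \<Rightarrow> real set \<Rightarrow> (real \<Rightarrow> real) \<Rightarrow> real \<Rightarrow> bool" where
  "Lp_le p A f M \<longleftrightarrow>
     (if p = \<infinity> then AE x in lborel. x \<in> A \<longrightarrow> \<bar>f x\<bar> \<le> M
      else (\<integral>\<^sup>+x. ennreal (\<bar>f x\<bar> powr enn2real p) * indicator A x \<partial>lborel)
             \<le> ennreal (M powr enn2real p))"

lemma enn2real_ge_1:
  assumes "1 \<le> p" "p \<noteq> (\<infinity>::ennreal)"
  shows "1 \<le> enn2real p"
  using enn2real_mono[of 1 p] assms by (simp add: less_top)

lemma epowr_le_iff:
  assumes "0 < a" "0 \<le> M"
  shows "epowr X (1 / a) \<le> ennreal M \<longleftrightarrow> X \<le> ennreal (M powr a)"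
proof (cases "X = \<infinity>")
  case True
  then show ?thesis by (auto simp: epowr_def top_unique)
next
  case False
  then obtain x where x: "X = ennreal x" "x \<ge> 0"
    by (cases X) auto
  have "x powr (1 / a) \<le> M \<longleftrightarrow> x \<le> M powr a"
  proof
    assume "x powr (1 / a) \<le> M"
    then have "(x powr (1/a)) powr a \<le> M powr a"
      using assms by (intro powr_mono2) auto
    then show "x \<le> M powr a" using x assms by (simp add: powr_powr)
  next
    assume "x \<le> M powr a"
    then have "x powr (1/a) \<le> (M powr a) powr (1/a)"
      using assms x by (intro powr_mono2) auto
    then show "x powr (1/a) \<le> M" using assms by (simp add: powr_powr)
  qed
  then show ?thesis using x assms by (simp add: epowr_def ennreal_le_iff)
qed

lemma Lp_norm_le_iff:
  assumes f: "f \<in> borel_measurable (lebesgue_on A)" and A: "A \<in> sets borel"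
    and M: "0 \<le> M" and p: "1 \<le> p"
  shows "Lp_norm p A f \<le> ennreal M \<longleftrightarrow> Lp_le p A f M"
proof (cases "p = \<infinity>")
  case True
  have AL: "A \<in> sets lebesgue" using A by simp
  have AE: "(AE x in lebesgue_on A. Q x) \<longleftrightarrow> (AE x in lborel. x \<in> A \<longrightarrow> Q x)" for Q
    using AL by (simp add: AE_restrict_space_iff AE_completion_iff)
  have f': "(\<lambda>x. ennreal \<bar>f x\<bar>) \<in> borel_measurable (lebesgue_on A)" using f by simp
  have "esssup (lebesgue_on A) (\<lambda>x. ennreal \<bar>f x\<bar>) \<le> ennreal M \<longleftrightarrow>
      (AE x in lebesgue_on A. ennreal \<bar>f x\<bar> \<le> ennreal M)"
    using esssup_I[OF f'] esssup_AE[of "\<lambda>x. ennreal \<bar>f x\<bar>" "lebesgue_on A"]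
    by (auto elim!: eventually_mono)
  then show ?thesis
    using True M by (simp add: Lp_norm_def Lp_le_def AE)
next
  case False
  have "(\<integral>\<^sup>+x. ennreal (\<bar>f x\<bar> powr enn2real p) \<partial>lebesgue_on A)
      = (\<integral>\<^sup>+x. ennreal (\<bar>f x\<bar> powr enn2real p) * indicator A x \<partial>lborel)"
    using A by (simp add: nn_integral_restrict_space nn_integral_completion)
  moreover have "0 < enn2real p" using enn2real_ge_1[OF p False] by simp
  ultimately show ?thesis
    using False M by (simp add: Lp_norm_def Lp_le_def epowr_le_iff)
qed

lemma Lp_norm_cong_AE:
  assumes "f \<in> borel_measurable (lebesgue_on A)" "g \<in> borel_measurable (lebesgue_on A)"
    and "A \<in> sets borel" "AE x in lborel. x \<in> A \<longrightarrow> f x = g x"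
  shows "Lp_norm p A f = Lp_norm p A g"
proof -
  have AE: "AE x in lebesgue_on A. f x = g x"
    using assms by (simp add: AE_restrict_space_iff AE_completion_iff)
  then have "esssup (lebesgue_on A) (\<lambda>x. ennreal \<bar>f x\<bar>) = esssup (lebesgue_on A) (\<lambda>x. ennreal \<bar>g x\<bar>)"
    using assms(1,2) by (intro esssup_AE_cong) auto
  moreover have "(\<integral>\<^sup>+x. ennreal (\<bar>f x\<bar> powr enn2real p) \<partial>lebesgue_on A)
     = (\<integral>\<^sup>+x. ennreal (\<bar>g x\<bar> powr enn2real p) \<partial>lebesgue_on A)"
    using AE by (intro nn_integral_cong_AE) auto
  ultimately show ?thesis by (simp add: Lp_norm_def)
qed

lemma Lp_le_mono_AE:
  assumes "AE x in lborel. x \<in> A \<longrightarrow> x \<in> B \<and> \<bar>f x\<bar> \<le> \<bar>g x\<bar>" and "Lp_le p B g M"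
  shows "Lp_le p A f M"
proof (cases "p = \<infinity>")
  case True
  then show ?thesis using assms unfolding Lp_le_def
    by (auto elim!: AE_mp)
next
  case False
  have "(\<integral>\<^sup>+x. ennreal (\<bar>f x\<bar> powr enn2real p) * indicator A x \<partial>lborel)
     \<le> (\<integral>\<^sup>+x. ennreal (\<bar>g x\<bar> powr enn2real p) * indicator B x \<partial>lborel)"
    using assms(1)
    by (intro nn_integral_mono_AE)
       (auto elim!: eventually_mono simp: indicator_def intro!: ennreal_leI powr_mono2)
  then show ?thesis using False assms(2) by (simp add: Lp_le_def)
qed

lemma Lp_le_mono:
  assumes "\<And>x. x \<in> A \<Longrightarrow> x \<in> B \<and> \<bar>f x\<bar> \<le> \<bar>g x\<bar>" and "Lp_le p B g M"
  shows "Lp_le p A f M"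
proof (rule Lp_le_mono_AE[OF _ assms(2)])
  show "AE x in lborel. x \<in> A \<longrightarrow> x \<in> B \<and> \<bar>f x\<bar> \<le> \<bar>g x\<bar>"
    using assms(1) by (intro AE_I2) blast
qed

lemma Lp_le_mono_bound:
  assumes "Lp_le p A f M" "0 \<le> M" "M \<le> N"
  shows "Lp_le p A f N"
proof (cases "p = \<infinity>")
  case True
  then show ?thesis using assms unfolding Lp_le_def by (auto elim!: eventually_mono)
next
  case False
  then have "(\<integral>\<^sup>+x. ennreal (\<bar>f x\<bar> powr enn2real p) * indicator A x \<partial>lborel) \<le> ennreal (M powr enn2real p)"
    using assms(1) by (simp add: Lp_le_def)
  also have "\<dots> \<le> ennreal (N powr enn2real p)"
    using assms by (intro ennreal_leI powr_mono2) auto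
  finally show ?thesis using False by (simp add: Lp_le_def)
qed

lemma Lp_le_scale:
  assumes "Lp_le p A f M" "0 \<le> M" "0 \<le> c" and f: "f \<in> borel_measurable borel" "A \<in> sets borel"
  shows "Lp_le p A (\<lambda>x. c * f x) (c * M)"
proof (cases "p = \<infinity>")
  case True
  then show ?thesis using assms unfolding Lp_le_def
    by (auto elim!: eventually_mono simp: abs_mult mult_left_mono)
next
  case False
  have "(\<integral>\<^sup>+x. ennreal (\<bar>c * f x\<bar> powr enn2real p) * indicator A x \<partial>lborel)
     = (\<integral>\<^sup>+x. ennreal (c powr enn2real p) * (ennreal (\<bar>f x\<bar> powr enn2real p) * indicator A x) \<partial>lborel)"
    using assms by (intro nn_integral_cong) (simp add: abs_mult powr_mult ennreal_mult mult.assoc)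
  also have "\<dots> = ennreal (c powr enn2real p) * (\<integral>\<^sup>+x. (ennreal (\<bar>f x\<bar> powr enn2real p) * indicator A x) \<partial>lborel)"
    using f by (intro nn_integral_cmult) auto
  also have "\<dots> \<le> ennreal (c powr enn2real p) * ennreal (M powr enn2real p)"
    using assms False by (intro mult_left_mono) (auto simp: Lp_le_def)
  also have "\<dots> = ennreal ((c * M) powr enn2real p)"
    using assms by (simp add: powr_mult ennreal_mult)
  finally show ?thesis using False by (simp add: Lp_le_def)
qed

text \<open>
  The factor 2 comes from \<open>(a + b)\<^sup>p \<le> (2 max a b)\<^sup>p \<le> 2\<^sup>p (a\<^sup>p + b\<^sup>p)\<close>; the embeddings leave all constants
  free. Sums of functions and unions of sets are both covered, because \<open>u\<close> only has to be bounded by the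
  sum of the truncated functions.
\<close>

lemma Lp_le_combine:
  assumes p: "1 \<le> p" and M: "0 \<le> M" "0 \<le> N"
    and f: "f \<in> borel_measurable borel" "A \<in> sets borel" "Lp_le p A f M"
    and g: "g \<in> borel_measurable borel" "B \<in> sets borel" "Lp_le p B g N"
    and u: "\<And>x. x \<in> C \<Longrightarrow> \<bar>u x\<bar> \<le> \<bar>f x\<bar> * indicator A x + \<bar>g x\<bar> * indicator B x"
  shows "Lp_le p C u (2 * (M + N))"
proof (cases "p = \<infinity>")
  case True
  have "AE x in lborel. \<bar>f x\<bar> * indicator A x \<le> M" "AE x in lborel. \<bar>g x\<bar> * indicator B x \<le> N"
    using f(3) g(3) M unfolding Lp_le_def if_P[OF True]
    by (auto elim!: eventually_mono simp: indicator_def)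
  then have "AE x in lborel. x \<in> C \<longrightarrow> \<bar>u x\<bar> \<le> 2 * (M + N)"
  proof eventually_elim
    case (elim x)
    then show ?case using u[of x] M by auto
  qed
  then show ?thesis using True by (simp add: Lp_le_def)
next
  case False
  define P where "P = enn2real p"
  have P: "1 \<le> P" using enn2real_ge_1[OF p False] by (simp add: P_def)
  have *: "\<bar>u x\<bar> powr P * indicator C x \<le> 2 powr P * (\<bar>f x\<bar> powr P * indicator A x + \<bar>g x\<bar> powr P * indicator B x)" for x
  proof (cases "x \<in> C")
    case True
    define a where "a = \<bar>f x\<bar> * indicator A x"
    define b where "b = \<bar>g x\<bar> * indicator B x"
    have ab: "0 \<le> a" "0 \<le> b" by (auto simp: a_def b_def)
    have "\<bar>u x\<bar> powr P \<le> (2 * max a b) powr P"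
      using u[OF True] P ab by (intro powr_mono2) (auto simp: a_def b_def)
    also have "\<dots> = 2 powr P * max a b powr P" using ab by (simp add: powr_mult)
    also have "max a b powr P \<le> a powr P + b powr P" by (simp add: max_def)
    finally have "\<bar>u x\<bar> powr P \<le> 2 powr P * (a powr P + b powr P)" by simp
    moreover have "a powr P = \<bar>f x\<bar> powr P * indicator A x" "b powr P = \<bar>g x\<bar> powr P * indicator B x"
      by (auto simp: a_def b_def indicator_def)
    ultimately show ?thesis using True by simp
  qed (simp add: zero_le_mult_iff)
  have "(\<integral>\<^sup>+x. ennreal (\<bar>u x\<bar> powr P) * indicator C x \<partial>lborel)
     \<le> (\<integral>\<^sup>+x. ennreal (2 powr P) * (ennreal (\<bar>f x\<bar> powr P) * indicator A x
                 + ennreal (\<bar>g x\<bar> powr P) * indicator B x) \<partial>lborel)"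
  proof (intro nn_integral_mono)
    fix x
    have "ennreal (\<bar>u x\<bar> powr P) * indicator C x = ennreal (\<bar>u x\<bar> powr P * indicator C x)"
      by (simp add: indicator_def)
    also have "\<dots> \<le> ennreal (2 powr P * (\<bar>f x\<bar> powr P * indicator A x + \<bar>g x\<bar> powr P * indicator B x))"
      by (intro ennreal_leI *)
    also have "\<dots> = ennreal (2 powr P) * (ennreal (\<bar>f x\<bar> powr P) * indicator A x
                 + ennreal (\<bar>g x\<bar> powr P) * indicator B x)"
      by (simp add: indicator_def ennreal_mult)
    finally show "ennreal (\<bar>u x\<bar> powr P) * indicator C x \<le> \<dots>" .
  qed
  also have "\<dots> = ennreal (2 powr P) * ((\<integral>\<^sup>+x. ennreal (\<bar>f x\<bar> powr P) * indicator A x \<partial>lborel)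
                 + (\<integral>\<^sup>+x. ennreal (\<bar>g x\<bar> powr P) * indicator B x \<partial>lborel))"
    using f(1,2) g(1,2) by (subst nn_integral_cmult, simp) (subst nn_integral_add, auto)
  also have "\<dots> \<le> ennreal (2 powr P) * (ennreal (M powr P) + ennreal (N powr P))"
    using f(3) g(3) False by (intro mult_left_mono add_mono) (auto simp: Lp_le_def P_def)
  also have "\<dots> = ennreal (2 powr P * (M powr P + N powr P))"
    by (simp add: ennreal_mult)
  also have "\<dots> \<le> ennreal ((2 * (M + N)) powr P)"
  proof (intro ennreal_leI)
    have "M powr P + N powr P \<le> (M + N) powr P"
    proof (cases "M + N = 0")
      case True
      then have "M = 0" "N = 0" using M by auto
      then show ?thesis by simp
    next
      case False
      then have s: "0 < M + N" using M by simp
      have 1: "x powr P \<le> (x / (M+N)) * (M + N) powr P" if "0 \<le> x" "x \<le> M + N" for x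
      proof -
        have "(x / (M+N)) powr P \<le> (x / (M+N)) powr 1"
          using that s P by (intro powr_mono') auto
        then have "(x / (M+N)) powr P * (M+N) powr P \<le> (x / (M+N)) * (M + N) powr P"
          using that s by (intro mult_right_mono) auto
        then show ?thesis using that s by (simp add: powr_divide)
      qed
      have "M powr P + N powr P \<le> (M / (M+N)) * (M + N) powr P + (N / (M+N)) * (M + N) powr P"
        using M by (intro add_mono 1) auto
      also have "\<dots> = (M + N) powr P"
        using s by (simp add: distrib_right[symmetric] add_divide_distrib[symmetric])
      finally show ?thesis .
    qed
    then show "2 powr P * (M powr P + N powr P) \<le> (2 * (M + N)) powr P"
      using M by (simp add: powr_mult del: distrib_left_numeral)
  qed
  finally show ?thesis using False by (simp add: Lp_le_def P_def)
qed

lemma Lp_le_add: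
  assumes "1 \<le> p" "0 \<le> M" "0 \<le> N" "A \<in> sets borel"
    and "f \<in> borel_measurable borel" "Lp_le p A f M"
    and "g \<in> borel_measurable borel" "Lp_le p A g N"
  shows "Lp_le p A (\<lambda>x. f x + g x) (2 * (M + N))"
  by (rule Lp_le_combine[OF assms(1-3,5,4,6,7,4,8)]) auto

lemma Lp_le_Un:
  assumes "1 \<le> p" "0 \<le> M" "0 \<le> N" "A \<in> sets borel" "B \<in> sets borel"
    and "f \<in> borel_measurable borel" "Lp_le p A f M" "Lp_le p B f N"
  shows "Lp_le p (A \<union> B) f (2 * (M + N))"
  by (rule Lp_le_combine[OF assms(1-3,6,4,7,6,5,8)]) (auto simp: indicator_def)

lemma Lp_le_affine:
  assumes f: "f \<in> borel_measurable borel" and A: "A \<in> sets borel" and c: "\<bar>c\<bar> = 1"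
    and "Lp_le p A f M"
  shows "Lp_le p {x. t + c * x \<in> A} (\<lambda>x. f (t + c * x)) M"
proof (cases "p = \<infinity>")
  case True
  have "c \<noteq> 0" using c by auto
  define S where "S = {x \<in> A. M < \<bar>f x\<bar>}"
  have "S = A \<inter> (\<lambda>x. \<bar>f x\<bar>) -` {M<..}" by (auto simp: S_def)
  then have S[measurable]: "S \<in> sets borel" using f A by (auto intro!: measurable_sets_borel)
  have "AE x in lborel. x \<notin> S"
    using assms(4) True by (auto simp: Lp_le_def S_def elim!: eventually_mono)
  then have "(\<integral>\<^sup>+x. indicator S x \<partial>lborel) = 0"
    by (subst nn_integral_0_iff_AE) (auto simp: indicator_def)
  then have "(\<integral>\<^sup>+x. indicator S (t + c * x) \<partial>lborel) = (0::ennreal)"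
    using c by (subst (asm) nn_integral_real_affine[OF _ \<open>c \<noteq> 0\<close>, of _ t]) auto
  then have "AE x in lborel. indicator S (t + c * x) = (0::ennreal)"
    by (subst (asm) nn_integral_0_iff_AE) auto
  then have "AE x in lborel. t + c * x \<in> A \<longrightarrow> \<bar>f (t + c * x)\<bar> \<le> M"
    by eventually_elim (auto simp: S_def indicator_def split: if_splits)
  then show ?thesis using True by (simp add: Lp_le_def)
next
  case False
  have "c \<noteq> 0" using c by auto
  have "(\<integral>\<^sup>+x. ennreal (\<bar>f x\<bar> powr enn2real p) * indicator A x \<partial>lborel)
    = (\<integral>\<^sup>+x. ennreal (\<bar>f (t + c * x)\<bar> powr enn2real p) * indicator A (t + c * x) \<partial>lborel)"
    using f A c by (subst nn_integral_real_affine[OF _ \<open>c \<noteq> 0\<close>, of _ t]) auto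
  then show ?thesis using False assms(4) by (simp add: Lp_le_def indicator_def)
qed

lemma Lp_le_const:
  assumes "A \<subseteq> {0..<1}" "0 \<le> M" "1 \<le> p" "\<And>x. x \<in> A \<Longrightarrow> \<bar>f x\<bar> \<le> M"
  shows "Lp_le p A f M"
proof (cases "p = \<infinity>")
  case True
  then show ?thesis using assms by (simp add: Lp_le_def)
next
  case False
  have "(\<integral>\<^sup>+x. ennreal (\<bar>f x\<bar> powr enn2real p) * indicator A x \<partial>lborel)
     \<le> (\<integral>\<^sup>+x. ennreal (M powr enn2real p) * indicator {0..<1::real} x \<partial>lborel)"
    using assms by (intro nn_integral_mono) (auto simp: indicator_def intro!: ennreal_leI powr_mono2)
  also have "\<dots> = ennreal (M powr enn2real p)"
    by (subst nn_integral_cmult) auto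
  finally show ?thesis using False by (simp add: Lp_le_def)
qed

text \<open>
  Jensen's inequality, obtained by integrating the tangent line of \<open>x\<^sup>P\<close> at the mean of \<open>\<bar>X\<bar>\<close>. If \<open>X\<close> is not
  integrable then its expectation is 0 by convention.
\<close>

lemma (in prob_space) powr_expectation_le:
  assumes "1 \<le> P" and X: "X \<in> borel_measurable M"
  shows "ennreal (\<bar>expectation X\<bar> powr P) \<le> (\<integral>\<^sup>+\<omega>. ennreal (\<bar>X \<omega>\<bar> powr P) \<partial>M)"
proof (cases "(\<integral>\<^sup>+\<omega>. ennreal (\<bar>X \<omega>\<bar> powr P) \<partial>M) = \<infinity>")
  case True
  then show ?thesis by simp
next
  case False
  have iP: "integrable M (\<lambda>\<omega>. \<bar>X \<omega>\<bar> powr P)"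
    using X False by (intro integrableI_bounded) (auto simp: less_top)
  have i1: "integrable M (\<lambda>\<omega>. \<bar>X \<omega>\<bar>)"
  proof (rule Bochner_Integration.integrable_bound)
    show "integrable M (\<lambda>\<omega>. 1 + \<bar>X \<omega>\<bar> powr P)" using iP by simp
    have "\<bar>x\<bar> \<le> 1 + \<bar>x\<bar> powr P" for x :: real
    proof (cases "\<bar>x\<bar> \<le> 1")
      case False
      then have "\<bar>x\<bar> powr 1 \<le> \<bar>x\<bar> powr P" using assms(1) by (intro powr_mono) auto
      then show ?thesis using False by simp
    qed (simp add: add_increasing2)
    then show "AE \<omega> in M. norm \<bar>X \<omega>\<bar> \<le> norm (1 + \<bar>X \<omega>\<bar> powr P)" by auto
  qed (use X in auto)
  have "expectation (\<lambda>\<omega>. \<bar>X \<omega>\<bar>) powr P \<le> expectation (\<lambda>\<omega>. \<bar>X \<omega>\<bar> powr P)"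
  proof (cases "expectation (\<lambda>\<omega>. \<bar>X \<omega>\<bar>) = 0")
    case True
    then show ?thesis by simp
  next
    case False
    define c where "c = expectation (\<lambda>\<omega>. \<bar>X \<omega>\<bar>)"
    have c: "0 < c" using False unfolding c_def by (simp add: order_less_le)
    have conv: "c powr P + P * c powr (P - 1) * (x - c) \<le> x powr P" if "0 \<le> x" for x
    proof (cases "x = 0")
      case True
      have "c powr P = c * c powr (P - 1)" using c by (simp add: powr_mult_base)
      then have "c powr P + P * c powr (P - 1) * (x - c) = (1 - P) * c powr P"
        using True by (simp add: algebra_simps)
      also have "\<dots> \<le> 0" using assms(1) by (simp add: mult_nonpos_nonneg)
      finally show ?thesis using True by simp
    next
      case False
      have "x powr P - c powr P \<ge> P * c powr (P - 1) * (x - c)"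
        using c that False assms(1)
        by (intro convex_on_imp_above_tangent[OF powr_convex[OF assms(1)]])
           (auto intro!: derivative_eq_intros simp: interior_open)
      then show ?thesis by simp
    qed
    have "c powr P = expectation (\<lambda>\<omega>. c powr P + P * c powr (P - 1) * (\<bar>X \<omega>\<bar> - c))"
      using i1 by (simp add: c_def prob_space)
    also have "\<dots> \<le> expectation (\<lambda>\<omega>. \<bar>X \<omega>\<bar> powr P)"
      using i1 iP by (intro integral_mono conv) auto
    finally show ?thesis by (simp add: c_def)
  qed
  moreover have "\<bar>expectation X\<bar> powr P \<le> expectation (\<lambda>\<omega>. \<bar>X \<omega>\<bar>) powr P"
    using assms(1) by (intro powr_mono2 integral_abs_bound) auto
  ultimately have "ennreal (\<bar>expectation X\<bar> powr P) \<le> ennreal (expectation (\<lambda>\<omega>. \<bar>X \<omega>\<bar> powr P))"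
    by (intro ennreal_leI) simp
  also have "\<dots> = (\<integral>\<^sup>+\<omega>. ennreal (\<bar>X \<omega>\<bar> powr P) \<partial>M)"
    using iP by (simp add: nn_integral_eq_integral)
  finally show ?thesis .
qed


text \<open>
  Minkowski's integral inequality for a probability measure: for finite \<open>p\<close> it follows from Jensen's
  inequality and Fubini's theorem, for \<open>p = \<infinity>\<close> from exchanging two almost-everywhere quantifiers.
\<close>

lemma Lp_le_average:
  assumes p: "1 \<le> p" and mu: "prob_space \<mu>" and A: "A \<in> sets borel" and M: "0 \<le> M"
    and F: "case_prod F \<in> borel_measurable (\<mu> \<Otimes>\<^sub>M lborel)"
    and le: "AE s in \<mu>. Lp_le p A (F s) M"
  shows "Lp_le p A (\<lambda>x. \<integral>s. F s x \<partial>\<mu>) M"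
proof -
  interpret mu: prob_space \<mu> by (rule mu)
  interpret pair_sigma_finite \<mu> lborel ..
  have F2[measurable]: "(\<lambda>s. F s x) \<in> borel_measurable \<mu>" for x
    using measurable_Pair1[OF F, of x] by simp
  show ?thesis
  proof (cases "p = \<infinity>")
    case True
    have "AE s in \<mu>. AE x in lborel. x \<in> A \<longrightarrow> \<bar>F s x\<bar> \<le> M"
      using le True by (simp add: Lp_le_def)
    moreover have "(\<lambda>z. F (fst z) (snd z)) \<in> borel_measurable (\<mu> \<Otimes>\<^sub>M lborel)"
      using F by (simp add: case_prod_beta')
    then have "{z \<in> space (\<mu> \<Otimes>\<^sub>M lborel). snd z \<in> A \<longrightarrow> \<bar>F (fst z) (snd z)\<bar> \<le> M} \<in> sets (\<mu> \<Otimes>\<^sub>M lborel)"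
      using A by measurable
    ultimately have "AE x in lborel. AE s in \<mu>. x \<in> A \<longrightarrow> \<bar>F s x\<bar> \<le> M"
      using AE_commute[of "\<lambda>s x. x \<in> A \<longrightarrow> \<bar>F s x\<bar> \<le> M"] by simp
    then have "AE x in lborel. x \<in> A \<longrightarrow> \<bar>\<integral>s. F s x \<partial>\<mu>\<bar> \<le> M"
    proof eventually_elim
      case (elim x)
      show ?case
      proof
        assume "x \<in> A"
        with elim have "AE s in \<mu>. \<bar>F s x\<bar> \<le> M" by simp
        moreover from this have "integrable \<mu> (\<lambda>s. F s x)"
          by (intro mu.integrable_const_bound[where B = M]) auto
        ultimately have "(\<integral>s. \<bar>F s x\<bar> \<partial>\<mu>) \<le> (\<integral>s. M \<partial>\<mu>)"
          by (intro integral_mono_AE) auto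
        with order_trans[OF integral_abs_bound[of \<mu> "\<lambda>s. F s x"]] show "\<bar>\<integral>s. F s x \<partial>\<mu>\<bar> \<le> M" by (simp add: mu.prob_space)
      qed
    qed
    then show ?thesis using True by (simp add: Lp_le_def)
  next
    case False
    define P where "P = enn2real p"
    have P: "1 \<le> P" using enn2real_ge_1[OF p False] by (simp add: P_def)
    have "(\<integral>\<^sup>+x. ennreal (\<bar>\<integral>s. F s x \<partial>\<mu>\<bar> powr P) * indicator A x \<partial>lborel)
       \<le> (\<integral>\<^sup>+x. (\<integral>\<^sup>+s. ennreal (\<bar>F s x\<bar> powr P) * indicator A x \<partial>\<mu>) \<partial>lborel)"
    proof (intro nn_integral_mono)
      fix x
      have "ennreal (\<bar>\<integral>s. F s x \<partial>\<mu>\<bar> powr P) * indicator A x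
         \<le> (\<integral>\<^sup>+s. ennreal (\<bar>F s x\<bar> powr P) \<partial>\<mu>) * indicator A x"
        by (intro mult_right_mono mu.powr_expectation_le P F2) auto
      also have "\<dots> = (\<integral>\<^sup>+s. ennreal (\<bar>F s x\<bar> powr P) * indicator A x \<partial>\<mu>)"
        by (simp add: nn_integral_multc)
      finally show "ennreal (\<bar>\<integral>s. F s x \<partial>\<mu>\<bar> powr P) * indicator A x \<le> \<dots>" .
    qed
    also have "\<dots> = (\<integral>\<^sup>+s. (\<integral>\<^sup>+x. ennreal (\<bar>F s x\<bar> powr P) * indicator A x \<partial>lborel) \<partial>\<mu>)"
      using F A by (intro Fubini') (auto simp: case_prod_beta')
    also have "\<dots> \<le> (\<integral>\<^sup>+s. ennreal (M powr P) \<partial>\<mu>)"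
      using le False by (intro nn_integral_mono_AE) (auto simp: Lp_le_def P_def)
    also have "\<dots> = ennreal (M powr P)" by (simp add: mu.emeasure_space_1)
    finally show ?thesis using False by (simp add: Lp_le_def P_def)
  qed
qed


lemma integral_uniform_Icc:
  fixes f :: "real \<Rightarrow> real"
  assumes "a < b" and f: "f \<in> borel_measurable borel"
  shows "(\<integral>x. f x \<partial>uniform_measure lborel {a..b}) = (LBINT x. f x * indicator {a..b} x) / (b - a)"
proof -
  have "uniform_measure lborel {a..b} = density lborel (\<lambda>x. ennreal (indicator {a..b} x / (b - a)))"
    unfolding uniform_measure_def using assms
    by (intro arg_cong[where f = "density lborel"]) (auto simp: fun_eq_iff indicator_def divide_ennreal simp flip: ennreal_1)
  then have "(\<integral>x. f x \<partial>uniform_measure lborel {a..b}) = (LBINT x. (indicator {a..b} x / (b - a)) *\<^sub>R f x)"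
    using assms by (simp add: integral_density)
  then show ?thesis by (simp add: mult.commute)
qed

lemma prob_space_uniform_Icc: "a < b \<Longrightarrow> prob_space (uniform_measure lborel {a..b::real})"
  by (intro prob_space_uniform_measure) auto

lemma Lp_le_mean:
  assumes "1 \<le> p" "a < b" "A \<in> sets borel" "0 \<le> M"
    and F: "case_prod F \<in> borel_measurable (borel \<Otimes>\<^sub>M borel)"
    and le: "\<And>s. a \<le> s \<Longrightarrow> s \<le> b \<Longrightarrow> Lp_le p A (F s) M"
  shows "Lp_le p A (\<lambda>x. (LBINT s. F s x * indicator {a..b} s) / (b - a)) M"
proof -
  have F2: "(\<lambda>s. F s x) \<in> borel_measurable borel" for x
    using measurable_Pair1[OF F, of x] by simp
  have "Lp_le p A (\<lambda>x. \<integral>s. F s x \<partial>uniform_measure lborel {a..b}) M"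
  proof (rule Lp_le_average[OF assms(1) prob_space_uniform_Icc[OF assms(2)] assms(3,4)])
    have "sets (uniform_measure lborel {a..b} \<Otimes>\<^sub>M lborel) = sets (borel \<Otimes>\<^sub>M borel :: (real \<times> real) measure)"
      by (intro sets_pair_measure_cong) auto
    then show "case_prod F \<in> borel_measurable (uniform_measure lborel {a..b} \<Otimes>\<^sub>M lborel)"
      using F by (simp cong: measurable_cong_sets)
    show "AE s in uniform_measure lborel {a..b}. Lp_le p A (F s) M"
      using le by (intro AE_uniform_measureI) auto
  qed
  then show ?thesis by (simp add: integral_uniform_Icc[OF assms(2) F2])
qed

text \<open>
  Jensen's inequality again, as the uniform measure on the unit interval is a probability measure.
\<close>

lemma Lp_le_imp_integrable:
  assumes p: "1 \<le> p" and f: "f \<in> borel_measurable borel" and M: "0 \<le> M"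
    and le: "Lp_le p {0..<1} f M" and z: "\<And>x. x \<notin> {0<..<1} \<Longrightarrow> f x = 0"
  shows "integrable lborel f" "(LBINT x. \<bar>f x\<bar>) \<le> M"
proof -
  interpret prob_space "uniform_measure lborel {0..1::real}" by (rule prob_space_uniform_Icc) simp
  have fz: "\<bar>f x\<bar> * indicator {0..1} x = \<bar>f x\<bar>" for x
    using z[of x] by (cases "x \<in> {0<..<1}") simp_all
  have "integrable lborel f \<and> (LBINT x. \<bar>f x\<bar>) \<le> M"
  proof (cases "p = \<infinity>")
    case True
    have AE: "AE x in lborel. \<bar>f x\<bar> \<le> M * indicator {0..<1} x"
    proof -
      have "AE x in lborel. x \<in> {0..<1} \<longrightarrow> \<bar>f x\<bar> \<le> M" using le True by (simp add: Lp_le_def)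
      then show ?thesis
      proof eventually_elim
        case (elim x)
        then show ?case using z[of x] M by (cases "x \<in> {0<..<1}") (auto simp: indicator_def)
      qed
    qed
    have i: "integrable lborel (\<lambda>x. M * indicator {0..<1::real} x)" by simp
    have "integrable lborel f"
      by (rule Bochner_Integration.integrable_bound[OF i]) (use AE f M in \<open>auto elim!: eventually_mono\<close>)
    moreover from this have "(LBINT x. \<bar>f x\<bar>) \<le> (LBINT x. M * indicator {0..<1::real} x)"
      using AE i by (intro integral_mono_AE) auto
    ultimately show ?thesis by simp
  next
    case False
    define P where "P = enn2real p"
    have P: "1 \<le> P" using enn2real_ge_1[OF p False] by (simp add: P_def)
    have fP: "ennreal (\<bar>f x\<bar> powr P) * indicator {0..<1} x = ennreal (\<bar>f x\<bar> powr P)"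
      "ennreal (\<bar>f x\<bar> powr P) * indicator {0..1} x = ennreal (\<bar>f x\<bar> powr P)" for x
      using z[of x] by (cases "x \<in> {0<..<1}"; simp)+
    have le': "(\<integral>\<^sup>+x. ennreal (\<bar>f x\<bar> powr P) * indicator {0..<1} x \<partial>lborel) \<le> ennreal (M powr P)"
      using le False by (simp add: Lp_le_def P_def)
    have iP: "integrable lborel (\<lambda>x. \<bar>f x\<bar> powr P)"
    proof (rule integrableI_bounded)
      have "(\<integral>\<^sup>+x. ennreal (norm (\<bar>f x\<bar> powr P)) \<partial>lborel) = (\<integral>\<^sup>+x. ennreal (\<bar>f x\<bar> powr P) * indicator {0..<1} x \<partial>lborel)"
        by (simp only: fP) simp
      then show "(\<integral>\<^sup>+x. ennreal (norm (\<bar>f x\<bar> powr P)) \<partial>lborel) < \<infinity>" using le' by (auto intro: le_less_trans)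
    qed (use f in auto)
    have "integrable lborel (\<lambda>x. indicator {0..<1} x + \<bar>f x\<bar> powr P)"
      using iP by simp
    then have i: "integrable lborel f"
    proof (rule Bochner_Integration.integrable_bound)
      show "AE x in lborel. norm (f x) \<le> norm (indicator {0..<1} x + \<bar>f x\<bar> powr P)"
      proof (intro AE_I2)
        fix x
        show "norm (f x) \<le> norm (indicator {0..<1} x + \<bar>f x\<bar> powr P)"
        proof (cases "\<bar>f x\<bar> \<le> 1")
          case True
          then show ?thesis using z[of x]
            by (cases "x \<in> {0<..<1}") (simp_all add: indicator_def add_increasing2)
        next
          case False
          then have "\<bar>f x\<bar> powr 1 \<le> \<bar>f x\<bar> powr P" using P by (intro powr_mono) auto
          then show ?thesis using False by (simp add: add_increasing)
        qed
      qed
    qed (use f in auto)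
    have "ennreal ((LBINT x. \<bar>f x\<bar>) powr P) \<le> (\<integral>\<^sup>+x. ennreal (\<bar>f x\<bar> powr P) \<partial>uniform_measure lborel {0..1})"
      using powr_expectation_le[OF P, of "\<lambda>x. \<bar>f x\<bar>"] f
      by (simp add: integral_uniform_Icc fz cong: measurable_cong_sets)
    also have "\<dots> = (\<integral>\<^sup>+x. ennreal (\<bar>f x\<bar> powr P) * indicator {0..1} x \<partial>lborel)"
      using f by (subst nn_integral_uniform_measure) (auto simp: divide_ennreal_def)
    also have "\<dots> = (\<integral>\<^sup>+x. ennreal (\<bar>f x\<bar> powr P) * indicator {0..<1} x \<partial>lborel)"
      by (simp only: fP)
    also have "\<dots> \<le> ennreal (M powr P)" by (rule le')
    finally have "(LBINT x. \<bar>f x\<bar>) powr P \<le> M powr P" by (simp add: ennreal_le_iff)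
    then have "(LBINT x. \<bar>f x\<bar>) \<le> M"
      using M P by (meson not_le powr_less_mono2 less_le_trans zero_less_one)
    with i show ?thesis ..
  qed
  then show "integrable lborel f" "(LBINT x. \<bar>f x\<bar>) \<le> M" by auto
qed

text \<open>
  Elements of \<open>L\<^sup>p\<close> are only Lebesgue measurable on \<open>[0,1)\<close> and arbitrary elsewhere. A Borel representative
  that vanishes outside the interval can be translated, reflected and used in iterated integrals.
\<close>

lemma borel_version:
  fixes f :: "real \<Rightarrow> real"
  assumes f: "f \<in> borel_measurable (lebesgue_on {0..<1})"
  obtains g where "g \<in> borel_measurable borel" "\<And>x. x \<notin> {0<..<1} \<Longrightarrow> g x = 0"
    "AE x in lborel. x \<in> {0..<1} \<longrightarrow> f x = g x"
proof -
  have "(\<lambda>x. f x * indicator {0..<1} x) \<in> borel_measurable lebesgue"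
    using f by (simp add: borel_measurable_restrict_space_iff mult.commute)
  then obtain g where g: "g \<in> borel_measurable lborel" "AE x in lborel. f x * indicator {0..<1} x = g x"
    using completion_ex_borel_measurable_real by blast
  have 0: "AE x in lborel. x \<noteq> (0::real)" by (rule AE_lborel_singleton)
  show ?thesis
  proof (rule that[of "\<lambda>x. g x * indicator {0<..<1} x"])
    show "AE x in lborel. x \<in> {0..<1} \<longrightarrow> f x = g x * indicator {0<..<1} x"
      using g(2) 0 by eventually_elim (auto simp: indicator_def)
  qed (use g in auto)
qed


lemma fdiff_funpow:
  "(fdiff h ^^ j) u x = (\<Sum>l\<le>j. (-1) ^ (j + l) * real (j choose l) * u (x + real l * h))"
proof (induction j arbitrary: x)
  case (Suc j)
  let ?c = "\<lambda>j l. (-1) ^ (j + l) * real (j choose l)"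
  have "(fdiff h ^^ Suc j) u x = (\<Sum>l\<le>j. ?c j l * u (x + h + real l * h)) - (\<Sum>l\<le>j. ?c j l * u (x + real l * h))"
    by (simp add: fdiff_def Suc.IH)
  also have "(\<Sum>l\<le>j. ?c j l * u (x + real l * h)) = (\<Sum>l\<le>Suc j. ?c j l * u (x + real l * h))"
    by simp
  also have "\<dots> = ?c j 0 * u x + (\<Sum>l\<le>j. ?c j (Suc l) * u (x + real (Suc l) * h))"
    by (subst sum.atMost_Suc_shift) simp
  also have "(\<Sum>l\<le>j. ?c j l * u (x + h + real l * h)) - \<dots>
     = ?c (Suc j) 0 * u x + (\<Sum>l\<le>j. ?c (Suc j) (Suc l) * u (x + real (Suc l) * h))"
    by (simp add: sum_subtractf[symmetric] algebra_simps sum.distrib sum_negf)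
  also have "\<dots> = (\<Sum>l\<le>Suc j. ?c (Suc j) l * u (x + real l * h))"
    by (subst sum.atMost_Suc_shift) simp
  finally show ?case .
qed simp

section \<open>Tensor networks\<close>

lemma compl_S_le_compl_C: "compl_S b m v \<le> compl_C b m v"
proof -
  have 1: "card {(i, k). i < b \<and> k \<in> {1..tn_rank v 1} \<and> tn_first v i k \<noteq> 0} \<le> b * tn_rank v 1"
  proof -
    have "card {(i, k). i < b \<and> k \<in> {1..tn_rank v 1} \<and> tn_first v i k \<noteq> 0}
        \<le> card ({..<b} \<times> {1..tn_rank v 1})" by (intro card_mono) auto
    then show ?thesis by simp
  qed
  have 2: "card {(i, k, l). i < b \<and> k \<in> {1..tn_rank v (\<nu> - 1)} \<and> l \<in> {1..tn_rank v \<nu>}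
                           \<and> tn_core v \<nu> i k l \<noteq> 0} \<le> b * (tn_rank v (\<nu> - 1) * tn_rank v \<nu>)" for \<nu>
  proof -
    have "card {(i, k, l). i < b \<and> k \<in> {1..tn_rank v (\<nu> - 1)} \<and> l \<in> {1..tn_rank v \<nu>}
                           \<and> tn_core v \<nu> i k l \<noteq> 0}
        \<le> card ({..<b} \<times> {1..tn_rank v (\<nu> - 1)} \<times> {1..tn_rank v \<nu>})" by (intro card_mono) auto
    then show ?thesis by (simp add: card_cartesian_product)
  qed
  have 3: "card {(k, l). k \<in> {1..tn_rank v (tn_depth v)} \<and> l \<in> {1..m+1} \<and> tn_last v k l \<noteq> 0}
      \<le> tn_rank v (tn_depth v) * (m + 1)"
  proof -
    have "card {(k, l). k \<in> {1..tn_rank v (tn_depth v)} \<and> l \<in> {1..m+1} \<and> tn_last v k l \<noteq> 0}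
        \<le> card ({1..tn_rank v (tn_depth v)} \<times> {1..m+1})" by (intro card_mono) auto
    then show ?thesis by (simp only: card_cartesian_product) simp
  qed
  show ?thesis
    unfolding compl_S_def compl_C_def sum_distrib_left
    by (intro add_mono sum_mono 1 2 3)
qed

text \<open>
  Each product of neighbouring ranks occurs in the square of the sum of all ranks.
\<close>

lemma compl_C_le_compl_N_squared:
  assumes "tn_wf v"
  shows "compl_C b m v \<le> (2 * b + m + 1) * (compl_N b m v)\<^sup>2"
proof -
  define N where "N = compl_N b m v"
  have d: "tn_depth v \<ge> 1" using assms by (simp add: tn_wf_def)
  have le: "tn_rank v \<nu> \<le> N" if "\<nu> \<in> {1..tn_depth v}" for \<nu>
    unfolding N_def compl_N_def by (rule member_le_sum) (use that in auto)
  have "1 \<le> tn_rank v 1" using assms d by (simp add: tn_wf_def)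
  then have N1: "1 \<le> N" using le[of 1] d by simp
  have sq: "x \<le> N\<^sup>2" if "x \<le> N" for x
    using that N1 by (metis le_trans power2_nat_le_imp_le power2_eq_square mult_le_mono1 mult_1 nat_mult_1)
  have "(\<Sum>k=2..tn_depth v. tn_rank v (k - 1) * tn_rank v k) \<le> (\<Sum>k=2..tn_depth v. N * tn_rank v k)"
    by (intro sum_mono mult_right_mono le) auto
  also have "\<dots> = N * (\<Sum>k=2..tn_depth v. tn_rank v k)" by (simp add: sum_distrib_left)
  also have "\<dots> \<le> N * N"
    unfolding N_def compl_N_def by (intro mult_left_mono sum_mono2) auto
  finally have 2: "(\<Sum>k=2..tn_depth v. tn_rank v (k - 1) * tn_rank v k) \<le> N\<^sup>2"
    by (simp add: power2_eq_square)
  have "compl_C b m v \<le> b * N\<^sup>2 + b * N\<^sup>2 + N\<^sup>2 * (m + 1)"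
    unfolding compl_C_def using d by (intro add_mono mult_mono sq le 2) auto
  then show ?thesis by (simp add: N_def algebra_simps)
qed

text \<open>
  The row vector that results from contracting the first \<open>n + 1\<close> tensors of a network with the digits
  \<open>i 1, \<dots>, i (n + 1)\<close>. The realization is computed from left to right by a recursion on this vector, in place
  of a sum over all multi-indices.
\<close>

primrec tn_left :: "tensor_network \<Rightarrow> (nat \<Rightarrow> nat) \<Rightarrow> nat \<Rightarrow> nat \<Rightarrow> real" where
  "tn_left v i 0 k = tn_first v (i 1) k"
| "tn_left v i (Suc n) k = (\<Sum>k'=1..tn_rank v (Suc n).
     tn_left v i n k' * tn_core v (Suc (Suc n)) (i (Suc (Suc n))) k' k)"

lemma sum_PiE_insert:
  fixes g :: "('a \<Rightarrow> 'b) \<Rightarrow> real"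
  assumes "x \<notin> S"
  shows "(\<Sum>k\<in>PiE (insert x S) T. g k) = (\<Sum>y\<in>T x. \<Sum>k\<in>PiE S T. g (k(x := y)))"
proof -
  have "(\<Sum>k\<in>PiE (insert x S) T. g k) = (\<Sum>z\<in>T x \<times> PiE S T. g (case z of (y, k) \<Rightarrow> k(x := y)))"
    unfolding PiE_insert_eq
    by (subst sum.reindex) (auto simp: o_def intro!: inj_combinator[OF assms])
  also have "\<dots> = (\<Sum>y\<in>T x. \<Sum>k\<in>PiE S T. g (k(x := y)))"
    by (subst sum.cartesian_product) (simp add: case_prod_beta)
  finally show ?thesis .
qed

lemma sum_tn_left:
  "(\<Sum>k \<in> PiE {1..Suc n} (\<lambda>\<nu>. {1..tn_rank v \<nu>}).
      tn_first v (i 1) (k 1) * (\<Prod>\<nu>=2..Suc n. tn_core v \<nu> (i \<nu>) (k (\<nu> - 1)) (k \<nu>)) * G (k (Suc n)))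
   = (\<Sum>k=1..tn_rank v (Suc n). tn_left v i n k * G k)"
proof (induction n arbitrary: G)
  case 0
  have "{1..Suc 0} = insert 1 {}" by auto
  then show ?case unfolding \<open>{1..Suc 0} = insert 1 {}\<close> by (subst sum_PiE_insert) auto
next
  case (Suc n)
  let ?x = "Suc (Suc n)"
  have "{1..?x} = insert ?x {1..Suc n}" by auto
  then have "(\<Sum>k \<in> PiE {1..?x} (\<lambda>\<nu>. {1..tn_rank v \<nu>}).
      tn_first v (i 1) (k 1) * (\<Prod>\<nu>=2..?x. tn_core v \<nu> (i \<nu>) (k (\<nu> - 1)) (k \<nu>)) * G (k ?x))
    = (\<Sum>y=1..tn_rank v ?x. \<Sum>k\<in>PiE {1..Suc n} (\<lambda>\<nu>. {1..tn_rank v \<nu>}).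
      tn_first v (i 1) ((k(?x := y)) 1)
       * (\<Prod>\<nu>=2..?x. tn_core v \<nu> (i \<nu>) ((k(?x := y)) (\<nu> - 1)) ((k(?x := y)) \<nu>)) * G y)"
    by (simp only:) (subst sum_PiE_insert, auto)
  also have "\<dots> = (\<Sum>y=1..tn_rank v ?x. \<Sum>k\<in>PiE {1..Suc n} (\<lambda>\<nu>. {1..tn_rank v \<nu>}).
      tn_first v (i 1) (k 1) * (\<Prod>\<nu>=2..Suc n. tn_core v \<nu> (i \<nu>) (k (\<nu> - 1)) (k \<nu>))
       * (tn_core v ?x (i ?x) (k (Suc n)) y * G y))"
  proof (intro sum.cong refl)
    fix y k
    have "(\<Prod>\<nu>=2..?x. tn_core v \<nu> (i \<nu>) ((k(?x := y)) (\<nu> - 1)) ((k(?x := y)) \<nu>))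
      = (\<Prod>\<nu>=2..Suc n. tn_core v \<nu> (i \<nu>) ((k(?x := y)) (\<nu> - 1)) ((k(?x := y)) \<nu>))
        * tn_core v ?x (i ?x) (k (Suc n)) y"
      by (subst prod.nat_ivl_Suc') (auto simp: mult.commute)
    also have "(\<Prod>\<nu>=2..Suc n. tn_core v \<nu> (i \<nu>) ((k(?x := y)) (\<nu> - 1)) ((k(?x := y)) \<nu>))
      = (\<Prod>\<nu>=2..Suc n. tn_core v \<nu> (i \<nu>) (k (\<nu> - 1)) (k \<nu>))"
      by (intro prod.cong) auto
    finally have E: "(\<Prod>\<nu>=2..?x. tn_core v \<nu> (i \<nu>) ((k(?x := y)) (\<nu> - 1)) ((k(?x := y)) \<nu>))
      = (\<Prod>\<nu>=2..Suc n. tn_core v \<nu> (i \<nu>) (k (\<nu> - 1)) (k \<nu>)) * tn_core v ?x (i ?x) (k (Suc n)) y" .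
    show "tn_first v (i 1) ((k(?x := y)) 1)
       * (\<Prod>\<nu>=2..?x. tn_core v \<nu> (i \<nu>) ((k(?x := y)) (\<nu> - 1)) ((k(?x := y)) \<nu>)) * G y
     = tn_first v (i 1) (k 1) * (\<Prod>\<nu>=2..Suc n. tn_core v \<nu> (i \<nu>) (k (\<nu> - 1)) (k \<nu>))
       * (tn_core v ?x (i ?x) (k (Suc n)) y * G y)"
      unfolding E by (simp only: mult.assoc) simp
  qed
  also have "\<dots> = (\<Sum>y=1..tn_rank v ?x. \<Sum>k=1..tn_rank v (Suc n).
      tn_left v i n k * (tn_core v ?x (i ?x) k y * G y))"
    by (intro sum.cong refl Suc.IH)
  also have "\<dots> = (\<Sum>k=1..tn_rank v ?x. tn_left v i (Suc n) k * G k)"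
    by (simp add: sum_distrib_right mult.assoc)
  finally show ?case .
qed

lemma tn_value_left:
  assumes "tn_depth v = Suc n"
  shows "tn_value m \<phi> v i y = (\<Sum>k=1..tn_rank v (Suc n). tn_left v i n k *
           (\<Sum>l=1..m+1. tn_last v k l * poly (\<phi> l) y))"
  unfolding tn_value_def Let_def assms
  by (subst sum_tn_left[symmetric]) (simp only: sum_distrib_left mult.assoc)

text \<open>
  The integer with the base-\<open>b\<close> digits \<open>i 1, \<dots>, i n\<close>, that is, the index of the cell of level \<open>n\<close> that
  contains the point with these digits.
\<close>

primrec digit_prefix :: "nat \<Rightarrow> (nat \<Rightarrow> nat) \<Rightarrow> nat \<Rightarrow> nat" where
  "digit_prefix b i 0 = 0"
| "digit_prefix b i (Suc n) = b * digit_prefix b i n + i (Suc n)"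

lemma digit_prefix_less:
  assumes "\<forall>k\<in>{1..n}. i k < b"
  shows "digit_prefix b i n < b ^ n"
  using assms
proof (induction n)
  case (Suc n)
  then have "digit_prefix b i n + 1 \<le> b ^ n" "i (Suc n) < b" by (simp_all add: Suc_leI)
  then have "b * (digit_prefix b i n + 1) \<le> b * b ^ n" by (intro mult_left_mono) auto
  then show ?case using \<open>i (Suc n) < b\<close> by simp
qed simp

lemma digit_sum:
  assumes "b > 0"
  shows "(\<Sum>k=1..n. real (i k) / real b ^ k) = real (digit_prefix b i n) / real b ^ n"
  using assms by (induction n) (auto simp: field_simps)

lemma digit_prefix_le:
  assumes "\<forall>k\<in>{1..D}. i k < b" "\<nu> \<le> D"
  shows "digit_prefix b i \<nu> * b ^ (D - \<nu>) \<le> digit_prefix b i D"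
    and "digit_prefix b i D < (digit_prefix b i \<nu> + 1) * b ^ (D - \<nu>)"
proof -
  have "digit_prefix b i \<nu> * b ^ (D - \<nu>) \<le> digit_prefix b i D \<and>
        digit_prefix b i D + 1 \<le> (digit_prefix b i \<nu> + 1) * b ^ (D - \<nu>)"
    using assms(2,1)
  proof (induction D rule: dec_induct)
    case (step n)
    let ?X = "digit_prefix b i"
    have IH: "?X \<nu> * b ^ (n - \<nu>) \<le> ?X n" "?X n + 1 \<le> (?X \<nu> + 1) * b ^ (n - \<nu>)"
      using step by auto
    have "i (Suc n) < b" using step by simp
    have e: "b ^ (Suc n - \<nu>) = b * b ^ (n - \<nu>)" using step by (simp add: Suc_diff_le)
    have "b * (?X \<nu> * b ^ (n - \<nu>)) \<le> b * ?X n" "b * (?X n + 1) \<le> b * ((?X \<nu> + 1) * b ^ (n - \<nu>))"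
      using IH by (intro mult_left_mono; simp)+
    moreover have "?X (Suc n) + 1 \<le> b * (?X n + 1)" using \<open>i (Suc n) < b\<close> by simp
    moreover have "b * ?X n \<le> ?X (Suc n)" by simp
    ultimately have "b * (?X \<nu> * b ^ (n - \<nu>)) \<le> ?X (Suc n)" "?X (Suc n) + 1 \<le> b * ((?X \<nu> + 1) * b ^ (n - \<nu>))"
      by linarith+
    then show ?case unfolding e by (simp only: mult.left_commute[of b])
  qed simp
  then show "digit_prefix b i \<nu> * b ^ (D - \<nu>) \<le> digit_prefix b i D"
    and "digit_prefix b i D < (digit_prefix b i \<nu> + 1) * b ^ (D - \<nu>)" by auto
qed

lemma floor_digits:
  assumes "\<forall>k\<in>{1..D}. i k < b" "\<nu> \<le> D" "0 \<le> y" "y < 1" "0 < b"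
  shows "\<lfloor>real b ^ \<nu> * ((\<Sum>k=1..D. real (i k) / real b ^ k) + y / real b ^ D)\<rfloor> = int (digit_prefix b i \<nu>)"
proof -
  let ?X = "digit_prefix b i"
  have bD: "real b ^ D = real b ^ \<nu> * real b ^ (D - \<nu>)"
    using assms by (simp flip: power_add)
  have eq: "real b ^ \<nu> * ((\<Sum>k=1..D. real (i k) / real b ^ k) + y / real b ^ D)
     = (real (?X D) + y) / real b ^ (D - \<nu>)"
    unfolding digit_sum[OF assms(5)] bD using assms by (simp add: field_simps)
  have "real (?X \<nu> * b ^ (D - \<nu>)) \<le> real (?X D)" "real (?X D + 1) \<le> real ((?X \<nu> + 1) * b ^ (D - \<nu>))"
    using digit_prefix_le[OF assms(1,2)] by (simp_all only: of_nat_le_iff Suc_eq_plus1[symmetric] Suc_le_eq)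
  then have "real (?X \<nu>) \<le> (real (?X D) + y) / real b ^ (D - \<nu>)"
    "(real (?X D) + y) / real b ^ (D - \<nu>) < real (?X \<nu>) + 1"
    using assms by (auto simp: field_simps)
  then show ?thesis unfolding eq by (simp add: floor_eq_iff)
qed

text \<open>
  The network for the function with value \<open>P k (t)\<close> at \<open>x\<close>, where \<open>k\<close> is the index of the cell of level \<open>2 e\<close>
  around \<open>x\<close> and \<open>t\<close> is the left end of its cell of level \<open>D\<close>. All states are shifted by 1, as the indices of a
  network start at 1. Up to level \<open>e\<close> the state is the index of the current cell. On the levels \<open>\<nu>\<close> between
  \<open>e + 1\<close> and \<open>2 e\<close> a state \<open>w r + j\<close> with \<open>j < r\<close> holds the coefficient \<open>j\<close> of the piece that is
  reached by the remaining digits \<open>w\<close>, the piece being written in powers of the distance from the left end of its own cell.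
  For \<open>\<nu> = 2 e\<close> only \<open>w = 0\<close> is left. On later levels the state \<open>j\<close> holds the coefficient \<open>j\<close> of that
  polynomial in powers of the distance from the left end of the current cell; the core with \<open>i\<close> is the matrix of the
  substitution \<open>t \<mapsto> t + i / b\<^sup>\<nu>\<close>. At level \<open>D\<close> the coefficient 0 is the value at the left end, and it is
  multiplied by \<open>\<Sum> a\<^sub>l \<phi>\<^sub>l = 1\<close>.
\<close>

definition spline_tn ::
    "nat \<Rightarrow> nat \<Rightarrow> nat \<Rightarrow> nat \<Rightarrow> (nat \<Rightarrow> real poly) \<Rightarrow> (nat \<Rightarrow> real) \<Rightarrow> tensor_network" where
  "spline_tn b r e D P a =
     \<lparr> tn_depth = D,
       tn_rank = (\<lambda>\<nu>. if \<nu> \<le> e then b ^ \<nu> else if \<nu> \<le> 2 * e then r * b ^ (2 * e - \<nu>) else r),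
       tn_first = (\<lambda>i k. if k - 1 = i then 1 else 0),
       tn_core = (\<lambda>\<nu> i k' k.
         if \<nu> \<le> e then (if k - 1 = b * (k' - 1) + i then 1 else 0)
         else if \<nu> = e + 1 then
           (let n = (b * (k' - 1) + i) * b ^ (2 * e - \<nu>) + (k - 1) div r
            in coeff (pcompose (P n) [:real n / real b ^ (2 * e), 1:]) ((k - 1) mod r))
         else if \<nu> \<le> 2 * e then (if k' - 1 = i * b ^ (2 * e - \<nu>) * r + (k - 1) then 1 else 0)
         else coeff ([:real i / real b ^ \<nu>, 1:] ^ (k' - 1)) (k - 1)),
       tn_last = (\<lambda>k l. if k = 1 then a l else 0) \<rparr>"

lemma coeff_pcompose_shift:
  fixes Q :: "real poly"
  assumes "degree Q < r"
  shows "coeff (pcompose Q [:u, 1:]) n = (\<Sum>k=1..r. coeff Q (k - 1) * coeff ([:u, 1:] ^ (k - 1)) n)"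
proof -
  have "poly (pcompose Q [:u, 1:]) = poly (\<Sum>j\<le>degree Q. smult (coeff Q j) ([:u, 1:] ^ j))"
    by (simp add: fun_eq_iff poly_pcompose poly_sum poly_altdef[of Q])
  then have "pcompose Q [:u, 1:] = (\<Sum>j\<le>degree Q. smult (coeff Q j) ([:u, 1:] ^ j))"
    by (simp only: poly_eq_poly_eq_iff)
  also have "\<dots> = (\<Sum>j<r. smult (coeff Q j) ([:u, 1:] ^ j))"
    using assms by (intro sum.mono_neutral_left) (auto simp: coeff_eq_0)
  also have "\<dots> = (\<Sum>k=1..r. smult (coeff Q (k - 1)) ([:u, 1:] ^ (k - 1)))"
    by (rule sum.reindex_bij_witness[of _ "\<lambda>k. k - 1" Suc]) auto
  finally show ?thesis by (simp add: coeff_sum)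
qed

lemma sum_indicator_pred:
  fixes f :: "nat \<Rightarrow> real"
  assumes "x < n"
  shows "(\<Sum>k=1..n. f k * (if k - 1 = x then 1 else 0)) = f (Suc x)"
    "(\<Sum>k=1..n. (if k - 1 = x then 1 else 0) * f k) = f (Suc x)"
proof -
  have *: "(\<Sum>k=1..n. f k * (if k - 1 = x then 1 else 0)) = (\<Sum>k\<in>{Suc x}. f k)"
    using assms by (intro sum.mono_neutral_cong_right) auto
  then show "(\<Sum>k=1..n. f k * (if k - 1 = x then 1 else 0)) = f (Suc x)" by simp
  then show "(\<Sum>k=1..n. (if k - 1 = x then 1 else 0) * f k) = f (Suc x)"
    by (simp only: mult.commute)
qed

context
  fixes b r e D :: nat and P :: "nat \<Rightarrow> real poly" and a :: "nat \<Rightarrow> real" and i :: "nat \<Rightarrow> nat"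
  assumes b: "2 \<le> b" and r: "1 \<le> r" and e: "1 \<le> e" and D: "2 * e \<le> D"
    and deg: "\<And>n. degree (P n) < r"
    and i: "\<forall>k\<in>{1..D}. i k < b"
begin

abbreviation "snet \<equiv> spline_tn b r e D P a"
abbreviation "pre \<equiv> digit_prefix b i"

text \<open>
  The next three lemmas verify the meaning of the states of \<open>spline_tn\<close> in its three ranges of levels.
\<close>

lemma tn_left_prefix: "Suc n \<le> e \<Longrightarrow> tn_left snet i n k = (if k - 1 = pre (Suc n) then 1 else 0)"
proof (induction n arbitrary: k)
  case 0
  show ?case by (simp add: spline_tn_def)
next
  case (Suc n)
  have pre: "pre (Suc n) < b ^ Suc n" using Suc i D e by (intro digit_prefix_less) auto
  have rk: "tn_rank snet (Suc n) = b ^ Suc n" using Suc.prems by (simp add: spline_tn_def)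
  have "tn_left snet i (Suc n) k = (\<Sum>k'=1..b ^ Suc n. (if k' - 1 = pre (Suc n) then 1 else 0)
      * tn_core snet (Suc (Suc n)) (i (Suc (Suc n))) k' k)"
    unfolding tn_left.simps rk
    by (intro sum.cong refl arg_cong2[where f = "(*)"] Suc.IH) (use Suc.prems in simp)
  also have "\<dots> = tn_core snet (Suc (Suc n)) (i (Suc (Suc n))) (Suc (pre (Suc n))) k"
    by (rule sum_indicator_pred(2)[OF pre])
  finally have "tn_left snet i (Suc n) k = \<dots>" .
  then show ?case using Suc.prems by (simp add: spline_tn_def)
qed

lemma tn_left_coeff: "e \<le> n \<Longrightarrow> Suc n \<le> 2 * e \<Longrightarrow> k \<in> {1..r * b ^ (2 * e - Suc n)} \<Longrightarrow>
  tn_left snet i n k =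
   (let N = pre (Suc n) * b ^ (2 * e - Suc n) + (k - 1) div r
    in coeff (pcompose (P N) [:real N / real b ^ (2 * e), 1:]) ((k - 1) mod r))"
proof (induction n arbitrary: k rule: dec_induct)
  case base
  obtain n where n: "Suc n = e" using e by (cases e) auto
  have pre: "pre e < b ^ e" using i D e by (intro digit_prefix_less) auto
  have rk: "tn_rank snet (Suc n) = b ^ e" unfolding n by (simp add: spline_tn_def)
  have "tn_left snet i (Suc n) k = (\<Sum>k'=1..b ^ e. (if k' - 1 = pre (Suc n) then 1 else 0)
      * tn_core snet (Suc (Suc n)) (i (Suc (Suc n))) k' k)"
    unfolding tn_left.simps rk
    by (intro sum.cong refl arg_cong2[where f = "(*)"] tn_left_prefix) (use n in simp)
  then have "tn_left snet i e k = (\<Sum>k'=1..b ^ e. (if k' - 1 = pre e then 1 else 0) * tn_core snet (Suc e) (i (Suc e)) k' k)"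
    unfolding n .
  also have "\<dots> = tn_core snet (Suc e) (i (Suc e)) (Suc (pre e)) k"
    using pre by (rule sum_indicator_pred)
  finally show ?case using e by (simp add: spline_tn_def)
next
  case (step n)
  define w where "w = b ^ (2 * e - Suc (Suc n))"
  have w: "b ^ (2 * e - Suc n) = b * w"
  proof -
    have "2 * e - Suc n = Suc (2 * e - Suc (Suc n))" using step.prems by simp
    then show ?thesis by (simp add: w_def)
  qed
  define x where "x = i (Suc (Suc n)) * w * r + (k - 1)"
  have ib: "i (Suc (Suc n)) + 1 \<le> b" using i step.prems D by (simp add: Suc_leI)
  have "k - 1 < r * w" using step.prems by (auto simp: w_def)
  then have "x < i (Suc (Suc n)) * w * r + r * w" by (simp add: x_def)
  also have "\<dots> = (i (Suc (Suc n)) + 1) * (r * w)" by (simp add: algebra_simps)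
  also have "\<dots> \<le> b * (r * w)" using ib by (intro mult_right_mono) auto
  finally have x: "x < r * (b * w)" by (simp add: mult.left_commute)
  have rk: "tn_rank snet (Suc n) = r * (b * w)"
    using step.hyps step.prems w by (auto simp: spline_tn_def)
  have "tn_left snet i (Suc n) k = (\<Sum>k'=1..r * (b * w). tn_left snet i n k' * (if k' - 1 = x then 1 else 0))"
    unfolding tn_left.simps rk using step.hyps step.prems
    by (intro sum.cong refl) (simp add: spline_tn_def x_def w_def)
  also have "\<dots> = tn_left snet i n (Suc x)" using x by (rule sum_indicator_pred)
  also have "\<dots> = (let N = pre (Suc n) * b ^ (2 * e - Suc n) + x div r
    in coeff (pcompose (P N) [:real N / real b ^ (2 * e), 1:]) (x mod r))"
    using step.IH[of "Suc x"] step.prems x w by (simp del: digit_prefix.simps)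
  also have "x div r = i (Suc (Suc n)) * w + (k - 1) div r"
    using r by (simp add: x_def)
  also have "x mod r = (k - 1) mod r"
    by (simp add: x_def)
  also have "pre (Suc n) * b ^ (2 * e - Suc n) + (i (Suc (Suc n)) * w + (k - 1) div r)
     = pre (Suc (Suc n)) * w + (k - 1) div r"
    unfolding w digit_prefix.simps(2)[of b i "Suc n"] by (simp add: algebra_simps del: digit_prefix.simps)
  finally show ?case by (simp only: w_def)
qed

lemma tn_left_recentre: "2 * e \<le> Suc n \<Longrightarrow> Suc n \<le> D \<Longrightarrow> k \<in> {1..r} \<Longrightarrow>
  tn_left snet i n k = coeff (pcompose (P (pre (2 * e))) [:real (pre (Suc n)) / real b ^ Suc n, 1:]) (k - 1)"
proof (induction n arbitrary: k)
  case 0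
  then show ?case using e by simp
next
  case (Suc n)
  show ?case
  proof (cases "2 * e = Suc (Suc n)")
    case True
    then have "e \<le> Suc n" using e by simp
    have "(k - 1) div r = 0" "(k - 1) mod r = k - 1" using Suc.prems by auto
    then show ?thesis
      using tn_left_coeff[OF \<open>e \<le> Suc n\<close>, of k] True Suc.prems by (simp add: Let_def del: digit_prefix.simps)
  next
    case False
    then have le: "2 * e \<le> Suc n" "Suc n \<le> D" using Suc.prems by auto
    let ?u = "real (i (Suc (Suc n))) / real b ^ Suc (Suc n)"
    let ?Q = "pcompose (P (pre (2 * e))) [:real (pre (Suc n)) / real b ^ Suc n, 1:]"
    have rk: "tn_rank snet (Suc n) = r"
      using le e by (auto simp: spline_tn_def)
    have dQ: "degree ?Q < r" using deg[of "pre (2 * e)"] by (simp add: degree_pcompose)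
    have "tn_left snet i (Suc n) k = (\<Sum>k'=1..r. coeff ?Q (k' - 1) * coeff ([:?u, 1:] ^ (k' - 1)) (k - 1))"
      unfolding tn_left.simps rk using le e
      by (intro sum.cong refl arg_cong2[where f = "(*)"] Suc.IH) (auto simp: spline_tn_def)
    also have "\<dots> = coeff (pcompose ?Q [:?u, 1:]) (k - 1)"
      using coeff_pcompose_shift[OF dQ] by simp
    also have "pcompose ?Q [:?u, 1:] = pcompose (P (pre (2 * e))) [:real (pre (Suc n)) / real b ^ Suc n + ?u, 1:]"
      by (simp add: pcompose_assoc[symmetric] pcompose_pCons)
    also have "real (pre (Suc n)) / real b ^ Suc n + ?u = real (pre (Suc (Suc n))) / real b ^ Suc (Suc n)"
      unfolding digit_prefix.simps(2)[of b i "Suc n"] using b by (simp add: field_simps del: digit_prefix.simps)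
    finally show ?thesis .
  qed
qed

lemma spline_tn_value:
  assumes "\<And>y. (\<Sum>l=1..m+1. a l * poly (\<phi> l) y) = 1"
  shows "tn_value m \<phi> snet i y = poly (P (pre (2 * e))) (real (pre D) / real b ^ D)"
proof -
  obtain n where n: "D = Suc n" using e D by (cases D) auto
  have rk: "tn_rank snet (Suc n) = r" using D e n
    by (cases "2 * e = D") (auto simp: spline_tn_def)
  have dp: "tn_depth snet = Suc n" by (simp add: spline_tn_def n)
  have "tn_value m \<phi> snet i y = (\<Sum>k=1..r. tn_left snet i n k * (if k = 1 then 1 else 0))"
    unfolding tn_value_left[OF dp] rk using assms[of y]
    by (intro sum.cong refl) (simp add: spline_tn_def)
  also have "\<dots> = (\<Sum>k\<in>{1}. tn_left snet i n k * (if k = 1 then 1 else 0))"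
    using r by (intro sum.mono_neutral_right) auto
  also have "\<dots> = poly (P (pre (2 * e))) (real (pre D) / real b ^ D)"
    using tn_left_recentre[of n 1] r D n by (simp add: poly_0_coeff_0[symmetric] poly_pcompose del: digit_prefix.simps)
  finally show ?thesis .
qed

end

lemma poly_basis_one:
  assumes "poly_basis m \<phi>"
  obtains a where "\<And>y. (\<Sum>l=1..m+1. a l * poly (\<phi> l) y) = 1"
proof -
  interpret module "smult :: real \<Rightarrow> real poly \<Rightarrow> real poly"
    by unfold_locales (auto simp: smult_add_right smult_add_left)
  have "1 \<in> span (\<phi> ` {1..m+1})" using assms by (simp add: poly_basis_def)
  then obtain u where "1 = (\<Sum>v\<in>\<phi> ` {1..m+1}. smult (u v) v)"
    by (subst (asm) span_finite) auto
  also have "\<dots> = (\<Sum>l=1..m+1. smult (u (\<phi> l)) (\<phi> l))"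
    using assms by (subst sum.reindex) (auto simp: poly_basis_def)
  finally have 1: "1 = (\<Sum>l=1..m+1. smult (u (\<phi> l)) (\<phi> l))" .
  have "(\<Sum>l=1..m+1. u (\<phi> l) * poly (\<phi> l) y) = poly 1 y" for y
    by (subst 1) (simp add: poly_sum)
  then show ?thesis by (intro that[of "\<lambda>l. u (\<phi> l)"]) simp
qed

lemma sum_powers_le: "2 \<le> (b::nat) \<Longrightarrow> (\<Sum>\<nu>=1..e. b ^ \<nu>) \<le> 2 * b ^ e"
proof (induction e)
  case (Suc e)
  have "2 * b ^ e \<le> b * b ^ e" using Suc by (intro mult_right_mono) auto
  moreover have "(\<Sum>\<nu>=1..Suc e. b ^ \<nu>) = (\<Sum>\<nu>=1..e. b ^ \<nu>) + b * b ^ e" by simp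
  ultimately show ?case using Suc.IH[OF Suc.prems] by (simp only: power_Suc)
qed simp

text \<open>
  The three ranges of levels contribute at most \<open>2 b\<^sup>e\<close>, \<open>2 r b\<^sup>e\<close> and \<open>r (D - 2 e) = 2 r (r + 1) e\<close> to the sum
  of the ranks; the first two are geometric sums, and the third one is small because \<open>e < b\<^sup>e\<close>.
\<close>

lemma sampled_spline_realized:
  assumes b: "2 \<le> b" and \<phi>: "poly_basis m \<phi>" and r: "1 \<le> r" and e: "1 \<le> e"
    and deg: "\<And>n. degree (P n) < r"
    and D: "D = (r + 2) * (2 * e)"
  defines "g \<equiv> (\<lambda>x. poly (P (nat \<lfloor>real b ^ (2 * e) * x\<rfloor>)) (of_int \<lfloor>real b ^ D * x\<rfloor> / real b ^ D))"
  shows "\<exists>v. tn_wf v \<and> tn_realizes b m \<phi> v g \<and> compl_N b m v \<le> (2 + 2 * r + 2 * r * (r + 1)) * b ^ e"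
proof -
  obtain a where a: "\<And>y. (\<Sum>l=1..m+1. a l * poly (\<phi> l) y) = 1"
    using poly_basis_one[OF \<phi>] by blast
  define v where "v = spline_tn b r e D P a"
  have D2: "2 * e \<le> D" using D by simp
  have "D \<ge> 1" using e D by simp
  have "tn_wf v"
    using \<open>D \<ge> 1\<close> b r by (auto simp: tn_wf_def v_def spline_tn_def Suc_le_eq)
  moreover have "tn_realizes b m \<phi> v g"
    unfolding tn_realizes_def
  proof safe
    fix i y assume i: "\<forall>k\<in>{1..tn_depth v}. i k < b" and y: "y \<in> {0..<1::real}"
    then have i: "\<forall>k\<in>{1..D}. i k < b" by (simp add: v_def spline_tn_def)
    have [simp]: "tn_depth v = D" by (simp add: v_def spline_tn_def)
    have "tn_value m \<phi> v i y = poly (P (digit_prefix b i (2 * e))) (real (digit_prefix b i D) / real b ^ D)"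
      unfolding v_def by (rule spline_tn_value[OF b r e D2 deg i a])
    moreover have "tensorization b (tn_depth v) g i y = \<dots>"
      using floor_digits[OF i D2, of y] floor_digits[OF i order_refl, of y] y b
      by (simp add: tensorization_def g_def)
    ultimately show "tensorization b (tn_depth v) g i y = tn_value m \<phi> v i y" by simp
  qed
  moreover have "compl_N b m v \<le> (2 + 2 * r + 2 * r * (r + 1)) * b ^ e"
  proof -
    have "{1..D} = {1..e} \<union> ({e+1..2*e} \<union> {2*e+1..D})" using D2 by auto
    then have "compl_N b m v = sum (tn_rank v) ({1..e} \<union> ({e+1..2*e} \<union> {2*e+1..D}))"
      by (simp add: compl_N_def v_def spline_tn_def)
    also have "\<dots> = (\<Sum>\<nu>=1..e. tn_rank v \<nu>) + ((\<Sum>\<nu>=e+1..2*e. tn_rank v \<nu>) + (\<Sum>\<nu>=2*e+1..D. tn_rank v \<nu>))"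
      by (subst sum.union_disjoint; (subst sum.union_disjoint)?) auto
    also have "(\<Sum>\<nu>=1..e. tn_rank v \<nu>) = (\<Sum>\<nu>=1..e. b ^ \<nu>)"
      by (intro sum.cong) (auto simp: v_def spline_tn_def)
    also have "\<dots> \<le> 2 * b ^ e" using b by (rule sum_powers_le)
    also have "(\<Sum>\<nu>=e+1..2*e. tn_rank v \<nu>) = (\<Sum>\<nu>=e+1..2*e. r * b ^ (2 * e - \<nu>))"
      by (intro sum.cong) (auto simp: v_def spline_tn_def)
    also have "\<dots> = (\<Sum>j<e. r * b ^ j)"
      by (rule sum.reindex_bij_witness[of _ "\<lambda>j. 2 * e - j" "\<lambda>\<nu>. 2 * e - \<nu>"]) auto
    also have "\<dots> \<le> r * (2 * b ^ e)"
    proof -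
      have "(\<Sum>j<e. b ^ j) \<le> b ^ e"
      proof (induction e)
        case (Suc e)
        have "2 * b ^ e \<le> b * b ^ e" using b by (intro mult_right_mono) auto
        moreover have "(\<Sum>j<Suc e. b ^ j) = (\<Sum>j<e. b ^ j) + b ^ e" by simp
        ultimately show ?case using Suc by (simp only: power_Suc)
      qed simp
      then have "r * (\<Sum>j<e. b ^ j) \<le> r * (2 * b ^ e)" by (intro mult_left_mono) auto
      then show ?thesis by (simp add: sum_distrib_left)
    qed
    also have "(\<Sum>\<nu>=2*e+1..D. tn_rank v \<nu>) = (\<Sum>\<nu>=2*e+1..D. r)"
      by (intro sum.cong) (auto simp: v_def spline_tn_def)
    also have "\<dots> = r * (D - 2 * e)" by simp
    also have "D - 2 * e = 2 * (r + 1) * e" by (simp add: D algebra_simps)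
    also have "r * (2 * (r + 1) * e) \<le> r * (2 * (r + 1) * b ^ e)"
      using b by (intro mult_left_mono) (auto intro: less_imp_le less_exp order.strict_trans2)
    finally show ?thesis by (simp add: algebra_simps)
  qed
  ultimately show ?thesis by blast
qed

section \<open>Discretization of the approximation norms\<close>

lemma epowr_mono: "x \<le> y \<Longrightarrow> 0 < a \<Longrightarrow> epowr x a \<le> epowr y a"
  by (auto simp: epowr_def top_unique less_top intro!: ennreal_leI powr_mono2 enn2real_mono)

lemma epowr_0 [simp]: "epowr 0 a = 0"
  by (simp add: epowr_def)

lemma epowr_ennreal: "0 \<le> x \<Longrightarrow> epowr (ennreal x) a = ennreal (x powr a)"
  by (simp add: epowr_def)

lemma epowr_mult:
  assumes "0 < a"
  shows "epowr (x * y) a = epowr x a * epowr y a"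
proof (cases "x = 0 \<or> y = 0")
  case True
  then show ?thesis by auto
next
  case False
  show ?thesis
  proof (cases "x = \<infinity> \<or> y = \<infinity>")
    case True
    have "epowr z a \<noteq> 0" if "z \<noteq> 0" for z
      using that by (auto simp: epowr_def enn2real_eq_0_iff)
    with True False show ?thesis
      by (auto simp: epowr_def ennreal_mult_eq_top_iff ennreal_top_mult ennreal_mult_top enn2real_eq_0_iff)
  next
    case False
    then obtain u v where "x = ennreal u" "0 \<le> u" "y = ennreal v" "0 \<le> v"
      by (cases x; cases y) auto
    then show ?thesis
      by (simp add: epowr_ennreal powr_mult flip: ennreal_mult)
  qed
qed

lemma epowr_add_le:
  assumes "0 < a"
  shows "epowr (x + y) a \<le> ennreal (2 powr a) * (epowr x a + epowr y a)"
proof -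
  have "epowr (x + y) a \<le> epowr (2 * max x y) a"
    using assms by (intro epowr_mono) (auto simp: mult_2 intro: add_mono)
  also have "\<dots> = ennreal (2 powr a) * epowr (max x y) a"
    using assms epowr_ennreal[of 2 a] by (simp add: epowr_mult)
  also have "epowr (max x y) a \<le> epowr x a + epowr y a"
    by (simp add: max_def)
  finally show ?thesis by (simp add: mult_left_mono)
qed

lemma epowr_epowr: "0 < a \<Longrightarrow> epowr (epowr x a) (1 / a) = x"
  by (cases x) (auto simp: epowr_def powr_powr)

lemma epowr_power: "0 \<le> x \<Longrightarrow> epowr (ennreal x ^ n) a = ennreal ((x powr a) ^ n)"
proof -
  assume x: "0 \<le> x"
  then have "(x ^ n) powr a = (x powr a) ^ n" by (induction n) (simp_all add: powr_mult)
  then show ?thesis using x by (simp add: epowr_ennreal ennreal_power)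
qed

lemma exists_block:
  fixes n K B :: nat
  assumes "1 \<le> K" "2 \<le> B"
  obtains e where "n < K * B ^ Suc e" "1 \<le> e \<Longrightarrow> K * B ^ e \<le> n"
proof -
  have "n < B ^ n" using assms(2) by (intro power_gt_expt) auto
  also have "\<dots> \<le> B ^ Suc n" using assms(2) by (intro power_increasing) auto
  also have "\<dots> \<le> K * B ^ Suc n" using assms(1) by simp
  finally have ex: "n < K * B ^ Suc n" .
  define e where "e = (LEAST e. n < K * B ^ Suc e)"
  have 1: "n < K * B ^ Suc e" unfolding e_def by (rule LeastI[of _ n]) fact
  have 2: "K * B ^ e \<le> n" if "1 \<le> e"
  proof -
    have "\<not> n < K * B ^ Suc (e - 1)"
      using that unfolding e_def by (intro not_less_Least) auto
    then show ?thesis using that by simp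
  qed
  from 1 2 show ?thesis by (rule that)
qed

text \<open>
  The indices \<open>n\<close> with \<open>K B\<^sup>e \<le> n < K B\<^bsup>e+1\<^esup>\<close> form the block \<open>e\<close>, and block 0 contains all smaller indices as
  well, where the norm of the function is the only available bound for the error. Up to a constant,
  \<open>block_bound\<close> bounds the weighted errors in a block.
\<close>

definition block_bound :: "ennreal \<Rightarrow> (nat \<Rightarrow> ennreal) \<Rightarrow> real \<Rightarrow> nat \<Rightarrow> ennreal" where
  "block_bound F T \<theta> e = (if e = 0 then F else T e + ennreal \<theta> ^ e * F)"

definition block_const :: "nat \<Rightarrow> nat \<Rightarrow> real \<Rightarrow> real \<Rightarrow> real" where
  "block_const K B \<gamma> C = C * real (K * B) powr \<gamma>"

context
  fixes K B :: nat and \<gamma> C \<theta> :: real and E T :: "nat \<Rightarrow> ennreal" and F :: ennreal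
  \<comment> \<open>\<open>E\<close> are the errors, \<open>F\<close> the norm, \<open>T e\<close> the weighted modulus at \<open>b\<^bsup>-2e\<^esup>\<close>\<close>
  assumes K: "1 \<le> K" and B: "2 \<le> B" and \<gamma>: "0 < \<gamma>" and C: "1 \<le> C" and \<theta>: "0 < \<theta>" "\<theta> \<le> 1"
    and EF: "\<And>n. E n \<le> F"
    and ET: "\<And>e n. 1 \<le> e \<Longrightarrow> K * B ^ e \<le> n \<Longrightarrow>
      ennreal (real B powr (\<gamma> * real e)) * E n \<le> ennreal C * (T e + ennreal \<theta> ^ e * F)"
begin

lemma block_const_ge_1: "1 \<le> block_const K B \<gamma> C"
proof -
  have "1 \<le> K * B" using K B by (metis One_nat_def Suc_leI dual_order.trans le_numeral_extra(4) mult_le_mono one_le_numeral mult_1)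
  then have "1 \<le> real (K * B) powr \<gamma>" using \<gamma> by (intro ge_one_powr_ge_zero) (auto simp flip: of_nat_mult)
  then have "1 * 1 \<le> block_const K B \<gamma> C" unfolding block_const_def using C by (intro mult_mono) auto
  then show ?thesis by simp
qed

lemma weighted_error_le_block:
  assumes "n < K * B ^ Suc e" "1 \<le> e \<Longrightarrow> K * B ^ e \<le> n"
  shows "ennreal (real (Suc n) powr \<gamma>) * E n \<le> ennreal (block_const K B \<gamma> C) * block_bound F T \<theta> e"
proof -
  have "real (Suc n) \<le> real (K * B ^ Suc e)" using assms(1) by (simp only: of_nat_le_iff Suc_le_eq)
  then have "real (Suc n) powr \<gamma> \<le> real (K * B * B ^ e) powr \<gamma>"
    using \<gamma> by (intro powr_mono2) (auto simp: mult.assoc)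
  also have "\<dots> = real (K * B) powr \<gamma> * real B powr (\<gamma> * real e)"
    using B by (simp add: powr_mult powr_powr mult.commute flip: powr_realpow)
  finally have 1: "real (Suc n) powr \<gamma> \<le> real (K * B) powr \<gamma> * real B powr (\<gamma> * real e)" .
  have "ennreal (real (Suc n) powr \<gamma>) * E n
     \<le> ennreal (real (K * B) powr \<gamma>) * (ennreal (real B powr (\<gamma> * real e)) * E n)"
    using mult_right_mono[OF ennreal_leI[OF 1], of "E n"] by (simp add: ennreal_mult mult.assoc)
  also have "ennreal (real B powr (\<gamma> * real e)) * E n \<le> ennreal C * block_bound F T \<theta> e"
  proof (cases "e = 0")
    case True
    have "1 * E n \<le> ennreal C * F" using C EF by (intro mult_mono) auto
    then show ?thesis using B True by (simp add: block_bound_def)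
  next
    case False
    then show ?thesis using ET[of e n] assms(2) by (simp add: block_bound_def)
  qed
  finally show ?thesis using C
    by (simp add: block_const_def ennreal_mult mult.assoc mult.left_commute[of "ennreal C"] mult_left_mono)
qed

lemma weighted_sup_bound:
  assumes "\<And>e. 1 \<le> e \<Longrightarrow> T e \<le> S"
  shows "(SUP n\<in>{1..}. ennreal (real n powr \<gamma>) * E (n - 1)) \<le> ennreal (block_const K B \<gamma> C) * (F + S)"
proof (rule SUP_least)
  fix n :: nat assume "n \<in> {1..}"
  then obtain n' where n: "n = Suc n'" by (cases n) auto
  obtain e where e: "n' < K * B ^ Suc e" "1 \<le> e \<Longrightarrow> K * B ^ e \<le> n'"
    using exists_block[OF K B] by blast
  have "ennreal \<theta> ^ e * F \<le> 1 * F"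
    using \<theta> by (intro mult_right_mono power_le_one) auto
  then have "block_bound F T \<theta> e \<le> F + S"
    using assms[of e] by (auto simp: block_bound_def add.commute[of F] intro: add_mono add_increasing)
  then have "ennreal (block_const K B \<gamma> C) * block_bound F T \<theta> e \<le> ennreal (block_const K B \<gamma> C) * (F + S)" by (rule mult_left_mono) simp
  with weighted_error_le_block[OF e] show "ennreal (real n powr \<gamma>) * E (n - 1) \<le> ennreal (block_const K B \<gamma> C) * (F + S)"
    by (simp add: n)
qed

text \<open>
  A block has fewer than \<open>K B\<^bsup>e+1\<^esup>\<close> elements, all of which satisfy \<open>n + 1 \<ge> B\<^sup>e\<close>.
\<close>

lemma harmonic_block:
  "(\<Sum>n. indicator {n. n < K * B ^ Suc e \<and> (1 \<le> e \<longrightarrow> K * B ^ e \<le> n)} n * ennreal (1 / real (Suc n)))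
     \<le> ennreal (real (K * B))"
proof -
  let ?b = "{n. n < K * B ^ Suc e \<and> (1 \<le> e \<longrightarrow> K * B ^ e \<le> n)}"
  have "(\<Sum>n. indicator ?b n * ennreal (1 / real (Suc n)))
     = (\<Sum>n<K * B ^ Suc e. indicator ?b n * ennreal (1 / real (Suc n)))"
    by (intro suminf_finite) auto
  also have "\<dots> \<le> (\<Sum>n<K * B ^ Suc e. ennreal (1 / real B ^ e))"
  proof (intro sum_mono)
    fix n
    show "indicator ?b n * ennreal (1 / real (Suc n)) \<le> ennreal (1 / real B ^ e)"
    proof (cases "n \<in> ?b")
      case True
      have "B ^ e \<le> Suc n"
      proof (cases "e = 0")
        case False
        have "B ^ e \<le> K * B ^ e" using K by simp
        also have "\<dots> \<le> n" using True False by auto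
        finally show ?thesis by simp
      qed simp
      then have "real B ^ e \<le> real (Suc n)" by (metis of_nat_le_iff of_nat_power)
      then show ?thesis using True B by (auto intro!: ennreal_leI divide_left_mono)
    qed simp
  qed
  also have "\<dots> = of_nat (K * B ^ Suc e) * ennreal (1 / real B ^ e)"
    by (simp only: sum_constant card_lessThan)
  also have "\<dots> = ennreal (real (K * B ^ Suc e) * (1 / real B ^ e))"
    unfolding ennreal_of_nat_eq_real_of_nat by (rule ennreal_mult[symmetric]) auto
  also have "real (K * B ^ Suc e) * (1 / real B ^ e) = real (K * B)" using B by simp
  finally show ?thesis .
qed

text \<open>
  Exchanging the sums over \<open>n\<close> and over the blocks leaves, by \<open>harmonic_block\<close>, a multiple of the sum of
  \<open>(block_bound e)\<^sup>q\<close>, in which the powers of \<open>\<theta>\<close> form a geometric series.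
\<close>

lemma weighted_sum_bound:
  assumes q: "0 < q" and \<theta>': "\<theta> < 1"
  shows "(\<Sum>n. epowr (ennreal (real (Suc n) powr \<gamma>) * E n) q * ennreal (1 / real (Suc n)))
     \<le> ennreal (real (K * B) * (block_const K B \<gamma> C) powr q * (2 powr q + 1) / (1 - \<theta> powr q))
         * (epowr F q + (\<Sum>e. epowr (T (Suc e)) q))"
proof -
  let ?b = "\<lambda>e. {n. n < K * B ^ Suc e \<and> (1 \<le> e \<longrightarrow> K * B ^ e \<le> n)}"
  let ?t = "\<lambda>n e. epowr (ennreal (block_const K B \<gamma> C) * block_bound F T \<theta> e) q * (indicator (?b e) n * ennreal (1 / real (Suc n)))"
  let ?\<theta> = "\<theta> powr q"
  have tq: "0 < ?\<theta>" "?\<theta> < 1" using \<theta> \<theta>' q powr_less_mono2[of q \<theta> 1] by auto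
  have A0: "0 \<le> block_const K B \<gamma> C" using block_const_ge_1 by simp
  have "(\<Sum>n. epowr (ennreal (real (Suc n) powr \<gamma>) * E n) q * ennreal (1 / real (Suc n)))
     \<le> (\<Sum>n. \<Sum>e. ?t n e)"
  proof (intro suminf_le summableI)
    fix n
    obtain e where e: "n < K * B ^ Suc e" "1 \<le> e \<Longrightarrow> K * B ^ e \<le> n"
      using exists_block[OF K B] by blast
    have "epowr (ennreal (real (Suc n) powr \<gamma>) * E n) q * ennreal (1 / real (Suc n))
       \<le> epowr (ennreal (block_const K B \<gamma> C) * block_bound F T \<theta> e) q * ennreal (1 / real (Suc n))"
      using q by (intro mult_right_mono epowr_mono weighted_error_le_block e) auto
    also have "\<dots> = ?t n e" using e by simp
    also have "\<dots> = (\<Sum>e'\<in>{e}. ?t n e')" by simp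
    also have "\<dots> \<le> (\<Sum>e. ?t n e)" by (intro sum_le_suminf summableI) auto
    finally show "epowr (ennreal (real (Suc n) powr \<gamma>) * E n) q * ennreal (1 / real (Suc n)) \<le> (\<Sum>e. ?t n e)" .
  qed
  also have "\<dots> = (\<integral>\<^sup>+n. (\<Sum>e. ?t n e) \<partial>count_space UNIV)"
    by (simp add: nn_integral_count_space_nat)
  also have "\<dots> = (\<Sum>e. \<integral>\<^sup>+n. ?t n e \<partial>count_space UNIV)"
    by (intro nn_integral_suminf) auto
  also have "\<dots> = (\<Sum>e. \<Sum>n. ?t n e)"
    by (simp add: nn_integral_count_space_nat)
  also have "\<dots> \<le> (\<Sum>e. epowr (ennreal (block_const K B \<gamma> C) * block_bound F T \<theta> e) q * ennreal (real (K * B)))"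
  proof (intro suminf_le summableI)
    fix e
    have "(\<Sum>n. ?t n e) = epowr (ennreal (block_const K B \<gamma> C) * block_bound F T \<theta> e) q *
        (\<Sum>n. indicator (?b e) n * ennreal (1 / real (Suc n)))" by (rule ennreal_suminf_cmult)
    also have "\<dots> \<le> epowr (ennreal (block_const K B \<gamma> C) * block_bound F T \<theta> e) q * ennreal (real (K * B))"
      by (intro mult_left_mono harmonic_block) auto
    finally show "(\<Sum>n. ?t n e) \<le> \<dots>" .
  qed
  also have "\<dots> = (\<Sum>e. ennreal (real (K * B) * (block_const K B \<gamma> C) powr q) * epowr (block_bound F T \<theta> e) q)"
    using q A0 by (simp add: epowr_mult epowr_ennreal ennreal_mult mult_ac)
  also have "\<dots> = ennreal (real (K * B) * (block_const K B \<gamma> C) powr q) * (\<Sum>e. epowr (block_bound F T \<theta> e) q)"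
    by (rule ennreal_suminf_cmult)
  also have "(\<Sum>e. epowr (block_bound F T \<theta> e) q) = epowr (block_bound F T \<theta> 0) q + (\<Sum>e. epowr (block_bound F T \<theta> (Suc e)) q)"
    by (subst suminf_offset[of _ 1]) (auto simp: summableI add.commute)
  also have "(\<Sum>e. epowr (block_bound F T \<theta> (Suc e)) q)
     \<le> (\<Sum>e. ennreal (2 powr q) * (epowr (T (Suc e)) q + ennreal (?\<theta> ^ Suc e) * epowr F q))"
  proof (intro suminf_le summableI)
    fix e
    show "epowr (block_bound F T \<theta> (Suc e)) q \<le> ennreal (2 powr q) * (epowr (T (Suc e)) q + ennreal (?\<theta> ^ Suc e) * epowr F q)"
      using epowr_add_le[OF q, of "T (Suc e)" "ennreal \<theta> ^ Suc e * F"] \<theta> q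
      by (simp add: block_bound_def epowr_mult epowr_power del: power_Suc)
  qed
  also have "\<dots> = ennreal (2 powr q) * ((\<Sum>e. epowr (T (Suc e)) q) + (\<Sum>e. ennreal (?\<theta> ^ Suc e)) * epowr F q)"
    by (subst ennreal_suminf_cmult, subst suminf_add[symmetric]) (auto simp: summableI ennreal_suminf_multc)
  also have "(\<Sum>e. ennreal (?\<theta> ^ Suc e)) \<le> ennreal (1 / (1 - ?\<theta>))"
  proof -
    have "(\<Sum>e. ennreal (?\<theta> ^ Suc e)) \<le> (\<Sum>e. ennreal (?\<theta> ^ e))"
      using tq by (intro suminf_le summableI ennreal_leI) (auto intro: mult_left_le_one_le)
    also have "\<dots> = ennreal (\<Sum>e. ?\<theta> ^ e)"
      using tq by (intro suminf_ennreal2) (auto intro: summable_geometric)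
    also have "(\<Sum>e. ?\<theta> ^ e) = 1 / (1 - ?\<theta>)" using tq by (intro suminf_geometric) auto
    finally show ?thesis .
  qed
  finally have "(\<Sum>n. epowr (ennreal (real (Suc n) powr \<gamma>) * E n) q * ennreal (1 / real (Suc n)))
    \<le> ennreal (real (K * B) * (block_const K B \<gamma> C) powr q) * (epowr F q + ennreal (2 powr q) * ((\<Sum>e. epowr (T (Suc e)) q)
        + ennreal (1 / (1 - ?\<theta>)) * epowr F q))"
    by (simp add: block_bound_def mult_left_mono mult_right_mono add_left_mono)
  also have "\<dots> \<le> ennreal (real (K * B) * (block_const K B \<gamma> C) powr q) * (ennreal ((2 powr q + 1) / (1 - ?\<theta>)) *
       (epowr F q + (\<Sum>e. epowr (T (Suc e)) q)))"
  proof (intro mult_left_mono)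
    have 1: "1 \<le> 1 / (1 - ?\<theta>)" using tq by simp
    have "epowr F q + ennreal (2 powr q) * ((\<Sum>e. epowr (T (Suc e)) q) + ennreal (1 / (1 - ?\<theta>)) * epowr F q)
      = ennreal (1 + 2 powr q * (1 / (1 - ?\<theta>))) * epowr F q + ennreal (2 powr q) * (\<Sum>e. epowr (T (Suc e)) q)"
    proof -
      have "ennreal (1 + 2 powr q * (1 / (1 - ?\<theta>))) = 1 + ennreal (2 powr q) * ennreal (1 / (1 - ?\<theta>))"
        by (subst ennreal_plus, simp, use tq in simp, subst ennreal_mult) (use tq in simp_all)
      then show ?thesis by (simp only: distrib_left distrib_right mult_1 ac_simps)
    qed
    also have "\<dots> \<le> ennreal ((2 powr q + 1) / (1 - ?\<theta>)) * epowr F q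
        + ennreal ((2 powr q + 1) / (1 - ?\<theta>)) * (\<Sum>e. epowr (T (Suc e)) q)"
    proof (intro add_mono mult_right_mono ennreal_leI)
      show "1 + 2 powr q * (1 / (1 - ?\<theta>)) \<le> (2 powr q + 1) / (1 - ?\<theta>)"
        using 1 by (simp add: add_divide_distrib)
      have "2 powr q * 1 \<le> (2 powr q + 1) * (1 / (1 - ?\<theta>))" using 1 by (intro mult_mono) auto
      then show "2 powr q \<le> (2 powr q + 1) / (1 - ?\<theta>)" by simp
    qed auto
    finally show "epowr F q + ennreal (2 powr q) * ((\<Sum>e. epowr (T (Suc e)) q) + ennreal (1 / (1 - ?\<theta>)) * epowr F q)
      \<le> ennreal ((2 powr q + 1) / (1 - ?\<theta>)) * (epowr F q + (\<Sum>e. epowr (T (Suc e)) q))"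
      by (simp add: distrib_left)
  qed simp
  also have "\<dots> = ennreal (real (K * B) * (block_const K B \<gamma> C) powr q * (2 powr q + 1) / (1 - ?\<theta>))
         * (epowr F q + (\<Sum>e. epowr (T (Suc e)) q))"
  proof -
    have "ennreal (real (K * B) * (block_const K B \<gamma> C) powr q) * ennreal ((2 powr q + 1) / (1 - ?\<theta>))
      = ennreal (real (K * B) * (block_const K B \<gamma> C) powr q * (2 powr q + 1) / (1 - ?\<theta>))"
      using tq by (subst ennreal_mult[symmetric]) auto
    then show ?thesis by (simp only: mult.assoc[symmetric])
  qed
  finally show ?thesis .
qed

end

text \<open>
  On the interval between \<open>\<beta>\<^bsup>e+1\<^esup>\<close> and \<open>\<beta>\<^sup>e\<close> the integrand is at least its weight at the right end times the
  modulus at the left end, and these intervals are disjoint.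
\<close>

lemma besov_sum_le:
  fixes \<omega> :: "real \<Rightarrow> ennreal"
  assumes \<beta>: "0 < \<beta>" "\<beta> < 1" and \<alpha>: "0 < \<alpha>" and q: "0 < q"
    and mono: "\<And>s t. 0 < s \<Longrightarrow> s \<le> t \<Longrightarrow> \<omega> s \<le> \<omega> t"
  shows "(\<Sum>e. epowr (ennreal ((\<beta> ^ Suc e) powr (-\<alpha>)) * \<omega> (\<beta> ^ Suc e)) q)
     \<le> ennreal (\<beta> powr (-\<alpha> * q) / (1 - \<beta>)) *
        (\<integral>\<^sup>+t\<in>{0<..<1}. epowr (ennreal (t powr (-\<alpha>)) * \<omega> t) q * ennreal (1 / t) \<partial>lborel)"
proof -
  define c where "c e = epowr (ennreal ((\<beta> ^ e) powr (-\<alpha>)) * \<omega> (\<beta> ^ Suc e)) q * ennreal (1 / \<beta> ^ e)" for e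
  let ?I = "\<lambda>e. {\<beta> ^ Suc e<..<\<beta> ^ e}"
  let ?g = "\<lambda>t. epowr (ennreal (t powr (-\<alpha>)) * \<omega> t) q * ennreal (1 / t) * indicator {0<..<1} t"
  have le: "\<beta> ^ Suc e \<le> \<beta> ^ e" "\<beta> ^ e \<le> 1" for e using \<beta> by (auto intro: power_le_one)
  have "(\<Sum>e. epowr (ennreal ((\<beta> ^ Suc e) powr (-\<alpha>)) * \<omega> (\<beta> ^ Suc e)) q)
     = (\<Sum>e. ennreal (\<beta> powr (-\<alpha> * q) / (1 - \<beta>)) * (c e * emeasure lborel (?I e)))"
  proof (intro suminf_cong)
    fix e
    have "emeasure lborel (?I e) = ennreal ((1 - \<beta>) * \<beta> ^ e)"
      using le[of e] by (simp add: algebra_simps)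
    then have "c e * emeasure lborel (?I e)
      = epowr (ennreal ((\<beta> ^ e) powr (-\<alpha>)) * \<omega> (\<beta> ^ Suc e)) q * (ennreal (1 / \<beta> ^ e) * ennreal ((1 - \<beta>) * \<beta> ^ e))"
      by (simp add: c_def mult.assoc)
    also have "ennreal (1 / \<beta> ^ e) * ennreal ((1 - \<beta>) * \<beta> ^ e) = ennreal (1 - \<beta>)"
      using \<beta> by (simp flip: ennreal_mult)
    finally have "ennreal (\<beta> powr (-\<alpha> * q) / (1 - \<beta>)) * (c e * emeasure lborel (?I e))
      = (ennreal (\<beta> powr (-\<alpha> * q) / (1 - \<beta>)) * ennreal (1 - \<beta>)) * epowr (ennreal ((\<beta> ^ e) powr (-\<alpha>)) * \<omega> (\<beta> ^ Suc e)) q"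
      by (simp add: mult_ac)
    also have "ennreal (\<beta> powr (-\<alpha> * q) / (1 - \<beta>)) * ennreal (1 - \<beta>) = ennreal (\<beta> powr (-\<alpha> * q))"
      using \<beta> by (simp flip: ennreal_mult)
    also have "\<dots> = epowr (ennreal (\<beta> powr (-\<alpha>))) q"
      by (simp add: epowr_ennreal powr_powr)
    also have "\<dots> * epowr (ennreal ((\<beta> ^ e) powr (-\<alpha>)) * \<omega> (\<beta> ^ Suc e)) q
       = epowr (ennreal ((\<beta> ^ Suc e) powr (-\<alpha>)) * \<omega> (\<beta> ^ Suc e)) q"
      using \<beta> q by (simp add: epowr_mult powr_mult ennreal_mult mult.assoc)
    finally show "epowr (ennreal ((\<beta> ^ Suc e) powr (-\<alpha>)) * \<omega> (\<beta> ^ Suc e)) q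
      = ennreal (\<beta> powr (-\<alpha> * q) / (1 - \<beta>)) * (c e * emeasure lborel (?I e))" by simp
  qed
  also have "\<dots> = ennreal (\<beta> powr (-\<alpha> * q) / (1 - \<beta>)) * (\<Sum>e. c e * emeasure lborel (?I e))"
    by (rule ennreal_suminf_cmult)
  also have "(\<Sum>e. c e * emeasure lborel (?I e)) = (\<Sum>e. \<integral>\<^sup>+t. c e * indicator (?I e) t \<partial>lborel)"
    by (subst nn_integral_cmult_indicator) auto
  also have "\<dots> = (\<integral>\<^sup>+t. (\<Sum>e. c e * indicator (?I e) t) \<partial>lborel)"
    by (intro nn_integral_suminf[symmetric]) auto
  also have "\<dots> \<le> (\<integral>\<^sup>+t. ?g t \<partial>lborel)"
  proof (intro nn_integral_mono)
    fix t
    show "(\<Sum>e. c e * indicator (?I e) t) \<le> ?g t"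
    proof (cases "\<exists>e. t \<in> ?I e")
      case False
      then have "(\<Sum>e. c e * indicator (?I e) t) = (\<Sum>e. 0)" by (intro suminf_cong) auto
      then show ?thesis by simp
    next
      case True
      then obtain e where e: "t \<in> ?I e" by blast
      have disj: "t \<notin> ?I e'" if "e' \<noteq> e" for e'
      proof -
        have *: "x \<le> y" if "x < \<beta> ^ j" "\<beta> ^ Suc i < y" "i < j" for i j and x y :: real
        proof -
          have "\<beta> ^ j \<le> \<beta> ^ Suc i" using that \<beta> by (intro power_decreasing) auto
          then show ?thesis using that by linarith
        qed
        show ?thesis
        proof
          assume "t \<in> ?I e'"
          then have t: "t < \<beta> ^ e'" "\<beta> ^ Suc e' < t" by auto
          have "\<beta> ^ e' \<le> \<beta> ^ Suc e \<or> \<beta> ^ e \<le> \<beta> ^ Suc e'"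
            using \<beta> \<open>e' \<noteq> e\<close> by (cases "e < e'") (auto intro!: disjI1 disjI2 power_decreasing simp del: power_Suc)
          then show False using t e by (auto simp del: power_Suc)
        qed
      qed
      have "(\<Sum>e. c e * indicator (?I e) t) = (\<Sum>e\<in>{e}. c e * indicator (?I e) t)"
        using disj by (intro suminf_finite) auto
      also have "\<dots> = c e" using e by simp
      also have "\<dots> \<le> epowr (ennreal (t powr (-\<alpha>)) * \<omega> t) q * ennreal (1 / t)"
      proof -
        have bp: "0 < \<beta> ^ Suc e" using \<beta> by simp
        have t: "0 < t" "t < \<beta> ^ e" "\<beta> ^ Suc e < t" using e bp by (auto simp del: power_Suc)
        have "(\<beta> ^ e) powr (-\<alpha>) \<le> t powr (-\<alpha>)" using t \<alpha> by (intro powr_mono2') auto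
        moreover have "\<omega> (\<beta> ^ Suc e) \<le> \<omega> t" using t bp by (intro mono) auto
        moreover have "1 / \<beta> ^ e \<le> 1 / t" using t by (intro divide_left_mono) auto
        ultimately show ?thesis
          unfolding c_def using q by (intro mult_mono epowr_mono ennreal_leI) auto
      qed
      also have "\<dots> = ?g t"
      proof -
        have "0 < \<beta> ^ Suc e" using \<beta> by simp
        then have "0 < t" "t < 1" using e le(2)[of e] by (auto simp del: power_Suc)
        then show ?thesis by simp
      qed
      finally show ?thesis .
    qed
  qed
  finally show ?thesis by (simp add: mult_left_mono)
qed

section \<open>Smooth functions of compact support\<close>

text \<open>
  The function \<open>exp (- 1 / t)\<close> continued by 0, with additional factors \<open>1 / t\<close>, which appear in its
  derivatives.
\<close>

definition flat_exp :: "nat \<Rightarrow> real \<Rightarrow> real" where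
  "flat_exp k t = (if t > 0 then exp (- (1 / t)) * (1 / t) ^ k else 0)"

lemma power_le_fact_exp:
  assumes "0 \<le> (x::real)"
  shows "x ^ n \<le> fact n * exp x"
proof -
  have "x ^ n /\<^sub>R fact n = (\<Sum>i\<in>{n}. x ^ i /\<^sub>R fact i)" by simp
  also have "\<dots> \<le> exp x"
    unfolding exp_def using assms by (intro sum_le_suminf summable_exp_generic) auto
  finally show ?thesis by (simp add: field_simps)
qed

lemma flat_exp_bound: "\<bar>flat_exp k t\<bar> \<le> fact (k + 2) * t\<^sup>2"
proof (cases "t > 0")
  case True
  have "exp (- (1 / t)) * (1 / t) ^ (k + 2) \<le> exp (- (1 / t)) * (fact (k + 2) * exp (1 / t))"
    using True by (intro mult_left_mono power_le_fact_exp) auto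
  also have "\<dots> = fact (k + 2)" by (simp add: exp_minus)
  finally have "exp (- (1 / t)) * (1 / t) ^ (k + 2) * t\<^sup>2 \<le> fact (k + 2) * t\<^sup>2"
    by (intro mult_right_mono) auto
  moreover have "exp (- (1 / t)) * (1 / t) ^ (k + 2) * t\<^sup>2 = flat_exp k t"
    using True by (simp add: flat_exp_def power_add power2_eq_square field_simps)
  ultimately show ?thesis using True by (simp add: flat_exp_def)
qed (simp add: flat_exp_def)

text \<open>
  At 0 the difference quotient vanishes in the limit, as the exponential series yields
  \<open>exp (- 1 / t) t\<^bsup>-(k+2)\<^esup> \<le> (k + 2)!\<close> for \<open>t > 0\<close>.
\<close>

lemma flat_exp_deriv:
  "(flat_exp k has_real_derivative flat_exp (k + 2) t - real k * flat_exp (k + 1) t) (at t)"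
proof (cases t "0::real" rule: linorder_cases)
  case less
  have "((\<lambda>_. 0) has_real_derivative 0) (at t)" by simp
  then have "(flat_exp k has_real_derivative 0) (at t)"
    by (rule has_field_derivative_transform_within_open[where S = "{..<0}"]) (use less in \<open>auto simp: flat_exp_def\<close>)
  then show ?thesis using less by (simp add: flat_exp_def)
next
  case equal
  have "((\<lambda>h. flat_exp k h / h) \<longlongrightarrow> 0) (at 0)"
  proof (rule Lim_null_comparison)
    show "\<forall>\<^sub>F h in at 0. norm (flat_exp k h / h) \<le> fact (k + 2) * \<bar>h\<bar>"
    proof (intro eventually_at_filter[THEN iffD2] always_eventually allI impI)
      fix h :: real assume "h \<noteq> 0"
      then have "\<bar>flat_exp k h\<bar> / \<bar>h\<bar> \<le> fact (k + 2) * h\<^sup>2 / \<bar>h\<bar>"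
        by (intro divide_right_mono flat_exp_bound) auto
      also have "h\<^sup>2 = \<bar>h\<bar> * \<bar>h\<bar>" by (simp add: power2_eq_square)
      also have "fact (k + 2) * (\<bar>h\<bar> * \<bar>h\<bar>) / \<bar>h\<bar> = fact (k + 2) * \<bar>h\<bar>"
        unfolding times_divide_eq_right[symmetric]
        using \<open>h \<noteq> 0\<close> by simp
      finally show "norm (flat_exp k h / h) \<le> fact (k + 2) * \<bar>h\<bar>" by (simp only: real_norm_def abs_divide)
    qed
    show "((\<lambda>h. fact (k + 2) * \<bar>h\<bar>) \<longlongrightarrow> (0::real)) (at 0)"
      by (intro tendsto_eq_intros) auto
  qed
  then have "(flat_exp k has_real_derivative 0) (at 0)"
    by (simp add: has_field_derivative_iff flat_exp_def)
  then show ?thesis using equal by (simp add: flat_exp_def)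
next
  case greater
  have "((\<lambda>t. exp (- (1 / t)) * (1 / t) ^ k) has_real_derivative
      flat_exp (k + 2) t - real k * flat_exp (k + 1) t) (at t)"
  proof -
    have k: "real k * (1 / t) ^ (k - Suc 0) * (1 / t)\<^sup>2 = real k * (1 / t) ^ (k + 1)"
      by (cases k) (auto simp: power2_eq_square)
    have "((\<lambda>t. exp (- (1 / t)) * (1 / t) ^ k) has_real_derivative
      exp (- (1 / t)) * (1 / t)\<^sup>2 * (1 / t) ^ k - exp (- (1 / t)) * (real k * (1 / t) ^ (k - Suc 0) * (1 / t)\<^sup>2)) (at t)"
    proof -
      have d: "((\<lambda>t. 1 / t) has_real_derivative - ((1 / t)\<^sup>2)) (at t)"
        using greater by (auto intro!: derivative_eq_intros simp: power2_eq_square)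
      show ?thesis
        by (rule DERIV_cong[OF DERIV_mult[OF DERIV_chain2[OF DERIV_exp DERIV_minus[OF d]] DERIV_power[OF d]]])
           (simp add: algebra_simps)
    qed
    then show ?thesis unfolding k using greater
      by (simp add: flat_exp_def power_add power2_eq_square algebra_simps)
  qed
  then show ?thesis
    by (rule has_field_derivative_transform_within_open[where S = "{0<..}"]) (use greater in \<open>auto simp: flat_exp_def\<close>)
qed

text \<open>
  A class that is visibly closed under differentiation, and whose members are therefore smooth. It
  contains the smooth approximations of indicator functions that are used below.
\<close>

inductive flat_exp_sum :: "(real \<Rightarrow> real) \<Rightarrow> bool" where
  flat_base: "flat_exp_sum (\<lambda>x. poly A x * flat_exp k (poly q x))"
| flat_add: "flat_exp_sum f \<Longrightarrow> flat_exp_sum g \<Longrightarrow> flat_exp_sum (\<lambda>x. f x + g x)"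

lemma flat_exp_sum_deriv:
  assumes "flat_exp_sum f"
  shows "\<exists>f'. flat_exp_sum f' \<and> (\<forall>x. (f has_real_derivative f' x) (at x))"
  using assms
proof induction
  case (flat_base A k q)
  let ?f' = "\<lambda>x. poly (pderiv A) x * flat_exp k (poly q x) +
     (poly (A * pderiv q) x * flat_exp (k + 2) (poly q x)
        + poly (smult (- real k) (A * pderiv q)) x * flat_exp (k + 1) (poly q x))"
  have "flat_exp_sum ?f'" by (intro flat_exp_sum.intros)
  moreover have "((\<lambda>x. poly A x * flat_exp k (poly q x)) has_real_derivative ?f' x) (at x)" for x
  proof -
    have "((\<lambda>x. flat_exp k (poly q x)) has_real_derivative
        (flat_exp (k + 2) (poly q x) - real k * flat_exp (k + 1) (poly q x)) * poly (pderiv q) x) (at x)"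
      by (rule DERIV_chain2[OF flat_exp_deriv poly_DERIV])
    from DERIV_mult[OF poly_DERIV[of A x] this] show ?thesis
      by (rule DERIV_cong) (simp add: algebra_simps)
  qed
  ultimately show ?case by blast
next
  case (flat_add f g)
  then obtain f' g' where "flat_exp_sum f'" "flat_exp_sum g'"
    "\<And>x. (f has_real_derivative f' x) (at x)" "\<And>x. (g has_real_derivative g' x) (at x)" by blast
  then have "flat_exp_sum (\<lambda>x. f' x + g' x)" "\<And>x. ((\<lambda>x. f x + g x) has_real_derivative f' x + g' x) (at x)"
    by (auto intro: flat_exp_sum.flat_add DERIV_add)
  then show ?case by blast
qed

lemma flat_exp_sum_smooth:
  assumes "flat_exp_sum f"
  shows "flat_exp_sum ((deriv ^^ k) f)" "(deriv ^^ k) f differentiable at x"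
proof -
  show 1: "flat_exp_sum ((deriv ^^ k) f)" for k
  proof (induction k)
    case (Suc k)
    then obtain f' where "flat_exp_sum f'" "\<forall>x. ((deriv ^^ k) f has_real_derivative f' x) (at x)"
      using flat_exp_sum_deriv by blast
    moreover from this(2) have "deriv ((deriv ^^ k) f) = f'" by (auto intro: DERIV_imp_deriv)
    ultimately show ?case by simp
  qed (simp add: assms)
  show "(deriv ^^ k) f differentiable at x"
    using flat_exp_sum_deriv[OF 1[of k]] by (auto simp: real_differentiable_def)
qed

text \<open>
  For \<open>n \<rightarrow> \<infinity>\<close> these functions converge to the indicator function of the open interval from \<open>\<alpha>\<close> to \<open>\<beta>\<close>,
  because the quadratic polynomial is positive exactly on that interval.
\<close>

definition bump :: "real \<Rightarrow> real \<Rightarrow> nat \<Rightarrow> real \<Rightarrow> real" where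
  "bump \<alpha> \<beta> n x = flat_exp 0 (real n * ((x - \<alpha>) * (\<beta> - x)))"

lemma bump_flat_exp_sum: "flat_exp_sum (\<lambda>x. c * bump \<alpha> \<beta> n (x - h))"
proof -
  have "(\<lambda>x. c * bump \<alpha> \<beta> n (x - h)) =
      (\<lambda>x. poly [:c:] x * flat_exp 0 (poly (smult (real n) ([:- h - \<alpha>, 1:] * [:\<beta> + h, -1:])) x))"
    by (rule ext) (simp add: bump_def algebra_simps)
  then show ?thesis by (simp only: flat_base)
qed

lemma bump_range: "0 \<le> bump \<alpha> \<beta> n x" "bump \<alpha> \<beta> n x \<le> 1"
  by (auto simp: bump_def flat_exp_def)

lemma bump_eq_0: "x \<notin> {\<alpha><..<\<beta>} \<Longrightarrow> \<alpha> < \<beta> \<Longrightarrow> bump \<alpha> \<beta> n x = 0"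
  by (auto simp: bump_def flat_exp_def zero_less_mult_iff mult_less_0_iff not_less)

lemma bump_tendsto:
  assumes "\<alpha> < \<beta>"
  shows "(\<lambda>n. bump \<alpha> \<beta> n x) \<longlonglongrightarrow> indicator {\<alpha><..<\<beta>} x"
proof (cases "x \<in> {\<alpha><..<\<beta>}")
  case True
  define c where "c = (x - \<alpha>) * (\<beta> - x)"
  have c: "0 < c" using True by (simp add: c_def)
  have "(\<lambda>n. exp (- (1 / c) * (1 / real n))) \<longlonglongrightarrow> exp (- (1 / c) * 0)"
    by (intro tendsto_intros lim_1_over_n)
  then have "(\<lambda>n. exp (- (1 / c) * (1 / real n))) \<longlonglongrightarrow> 1" by simp
  moreover have "\<forall>\<^sub>F n in sequentially. exp (- (1 / c) * (1 / real n)) = bump \<alpha> \<beta> n x"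
    using eventually_gt_at_top[of 0]
  proof eventually_elim
    case (elim n)
    then show ?case using c by (simp add: bump_def flat_exp_def c_def[symmetric] mult.commute[of c])
  qed
  ultimately have "(\<lambda>n. bump \<alpha> \<beta> n x) \<longlonglongrightarrow> 1" by (rule Lim_transform_eventually)
  then show ?thesis using True by simp
next
  case False
  then show ?thesis using assms by (simp add: bump_eq_0)
qed

lemma bump_continuous: "continuous_on S (bump \<alpha> \<beta> n)"
proof -
  have "flat_exp_sum (bump \<alpha> \<beta> n)" using bump_flat_exp_sum[of 1 \<alpha> \<beta> n 0] by simp
  then have "\<And>x. isCont (bump \<alpha> \<beta> n) x" using flat_exp_sum_deriv DERIV_isCont by blast
  then show ?thesis by (simp add: continuous_at_imp_continuous_on)
qed

text \<open>
  A test function whose derivative is a first difference of \<open>bump\<close>. Testing a weak derivative with it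
  therefore leads to differences of \<open>f\<close>.
\<close>

definition test_bump :: "real \<Rightarrow> real \<Rightarrow> real \<Rightarrow> nat \<Rightarrow> real \<Rightarrow> real" where
  "test_bump h \<alpha> \<beta> n x = (LBINT y. bump \<alpha> \<beta> n y * indicator {x-h..x} y)"

lemma test_bump_deriv:
  assumes "0 < h"
  shows "(test_bump h \<alpha> \<beta> n has_real_derivative bump \<alpha> \<beta> n x - bump \<alpha> \<beta> n (x - h)) (at x)"
proof -
  have cont: "isCont (bump \<alpha> \<beta> n) x" for x
    using bump_continuous[of UNIV] by (simp add: continuous_on_eq_continuous_at)
  then obtain H where "\<forall>x::real. -\<infinity> < ereal x \<longrightarrow> ereal x < \<infinity> \<longrightarrow> (H has_vector_derivative bump \<alpha> \<beta> n x) (at x)"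
    using einterval_antiderivative[of "-\<infinity>" "\<infinity>" "bump \<alpha> \<beta> n"] by auto
  then have H: "(H has_real_derivative bump \<alpha> \<beta> n x) (at x)" for x
    by (simp add: has_real_derivative_iff_has_vector_derivative)
  have "test_bump h \<alpha> \<beta> n x = H x - H (x - h)" for x
    unfolding test_bump_def using assms H cont
    by (intro integral_FTC_Icc_real) (auto intro!: continuous_at_imp_continuous_on)
  then have eq: "test_bump h \<alpha> \<beta> n = (\<lambda>x. H x - H (x - h))" by auto
  have "((\<lambda>x. H (x - h)) has_real_derivative bump \<alpha> \<beta> n (x - h) * 1) (at x)"
    by (rule DERIV_chain2[OF H]) (auto intro!: derivative_eq_intros)
  then show ?thesis unfolding eq using H by (auto intro!: derivative_eq_intros)
qed

lemma test_bump_test_function: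
  assumes "0 < h" "0 < \<alpha>" "\<alpha> < \<beta>" "\<beta> + h < 1"
  shows "test_function (test_bump h \<alpha> \<beta> n)"
    "deriv (test_bump h \<alpha> \<beta> n) = (\<lambda>x. bump \<alpha> \<beta> n x - bump \<alpha> \<beta> n (x - h))"
proof -
  show d: "deriv (test_bump h \<alpha> \<beta> n) = (\<lambda>x. bump \<alpha> \<beta> n x - bump \<alpha> \<beta> n (x - h))"
    by (rule ext) (intro DERIV_imp_deriv test_bump_deriv assms)
  have "flat_exp_sum (\<lambda>x. 1 * bump \<alpha> \<beta> n (x - 0) + (- 1) * bump \<alpha> \<beta> n (x - h))"
    by (intro flat_add bump_flat_exp_sum)
  then have fl: "flat_exp_sum (deriv (test_bump h \<alpha> \<beta> n))" by (simp add: d)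
  have "(deriv ^^ k) (test_bump h \<alpha> \<beta> n) differentiable at x" for k x
  proof (cases k)
    case 0
    then show ?thesis using test_bump_deriv[OF assms(1), of \<alpha> \<beta> n x] by (auto simp: real_differentiable_def)
  next
    case (Suc j)
    then show ?thesis using flat_exp_sum_smooth(2)[OF fl] by (simp add: funpow_swap1)
  qed
  moreover have "closure {x. test_bump h \<alpha> \<beta> n x \<noteq> 0} \<subseteq> {0<..<1}"
  proof -
    have "test_bump h \<alpha> \<beta> n x = 0" if "x \<notin> {\<alpha>..\<beta> + h}" for x
    proof -
      have "bump \<alpha> \<beta> n y * indicator {x-h..x} y = 0" for y
        using that bump_eq_0[of y \<alpha> \<beta> n] assms by (cases "y \<in> {\<alpha><..<\<beta>}") (auto simp: indicator_def)
      then have "test_bump h \<alpha> \<beta> n x = (\<integral>y. 0 \<partial>(lborel::real measure))"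
        unfolding test_bump_def by (rule Bochner_Integration.integral_cong[OF refl])
      then show ?thesis by simp
    qed
    then have "{x. test_bump h \<alpha> \<beta> n x \<noteq> 0} \<subseteq> {\<alpha>..\<beta> + h}" by blast
    then have "closure {x. test_bump h \<alpha> \<beta> n x \<noteq> 0} \<subseteq> {\<alpha>..\<beta> + h}"
      by (rule closure_minimal) simp
    also have "\<dots> \<subseteq> {0<..<1}" using assms by auto
    finally show ?thesis .
  qed
  ultimately show "test_function (test_bump h \<alpha> \<beta> n)" by (simp add: test_function_def)
qed

lemma test_function_deriv:
  assumes "test_function \<psi>"
  shows "test_function (deriv \<psi>)"
proof -
  have "{x. deriv \<psi> x \<noteq> 0} \<subseteq> closure {x. \<psi> x \<noteq> 0}"
  proof
    fix x assume x: "x \<in> {x. deriv \<psi> x \<noteq> 0}"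
    show "x \<in> closure {x. \<psi> x \<noteq> 0}"
    proof (rule ccontr)
      assume "x \<notin> closure {x. \<psi> x \<noteq> 0}"
      then have mem: "x \<in> - closure {x. \<psi> x \<noteq> 0}" by simp
      have "open (- closure {x. \<psi> x \<noteq> 0})" by (intro open_Compl closed_closure)
      moreover have "0 = \<psi> y" if "y \<in> - closure {x. \<psi> x \<noteq> 0}" for y
        using that closure_subset[of "{x. \<psi> x \<noteq> 0}"] by auto
      ultimately have "(\<psi> has_real_derivative 0) (at x)"
        using has_field_derivative_transform_within_open[OF DERIV_const[of 0] _ mem] by blast
      then have "deriv \<psi> x = 0" by (rule DERIV_imp_deriv)
      then show False using x by simp
    qed
  qed
  then have "closure {x. deriv \<psi> x \<noteq> 0} \<subseteq> closure {x. \<psi> x \<noteq> 0}"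
    by (rule closure_minimal) simp
  also have "\<dots> \<subseteq> {0<..<1}" using assms by (simp add: test_function_def)
  finally have "closure {x. deriv \<psi> x \<noteq> 0} \<subseteq> {0<..<1}" .
  moreover have "(deriv ^^ k) (deriv \<psi>) differentiable at x" for k x
  proof -
    have "(deriv ^^ Suc k) \<psi> differentiable at x" using assms unfolding test_function_def by blast
    then show ?thesis by (simp add: funpow_swap1)
  qed
  ultimately show ?thesis by (simp add: test_function_def)
qed

text \<open>
  The derivative of a test function is a test function, so the relation for order \<open>k + 1\<close> is the one for
  order \<open>k\<close> applied to a derivative. Hence it is enough to study weak derivatives of first order.
\<close>

lemma has_weak_deriv_step:
  assumes "has_weak_deriv k f g" "has_weak_deriv (Suc k) f g'"
  shows "has_weak_deriv 1 g g'"
  unfolding has_weak_deriv_def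
proof (intro conjI allI impI)
  show "locally_integrable g" "locally_integrable g'" using assms by (auto simp: has_weak_deriv_def)
  fix \<psi> assume \<psi>: "test_function \<psi>"
  have "(\<integral>x. f x * (deriv ^^ Suc k) \<psi> x \<partial>lebesgue_on {0<..<1})
      = (-1) ^ Suc k * (\<integral>x. g' x * \<psi> x \<partial>lebesgue_on {0<..<1})"
    using assms(2) \<psi> unfolding has_weak_deriv_def by blast
  moreover have "(\<integral>x. f x * (deriv ^^ k) (deriv \<psi>) x \<partial>lebesgue_on {0<..<1})
      = (-1) ^ k * (\<integral>x. g x * deriv \<psi> x \<partial>lebesgue_on {0<..<1})"
    using assms(1) test_function_deriv[OF \<psi>] unfolding has_weak_deriv_def by blast
  moreover have "(deriv ^^ k) (deriv \<psi>) = (deriv ^^ Suc k) \<psi>" by (simp add: funpow_swap1)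
  ultimately have "(-1) ^ k * (\<integral>x. g x * deriv \<psi> x \<partial>lebesgue_on {0<..<1})
     = (-1) ^ k * (- (\<integral>x. g' x * \<psi> x \<partial>lebesgue_on {0<..<1}))" by simp
  then have "(\<integral>x. g x * deriv \<psi> x \<partial>lebesgue_on {0<..<1}) = - (\<integral>x. g' x * \<psi> x \<partial>lebesgue_on {0<..<1})"
    by (rule mult_left_cancel[THEN iffD1, rotated]) simp
  then show "(\<integral>x. g x * (deriv ^^ 1) \<psi> x \<partial>lebesgue_on {0<..<1})
     = (-1) ^ 1 * (\<integral>x. g' x * \<psi> x \<partial>lebesgue_on {0<..<1})" by simp
qed

section \<open>Differences of weakly differentiable functions\<close>

text \<open>
  The Borel sets over which \<open>u\<close> has integral 0 form a Dynkin system, so the sets where \<open>u\<close> is positive or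
  negative are among them.
\<close>

lemma AE_zero_if_interval_integrals_zero:
  fixes u :: "real \<Rightarrow> real"
  assumes u: "integrable lborel u"
    and zero: "\<And>a b. (LBINT x. u x * indicator {a<..<b} x) = 0"
    and total: "(LBINT x. u x) = 0"
  shows "AE x in lborel. u x = 0"
proof -
  have all: "(LBINT x. u x * indicator A x) = 0" if "A \<in> sets borel" for A
  proof -
    let ?G = "range (\<lambda>(a, b). {a<..<b::real})"
    have ui: "integrable lborel (\<lambda>x. u x * indicator A x)" if "A \<in> sets borel" for A
      using integrable_real_mult_indicator[of A lborel u] u that by simp
    have borel: "sets (borel :: real measure) = sigma_sets UNIV ?G"
      by (subst borel_eq_box) (simp add: box_real case_prod_beta)
    have "Int_stable ?G"
    proof (rule Int_stableI)
      fix A B assume "A \<in> ?G" "B \<in> ?G"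
      then obtain a b c d where "A = {a<..<b}" "B = {c<..<d}" by auto
      then have "A \<inter> B = (\<lambda>(a, b). {a<..<b}) (max a c, min b d)" by auto
      then show "A \<inter> B \<in> ?G" by blast
    qed
    moreover have "?G \<subseteq> Pow UNIV" by simp
    moreover have "A \<in> sigma_sets UNIV ?G" using that unfolding borel .
    ultimately show ?thesis
    proof (induction rule: sigma_sets_induct_disjoint[consumes 3, case_names basic empty compl union])
      case (basic A)
      then show ?case using zero by auto
    next
      case empty
      then show ?case by simp
    next
      case (compl A)
      then have A: "A \<in> sets borel" unfolding borel by simp
      have "(LBINT x. u x * indicator (UNIV - A) x) = (LBINT x. u x - u x * indicator A x)"
        by (intro Bochner_Integration.integral_cong) (auto simp: indicator_def)
      also have "\<dots> = 0" using compl u ui[OF A] total by simp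
      finally show ?case .
    next
      case (union A)
      then have A: "A i \<in> sets borel" for i unfolding borel using union(1) by auto
      have "set_lebesgue_integral lborel (\<Union>i. A i) u = (\<Sum>i. set_lebesgue_integral lborel (A i) u)"
      proof (rule lebesgue_integral_countable_add)
        show "A i \<inter> A j = {}" if "i \<noteq> j" for i j
          using union that by (auto simp: disjoint_family_on_def)
        show "set_integrable lborel (\<Union>i. A i) u"
          unfolding set_integrable_def using ui[of "\<Union>i. A i"] A by (simp add: mult.commute)
      qed (use A in auto)
      then show ?case using union by (simp add: set_lebesgue_integral_def mult.commute)
    qed
  qed
  have um: "u \<in> borel_measurable borel" using u by auto
  have half: "AE x in lborel. u x * indicator {x. 0 < c * u x} x = 0" if "c \<noteq> 0" for c
  proof -
    have S: "{x. 0 < c * u x} \<in> sets borel" using um by measurable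
    have i: "integrable lborel (\<lambda>x. c * (u x * indicator {x. 0 < c * u x} x))"
      using integrable_real_mult_indicator[of "{x. 0 < c * u x}" lborel u] u S by simp
    have "(LBINT x. c * (u x * indicator {x. 0 < c * u x} x)) = 0" using all[OF S] by simp
    moreover have "AE x in lborel. 0 \<le> c * (u x * indicator {x. 0 < c * u x} x)"
      by (intro AE_I2) (auto simp: indicator_def)
    ultimately have "AE x in lborel. c * (u x * indicator {x. 0 < c * u x} x) = 0"
      using integral_nonneg_eq_0_iff_AE[OF i] by simp
    then show ?thesis using that by (auto elim!: eventually_mono)
  qed
  have "AE x in lborel. u x * indicator {x. 0 < u x} x = 0" "AE x in lborel. u x * indicator {x. u x < 0} x = 0"
    using half[of 1] half[of "-1"] by simp_all
  then show ?thesis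
    by eventually_elim (auto simp: indicator_def split: if_splits)
qed

text \<open>
  Integrated over an interval, \<open>f(x + h) - f(x)\<close> equals the integral of \<open>g\<close> from \<open>x\<close> to \<open>x + h\<close>. The defining
  relation is used with \<open>test_bump\<close>; for \<open>n \<rightarrow> \<infinity>\<close> dominated convergence replaces the smooth bumps by
  indicator functions, and Fubini's theorem rewrites the side with \<open>g\<close>.
\<close>

lemma weak_deriv_difference_mean:
  fixes f g :: "real \<Rightarrow> real"
  assumes f: "integrable lborel f" and g: "integrable lborel g" and h: "0 < h"
    and weak: "\<And>\<psi>. test_function \<psi> \<Longrightarrow> (LBINT x. f x * deriv \<psi> x) = - (LBINT x. g x * \<psi> x)"
    and ab: "0 < \<alpha>" "\<alpha> < \<beta>" "\<beta> + h < 1"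
  defines "D \<equiv> \<lambda>x. LBINT s. g (x + s) * indicator {0..h} s"
  shows "integrable lborel (\<lambda>x. (f (x + h) - f x - D x) * indicator {\<alpha><..<\<beta>} x)"
    "(LBINT x. (f (x + h) - f x - D x) * indicator {\<alpha><..<\<beta>} x) = 0"
proof -
  have fm[measurable]: "f \<in> borel_measurable borel" and gm[measurable]: "g \<in> borel_measurable borel"
    using f g by auto
  let ?I = "indicator {\<alpha><..<\<beta>} :: real \<Rightarrow> real"
  let ?b = "bump \<alpha> \<beta>"
  let ?w = "\<lambda>x y :: real. if x - h \<le> y \<and> y \<le> x then 1 else 0 :: real"
  have w: "indicator {x-h..x} y = ?w x y" "indicator {y..y+h} x = ?w x y" for x y
    by (auto simp: indicator_def)
  define J where "J x = (LBINT y. ?I y * indicator {x-h..x} y)" for x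
  have bm[measurable]: "?b n \<in> borel_measurable borel" for n
    using bump_continuous[of UNIV] by (rule borel_measurable_continuous_onI)
  have tm[measurable]: "test_bump h \<alpha> \<beta> n \<in> borel_measurable borel" for n
    using test_bump_deriv[OF h, of \<alpha> \<beta> n] DERIV_isCont
    by (intro borel_measurable_continuous_onI continuous_at_imp_continuous_on) blast
  have iI: "integrable lborel (indicator {c..d} :: real \<Rightarrow> real)" "integrable lborel (indicator {c<..<d} :: real \<Rightarrow> real)" for c d
    by (cases "c \<le> d"; auto intro!: integrable_real_indicator)+
  have tJ: "(\<lambda>n. test_bump h \<alpha> \<beta> n x) \<longlonglongrightarrow> J x" for x
    unfolding test_bump_def J_def
  proof (rule integral_dominated_convergence[where w = "indicator {x-h..x}"])
    show "AE y in lborel. (\<lambda>n. ?b n y * indicator {x - h..x} y) \<longlonglongrightarrow> ?I y * indicator {x - h..x} y"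
      by (intro AE_I2 tendsto_mult bump_tendsto ab tendsto_const)
    show "AE y in lborel. norm (?b n y * indicator {x - h..x} y) \<le> indicator {x - h..x} y" for n
      by (intro AE_I2) (use bump_range in \<open>auto simp: indicator_def\<close>)
  qed (auto intro: iI)
  have Jm[measurable]: "J \<in> borel_measurable borel"
    by (rule borel_measurable_LIMSEQ_real[OF tJ tm])
  have ti: "\<bar>test_bump h \<alpha> \<beta> n x\<bar> \<le> h" for n x
  proof -
    have "\<bar>test_bump h \<alpha> \<beta> n x\<bar> \<le> (LBINT y. \<bar>?b n y * indicator {x-h..x} y\<bar>)"
      unfolding test_bump_def by (rule integral_abs_bound)
    also have "\<dots> \<le> (LBINT y. indicator {x-h..x} y)"
      by (rule integral_mono'[OF iI(1)]) (use bump_range in \<open>auto simp: indicator_def\<close>)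
    finally have "\<bar>test_bump h \<alpha> \<beta> n x\<bar> \<le> (LBINT y. indicator {x-h..x} y)" .
    then show ?thesis using h by simp
  qed
  have "(\<lambda>n. LBINT x. f x * (?b n x - ?b n (x - h))) \<longlonglongrightarrow> (LBINT x. f x * (?I x - ?I (x - h)))"
  proof (rule integral_dominated_convergence[where w = "\<lambda>x. \<bar>f x\<bar>"])
    show "AE x in lborel. (\<lambda>n. f x * (?b n x - ?b n (x - h))) \<longlonglongrightarrow> f x * (?I x - ?I (x - h))"
      by (intro AE_I2 tendsto_intros bump_tendsto ab)
    show "AE x in lborel. norm (f x * (?b n x - ?b n (x - h))) \<le> \<bar>f x\<bar>" for n
    proof (intro AE_I2)
      fix x
      have "\<bar>?b n x - ?b n (x - h)\<bar> \<le> 1"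
        using bump_range[of \<alpha> \<beta> n x] bump_range[of \<alpha> \<beta> n "x - h"] by (auto simp: abs_le_iff)
      then have "\<bar>f x\<bar> * \<bar>?b n x - ?b n (x - h)\<bar> \<le> \<bar>f x\<bar> * 1" by (intro mult_left_mono) auto
      then show "norm (f x * (?b n x - ?b n (x - h))) \<le> \<bar>f x\<bar>" by (simp add: abs_mult)
    qed
  qed (use f in auto)
  moreover have "(\<lambda>n. - (LBINT x. g x * test_bump h \<alpha> \<beta> n x)) \<longlonglongrightarrow> - (LBINT x. g x * J x)"
  proof (intro tendsto_minus integral_dominated_convergence[where w = "\<lambda>x. h * \<bar>g x\<bar>"])
    show "AE x in lborel. (\<lambda>n. g x * test_bump h \<alpha> \<beta> n x) \<longlonglongrightarrow> g x * J x"
      by (intro AE_I2 tendsto_intros tJ)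
    show "AE x in lborel. norm (g x * test_bump h \<alpha> \<beta> n x) \<le> h * \<bar>g x\<bar>" for n
    proof (intro AE_I2)
      fix x
      show "norm (g x * test_bump h \<alpha> \<beta> n x) \<le> h * \<bar>g x\<bar>"
        using mult_left_mono[OF ti[of n x], of "\<bar>g x\<bar>"] by (simp add: abs_mult mult.commute)
    qed
  qed (use g in auto)
  moreover have "(LBINT x. f x * (?b n x - ?b n (x - h))) = - (LBINT x. g x * test_bump h \<alpha> \<beta> n x)" for n
    using weak[OF test_bump_test_function(1)[OF h ab, of n]] test_bump_test_function(2)[OF h ab, of n] by simp
  ultimately have eq1: "(LBINT x. f x * (?I x - ?I (x - h))) = - (LBINT x. g x * J x)"
    using LIMSEQ_unique by auto
  define K where "K x y = g x * (?I y * ?w x y)" for x y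
  have Kint: "integrable (lborel \<Otimes>\<^sub>M lborel) (case_prod K)"
  proof (rule lborel_pair.Fubini_integrable)
    show "case_prod K \<in> borel_measurable (lborel \<Otimes>\<^sub>M lborel)"
      unfolding K_def by measurable
    have i: "integrable lborel (\<lambda>y. ?I y * ?w x y)" for x
      by (rule Bochner_Integration.integrable_bound[OF iI(2)[of \<alpha> \<beta>]]) (auto simp: indicator_def)
    then show "AE x in lborel. integrable lborel (\<lambda>y. case_prod K (x, y))"
      by (simp add: K_def)
    have "(LBINT y. norm (case_prod K (x, y))) = \<bar>g x\<bar> * J x" for x
    proof -
      have "(LBINT y. norm (case_prod K (x, y))) = (LBINT y. \<bar>g x\<bar> * (?I y * ?w x y))"
        by (intro Bochner_Integration.integral_cong) (auto simp: K_def abs_mult)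
      then show ?thesis by (simp add: J_def w)
    qed
    moreover have "integrable lborel (\<lambda>x. \<bar>g x\<bar> * J x)"
    proof (rule Bochner_Integration.integrable_bound[where f = "\<lambda>x. h * \<bar>g x\<bar>"])
      have Jh: "\<bar>J x\<bar> \<le> h" for x
        by (rule LIMSEQ_le_const2[OF tendsto_rabs[OF tJ]]) (use ti in auto)
      show "AE x in lborel. norm (\<bar>g x\<bar> * J x) \<le> norm (h * \<bar>g x\<bar>)"
      proof (intro AE_I2)
        fix x
        show "norm (\<bar>g x\<bar> * J x) \<le> norm (h * \<bar>g x\<bar>)"
          using mult_left_mono[OF Jh[of x], of "\<bar>g x\<bar>"] h by (simp add: abs_mult mult.commute)
      qed
    qed (use g in auto)
    ultimately show "integrable lborel (\<lambda>x. LBINT y. norm (case_prod K (x, y)))" by simp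
  qed
  have D: "D y = (LBINT x. g x * ?w x y)" for y
  proof -
    have "(LBINT x. g x * ?w x y) = (LBINT s. g (y + 1 * s) * ?w (y + 1 * s) y)"
      by (subst lborel_integral_real_affine[of 1 _ y]) auto
    also have "\<dots> = D y" unfolding D_def
      by (intro Bochner_Integration.integral_cong) (auto simp: indicator_def)
    finally show ?thesis by simp
  qed
  have KD: "(LBINT x. K x y) = D y * ?I y" for y
  proof -
    have "(LBINT x. K x y) = (LBINT x. ?I y * (g x * ?w x y))"
      by (simp add: K_def mult.left_commute)
    then show ?thesis by (simp add: D)
  qed
  have Di: "integrable lborel (\<lambda>y. D y * ?I y)"
    using lborel_pair.integrable_snd[OF Kint] by (simp add: KD)
  have "(LBINT x. g x * J x) = (LBINT x. (LBINT y. K x y))"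
    by (simp add: K_def J_def w)
  also have "\<dots> = (LBINT y. D y * ?I y)"
    using lborel_pair.Fubini_integral[OF Kint] by (simp add: KD)
  finally have eq2: "(LBINT x. g x * J x) = (LBINT y. D y * ?I y)" .
  have f1: "integrable lborel (\<lambda>x. f x * ?I x)"
    using integrable_real_mult_indicator[of "{\<alpha><..<\<beta>}" lborel f] f by simp
  have fh: "integrable lborel (\<lambda>x. f (x + h))"
    using lborel_integrable_real_affine[OF f, of 1 h] by (simp add: add.commute)
  have f2: "integrable lborel (\<lambda>x. f (x + h) * ?I x)"
    using integrable_real_mult_indicator[of "{\<alpha><..<\<beta>}" lborel "\<lambda>x. f (x + h)"] fh by simp
  have f3: "integrable lborel (\<lambda>x. f x * ?I (x - h))"
    using lborel_integrable_real_affine[OF f2, of 1 "- h"] by simp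
  have "(LBINT x. f x * ?I (x - h)) = (LBINT x. f (x + h) * ?I x)"
    using lborel_integral_real_affine[of 1 "\<lambda>x. f x * ?I (x - h)" h] by (simp add: add.commute)
  moreover have "(LBINT x. f x * (?I x - ?I (x - h))) = (LBINT x. f x * ?I x) - (LBINT x. f x * ?I (x - h))"
    using f1 f3 by (simp add: right_diff_distrib)
  ultimately have "(LBINT x. f (x + h) * ?I x) - (LBINT x. f x * ?I x) - (LBINT y. D y * ?I y) = 0"
    using eq1 eq2 by simp
  then show "(LBINT x. (f (x + h) - f x - D x) * indicator {\<alpha><..<\<beta>} x) = 0"
    using f1 f2 Di by (simp add: left_diff_distrib)
  show "integrable lborel (\<lambda>x. (f (x + h) - f x - D x) * indicator {\<alpha><..<\<beta>} x)"
    using f1 f2 Di by (simp add: left_diff_distrib)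
qed

lemma weak_deriv_difference:
  fixes f g :: "real \<Rightarrow> real"
  assumes f: "integrable lborel f" and g: "integrable lborel g" and h: "0 < h"
    and weak: "\<And>\<psi>. test_function \<psi> \<Longrightarrow> (LBINT x. f x * deriv \<psi> x) = - (LBINT x. g x * \<psi> x)"
  shows "AE x in lborel. 0 < x \<and> x + h < 1 \<longrightarrow>
    f (x + h) - f x = (LBINT s. g (x + s) * indicator {0..h} s)"
proof -
  define u where "u x = f (x + h) - f x - (LBINT s. g (x + s) * indicator {0..h} s)" for x
  have ae: "AE x in lborel. u x * indicator {\<epsilon><..<1 - h - \<epsilon>} x = 0" if "0 < \<epsilon>" for \<epsilon>
  proof (rule AE_zero_if_interval_integrals_zero)
    let ?e = "{\<epsilon><..<1 - h - \<epsilon>}"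
    show int: "integrable lborel (\<lambda>x. u x * indicator ?e x)"
    proof (cases "\<epsilon> < 1 - h - \<epsilon>")
      case True
      then show ?thesis unfolding u_def
        using that by (intro weak_deriv_difference_mean(1)[OF f g h weak]) auto
    qed simp
    have *: "(LBINT x. u x * indicator ({\<epsilon><..<1 - h - \<epsilon>} \<inter> {a<..<b}) x) = 0" for a b
    proof -
      have e: "?e \<inter> {a<..<b} = {max \<epsilon> a<..<min (1 - h - \<epsilon>) b}" by auto
      show ?thesis
      proof (cases "max \<epsilon> a < min (1 - h - \<epsilon>) b")
        case True
        then show ?thesis unfolding u_def e
          using that by (intro weak_deriv_difference_mean(2)[OF f g h weak]) auto
      next
        case False
        then have E: "{max \<epsilon> a<..<min (1 - h - \<epsilon>) b} = {}"
          by (simp only: greaterThanLessThan_empty_iff not_less)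
        then show ?thesis unfolding e E by simp
      qed
    qed
    show "(LBINT x. u x * indicator ?e x * indicator {a<..<b} x) = 0" for a b
      using *[of a b] by (simp only: indicator_inter_arith mult.assoc)
    show "(LBINT x. u x * indicator ?e x) = 0"
      using *[of \<epsilon> "1 - h - \<epsilon>"] by simp
  qed
  have "AE x in lborel. \<forall>n. u x * indicator {1 / real (Suc n)<..<1 - h - 1 / real (Suc n)} x = 0"
    by (subst AE_all_countable) (intro allI ae, simp)
  then show ?thesis
  proof eventually_elim
    case (elim x)
    show ?case
    proof
      assume x: "0 < x \<and> x + h < 1"
      then obtain n where n: "1 / real (Suc n) < min x (1 - h - x)"
        using reals_Archimedean[of "min x (1 - h - x)"] by (auto simp: inverse_eq_divide)
      then have "x \<in> {1 / real (Suc n)<..<1 - h - 1 / real (Suc n)}" by auto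
      then have "u x = 0" using elim[rule_format, of n] by simp
      then show "f (x + h) - f x = (LBINT s. g (x + s) * indicator {0..h} s)" by (simp add: u_def)
    qed
  qed
qed


lemma AE_lborel_translate:
  fixes t :: real
  assumes "AE x in lborel. P x"
  shows "AE x in lborel. P (x + t)"
proof -
  obtain N where N: "{x \<in> space lborel. \<not> P x} \<subseteq> N" "emeasure lborel N = 0" "N \<in> sets lborel"
    using AE_E[OF assms] by blast
  then have "N \<in> null_sets lborel" by auto
  from null_sets_translation[OF this, of "- t"] show ?thesis
    by (rule AE_I') (use N in auto)
qed

lemma fdiff_funpow_measurable [measurable]:
  assumes [measurable]: "u \<in> borel_measurable borel"
  shows "(fdiff h ^^ j) u \<in> borel_measurable borel"
proof -
  have "(fdiff h ^^ j) u = (\<lambda>x. \<Sum>l\<le>j. (-1) ^ (j + l) * real (j choose l) * u (x + real l * h))"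
    by (rule ext) (rule fdiff_funpow)
  then show ?thesis by simp
qed

text \<open>
  Each weak derivative turns one difference into an average: almost everywhere \<open>\<Delta>\<^sub>h\<^bsup>j+1\<^esup>F\<^sub>i\<close> is \<open>h\<close> times the mean
  of \<open>\<Delta>\<^sub>h\<^sup>jF\<^bsub>i+1\<^esub>\<close> over a window of length \<open>h\<close>. Averages do not increase the norm, so each of the \<open>r\<close> steps
  costs a factor \<open>h\<close>.
\<close>

lemma Lp_le_fdiff_weak:
  fixes F :: "nat \<Rightarrow> real \<Rightarrow> real"
  assumes p: "1 \<le> p" and h: "0 < h"
    and int: "\<And>i. i \<le> r \<Longrightarrow> integrable lborel (F i)"
    and diff: "\<And>i. i < r \<Longrightarrow> AE x in lborel. 0 < x \<and> x + h < 1 \<longrightarrow>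
      F i (x + h) - F i x = (LBINT s. F (Suc i) (x + s) * indicator {0..h} s)"
    and M: "0 \<le> M" "Lp_le p {0..<1} (F r) M"
  shows "Lp_le p {0..<1 - real r * h} ((fdiff h ^^ r) (F 0)) (h ^ r * M)"
proof -
  have "j \<le> r \<Longrightarrow> Lp_le p {0..<1 - real j * h} ((fdiff h ^^ j) (F (r - j))) (h ^ j * M)" for j
  proof (induction j)
    case 0
    then show ?case using M by simp
  next
    case (Suc j)
    define i where "i = r - Suc j"
    have i: "r - j = Suc i" "r - Suc j = i" "i < r" "Suc i \<le> r" using Suc.prems by (auto simp: i_def)
    define G where "G = (fdiff h ^^ j) (F (Suc i))"
    have Fi: "integrable lborel (F (Suc i))" using int i by simp
    then have [measurable]: "F (Suc i) \<in> borel_measurable borel" by auto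
    have Gm[measurable]: "G \<in> borel_measurable borel" unfolding G_def by measurable
    let ?A = "{0..<1 - real (Suc j) * h}"
    let ?m = "\<lambda>x. (LBINT s. G (x + s) * indicator {0..h} s) / (h - 0)"
    have "Lp_le p ?A ?m (h ^ j * M)"
    proof (rule Lp_le_mean[OF p h])
      show "Lp_le p ?A (\<lambda>x. G (x + s)) (h ^ j * M)" if s: "0 \<le> s" "s \<le> h" for s
      proof -
        have "Lp_le p {0..<1 - real j * h} G (h ^ j * M)"
          using Suc i by (simp add: G_def)
        from Lp_le_affine[OF Gm _ _ this, of 1 s]
        have "Lp_le p {x. s + x \<in> {0..<1 - real j * h}} (\<lambda>x. G (s + x)) (h ^ j * M)" by simp
        then show ?thesis
          by (rule Lp_le_mono[rotated]) (use s in \<open>auto simp: algebra_simps\<close>)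
      qed
    qed (use M h in \<open>auto simp: zero_le_mult_iff\<close>)
    then have "Lp_le p ?A (\<lambda>x. h * ?m x) (h * (h ^ j * M))"
      using M h by (intro Lp_le_scale) auto
    moreover have "AE x in lborel. \<forall>l::nat. 0 < x + real l * h \<and> x + real l * h + h < 1 \<longrightarrow>
        F i (x + real l * h + h) - F i (x + real l * h)
          = (LBINT s. F (Suc i) (x + real l * h + s) * indicator {0..h} s)"
      by (subst AE_all_countable) (intro allI AE_lborel_translate diff i)
    then have "AE x in lborel. x \<in> ?A \<longrightarrow> x \<in> ?A \<and> \<bar>(fdiff h ^^ Suc j) (F i) x\<bar> \<le> \<bar>h * ?m x\<bar>"
      using AE_lborel_singleton[of 0]
    proof eventually_elim
      case (elim x)
      show ?case
      proof (intro impI conjI)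
        assume x: "x \<in> ?A"
        have ii: "integrable lborel (\<lambda>s. F (Suc i) (x + real l * h + s) * indicator {0..h} s)" for l
          using integrable_real_mult_indicator[of "{0..h}" lborel "\<lambda>s. F (Suc i) (x + real l * h + s)"]
            lborel_integrable_real_affine[OF Fi, of 1 "x + real l * h"] by simp
        have "(fdiff h ^^ Suc j) (F i) x = (fdiff h ^^ j) (fdiff h (F i)) x"
          by (simp only: funpow_Suc_right o_apply)
        also have "\<dots> = (\<Sum>l\<le>j. (-1) ^ (j + l) * real (j choose l) *
            (LBINT s. F (Suc i) (x + real l * h + s) * indicator {0..h} s))"
          unfolding fdiff_funpow
        proof (intro sum.cong refl arg_cong2[where f = "(*)"])
          fix l assume "l \<in> {..j}"
          then have "real l * h \<le> real j * h" using h by (intro mult_right_mono) auto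
          moreover have "0 \<le> real l * h" using h by simp
          ultimately have "0 < x + real l * h" "x + real l * h + h < 1"
            using x elim(2) by (auto simp: algebra_simps)
          then show "fdiff h (F i) (x + real l * h) = (LBINT s. F (Suc i) (x + real l * h + s) * indicator {0..h} s)"
            using elim(1) by (simp add: fdiff_def)
        qed
        also have "\<dots> = (LBINT s. (\<Sum>l\<le>j. (-1) ^ (j + l) * real (j choose l) *
            (F (Suc i) (x + real l * h + s) * indicator {0..h} s)))"
          using ii by (subst Bochner_Integration.integral_sum) auto
        also have "\<dots> = (LBINT s. G (x + s) * indicator {0..h} s)"
        proof (intro Bochner_Integration.integral_cong refl)
          fix s
          have "x + real l * h + s = x + s + real l * h" for l by simp
          then show "(\<Sum>l\<le>j. (-1) ^ (j + l) * real (j choose l) * (F (Suc i) (x + real l * h + s) * indicator {0..h} s))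
              = G (x + s) * indicator {0..h} s"
            by (simp only: G_def fdiff_funpow sum_distrib_right mult.assoc)
        qed
        finally show "\<bar>(fdiff h ^^ Suc j) (F i) x\<bar> \<le> \<bar>h * ?m x\<bar>" using h by simp
      qed
    qed
    ultimately have "Lp_le p ?A ((fdiff h ^^ Suc j) (F i)) (h * (h ^ j * M))"
      by (rule Lp_le_mono_AE[rotated])
    then show ?case by (simp add: i mult.assoc)
  qed
  from this[of r] show ?thesis by simp
qed

section \<open>Steklov means\<close>

definition steklov :: "real \<Rightarrow> (real \<Rightarrow> real) \<Rightarrow> real \<Rightarrow> real" where
  "steklov h u x = (LBINT s. u (x + s) * indicator {0..h} s) / h"

lemma integrable_indicator_mult:
  "integrable lborel u \<Longrightarrow> integrable lborel (\<lambda>x::real. u x * indicator {a..b} x :: real)"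
  using integrable_real_mult_indicator[of "{a..b}" lborel u] by simp

lemma integrable_shift:
  "integrable lborel u \<Longrightarrow> integrable lborel (\<lambda>x::real. u (t + x) :: real)"
  "integrable lborel u \<Longrightarrow> integrable lborel (\<lambda>x::real. u (x + t) :: real)"
  using lborel_integrable_real_affine[of u 1 t] by (simp_all add: add.commute)

lemma steklov_altdef: "steklov h u x = (LBINT y. u y * indicator {x..x+h} y) / h"
proof -
  have "(LBINT y. u y * indicator {x..x+h} y) = (LBINT s. u (x + s) * indicator {x..x+h} (x + s))"
    using lborel_integral_real_affine[of 1 "\<lambda>y. u y * indicator {x..x+h} y" x] by simp
  also have "\<dots> = (LBINT s. u (x + s) * indicator {0..h} s)"
    by (intro Bochner_Integration.integral_cong) (auto simp: indicator_def)
  finally show ?thesis by (simp add: steklov_def)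
qed

lemma steklov_bound:
  assumes "integrable lborel u" "0 < h"
  shows "\<bar>steklov h u x\<bar> \<le> (LBINT y. \<bar>u y\<bar>) / h"
proof -
  have "\<bar>LBINT y. u y * indicator {x..x+h} y\<bar> \<le> (LBINT y. \<bar>u y * indicator {x..x+h} y\<bar>)"
    by (rule integral_abs_bound)
  also have "\<dots> \<le> (LBINT y. \<bar>u y\<bar>)"
    by (rule integral_mono') (use assms in \<open>auto simp: indicator_def\<close>)
  finally show ?thesis using assms(2) by (simp add: steklov_altdef divide_right_mono)
qed

lemma steklov_integrable:
  assumes u: "integrable lborel u" and h: "0 < h"
  shows "integrable lborel (steklov h u)" "(LBINT x. \<bar>steklov h u x\<bar>) \<le> (LBINT x. \<bar>u x\<bar>)"
proof -
  have [measurable]: "u \<in> borel_measurable borel" using u by auto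
  define K where "K s x = u (x + s) * indicator {0..h} s" for s x :: real
  have nK: "(LBINT x. \<bar>K s x\<bar>) = (LBINT x. \<bar>u x\<bar>) * indicator {0..h} s" for s
  proof -
    have "(LBINT x. \<bar>u (x + s)\<bar>) = (LBINT x. \<bar>u x\<bar>)"
      using lborel_integral_real_affine[of 1 "\<lambda>x. \<bar>u x\<bar>" s] by (simp add: add.commute)
    then show ?thesis by (simp add: K_def abs_mult)
  qed
  have iI: "integrable lborel (indicator {0..h} :: real \<Rightarrow> real)" using h by simp
  have Ki: "integrable (lborel \<Otimes>\<^sub>M lborel) (case_prod K)"
  proof (rule lborel_pair.Fubini_integrable)
    show "case_prod K \<in> borel_measurable (lborel \<Otimes>\<^sub>M lborel)" unfolding K_def by measurable
    show "integrable lborel (\<lambda>x. LBINT y. norm (case_prod K (x, y)))"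
      using iI by (simp add: nK)
    show "AE x in lborel. integrable lborel (\<lambda>y. case_prod K (x, y))"
      using integrable_shift(2)[OF u] by (simp add: K_def)
  qed
  have sK: "steklov h u x = (LBINT s. K s x) / h" for x by (simp add: steklov_def K_def)
  show 1: "integrable lborel (steklov h u)"
    unfolding sK[abs_def] using lborel_pair.integrable_snd[OF Ki] by simp
  have Kai: "integrable (lborel \<Otimes>\<^sub>M lborel) (case_prod (\<lambda>s x. \<bar>K s x\<bar>))"
    using Ki by (simp add: case_prod_beta')
  have "(LBINT x. \<bar>steklov h u x\<bar>) \<le> (LBINT x. (LBINT s. \<bar>K s x\<bar>) / h)"
  proof (rule integral_mono)
    show "integrable lborel (\<lambda>x. \<bar>steklov h u x\<bar>)" using 1 by (rule integrable_abs)
    show "integrable lborel (\<lambda>x. (LBINT s. \<bar>K s x\<bar>) / h)"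
      using lborel_pair.integrable_snd[OF Kai] by simp
    show "\<bar>steklov h u x\<bar> \<le> (LBINT s. \<bar>K s x\<bar>) / h" for x
      using h by (simp add: sK divide_right_mono integral_abs_bound)
  qed
  also have "\<dots> = (LBINT s. (LBINT x. \<bar>K s x\<bar>)) / h"
    using lborel_pair.Fubini_integral[OF Kai] by simp
  also have "\<dots> = (LBINT x. \<bar>u x\<bar>)" using h by (simp add: nK)
  finally show "(LBINT x. \<bar>steklov h u x\<bar>) \<le> (LBINT x. \<bar>u x\<bar>)" .
qed

lemma steklov_funpow_integrable:
  assumes "integrable lborel u" "0 < h"
  shows "integrable lborel ((steklov h ^^ k) u)" "(LBINT x. \<bar>(steklov h ^^ k) u x\<bar>) \<le> (LBINT x. \<bar>u x\<bar>)"
proof -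
  have "integrable lborel ((steklov h ^^ k) u) \<and> (LBINT x. \<bar>(steklov h ^^ k) u x\<bar>) \<le> (LBINT x. \<bar>u x\<bar>)"
    using assms steklov_integrable[of "(steklov h ^^ k) u" h for k]
    by (induction k) (auto intro: order_trans)
  then show "integrable lborel ((steklov h ^^ k) u)" "(LBINT x. \<bar>(steklov h ^^ k) u x\<bar>) \<le> (LBINT x. \<bar>u x\<bar>)"
    by auto
qed

lemma fdiff_integrable:
  assumes u: "integrable lborel u"
  shows "integrable lborel (fdiff h u)" "(LBINT x. \<bar>fdiff h u x\<bar>) \<le> 2 * (LBINT x. \<bar>u x\<bar>)"
proof -
  show 1: "integrable lborel (fdiff h u)"
    unfolding fdiff_def[abs_def] using u integrable_shift(2)[OF u] by simp
  have "(LBINT x. \<bar>fdiff h u x\<bar>) \<le> (LBINT x. \<bar>u (x + h)\<bar> + \<bar>u x\<bar>)"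
    using 1 u integrable_shift(2)[OF u] by (intro integral_mono) (auto simp: fdiff_def)
  also have "\<dots> = (LBINT x. \<bar>u (x + h)\<bar>) + (LBINT x. \<bar>u x\<bar>)"
    using u integrable_shift(2)[OF u] by simp
  also have "(LBINT x. \<bar>u (x + h)\<bar>) = (LBINT x. \<bar>u x\<bar>)"
    using lborel_integral_real_affine[of 1 "\<lambda>x. \<bar>u x\<bar>" h] by (simp add: add.commute)
  finally show "(LBINT x. \<bar>fdiff h u x\<bar>) \<le> 2 * (LBINT x. \<bar>u x\<bar>)" by simp
qed

lemma steklov_fdiff:
  assumes "integrable lborel u"
  shows "fdiff h (steklov k u) = steklov k (fdiff h u)"
proof
  fix x
  have i: "integrable lborel (\<lambda>s. u (y + s) * indicator {0..k} s)" for y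
    by (intro integrable_indicator_mult integrable_shift assms)
  have "fdiff h (steklov k u) x = ((LBINT s. u (x + h + s) * indicator {0..k} s)
      - (LBINT s. u (x + s) * indicator {0..k} s)) / k"
    by (simp add: fdiff_def steklov_def diff_divide_distrib)
  also have "(LBINT s. u (x + h + s) * indicator {0..k} s) - (LBINT s. u (x + s) * indicator {0..k} s)
      = (LBINT s. u (x + h + s) * indicator {0..k} s - u (x + s) * indicator {0..k} s)"
    using i by simp
  also have "\<dots> = (LBINT s. fdiff h u (x + s) * indicator {0..k} s)"
    by (intro Bochner_Integration.integral_cong) (auto simp: fdiff_def algebra_simps)
  finally show "fdiff h (steklov k u) x = steklov k (fdiff h u) x"
    unfolding steklov_def[of k "fdiff h u" x] .
qed

lemma steklov_funpow_fdiff: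
  assumes "integrable lborel u" "0 < k"
  shows "fdiff h ((steklov k ^^ n) u) = (steklov k ^^ n) (fdiff h u)"
  by (induction n) (simp_all add: steklov_fdiff steklov_funpow_integrable assms)

lemma integral_split_Icc:
  fixes u :: "real \<Rightarrow> real"
  assumes u: "integrable lborel u" and "a \<le> b" "b \<le> c"
  shows "(LBINT y. u y * indicator {a..c} y)
    = (LBINT y. u y * indicator {a..b} y) + (LBINT y. u y * indicator {b..c} y)"
proof -
  have i: "integrable lborel (\<lambda>y. u y * indicator {a..b} y)" for a b
    by (intro integrable_indicator_mult u)
  have "AE y in lborel. u y * indicator {a..c} y = u y * indicator {a..b} y + u y * indicator {b..c} y"
    using AE_lborel_singleton[of b] by eventually_elim (use assms in \<open>auto simp: indicator_def\<close>)
  then have "(LBINT y. u y * indicator {a..c} y)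
     = (LBINT y. u y * indicator {a..b} y + u y * indicator {b..c} y)"
    using u by (intro integral_cong_AE) auto
  then show ?thesis using i by simp
qed

text \<open>
  The fundamental theorem of calculus for Steklov means. It only compares the integrals of \<open>u\<close> over
  overlapping intervals, so that \<open>u\<close> may be any integrable function.
\<close>

lemma steklov_increment:
  assumes u: "integrable lborel u" and h: "0 < h" and "a \<le> x"
  shows "steklov h u x = steklov h u a + (LBINT y. fdiff h u y * indicator {a..x} y) / h"
proof -
  define I where "I a b = (LBINT y. u y * indicator {a..b} y)" for a b
  have i: "integrable lborel (\<lambda>y. u y * indicator {a..b} y)" for a b
    by (intro integrable_indicator_mult u)
  have "I a x + I x (x + h) = I a (a + h) + I (a + h) (x + h)"
    using integral_split_Icc[OF u, of a x "x + h"] integral_split_Icc[OF u, of a "a + h" "x + h"] assms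
    by (simp add: I_def)
  moreover have "I (a + h) (x + h) = (LBINT y. u (y + h) * indicator {a..x} y)"
  proof -
    have "I (a + h) (x + h) = (LBINT y. u (h + y) * indicator {a+h..x+h} (h + y))"
      unfolding I_def using lborel_integral_real_affine[of 1 "\<lambda>y. u y * indicator {a+h..x+h} y" h] by simp
    also have "\<dots> = (LBINT y. u (y + h) * indicator {a..x} y)"
      by (intro Bochner_Integration.integral_cong) (auto simp: indicator_def add.commute)
    finally show ?thesis .
  qed
  moreover have "(LBINT y. fdiff h u y * indicator {a..x} y)
     = (LBINT y. u (y + h) * indicator {a..x} y) - I a x"
  proof -
    have "integrable lborel (\<lambda>y. u (y + h) * indicator {a..x} y)"
      by (intro integrable_indicator_mult integrable_shift u)
    then show ?thesis using i by (simp add: I_def fdiff_def left_diff_distrib)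
  qed
  ultimately have "I x (x + h) = I a (a + h) + (LBINT y. fdiff h u y * indicator {a..x} y)" by simp
  then show ?thesis using h by (simp add: steklov_altdef I_def add_divide_distrib)
qed

lemma poly_antiderivative:
  fixes Q :: "real poly"
  shows "\<exists>R. pderiv R = Q \<and> degree R \<le> Suc (degree Q)"
proof -
  define R where "R = (\<Sum>i\<le>degree Q. monom (coeff Q i / real (Suc i)) (Suc i))"
  have "coeff R (Suc n) = coeff Q n / real (Suc n)" for n
    by (simp add: R_def coeff_sum sum.delta' coeff_eq_0)
  then have "pderiv R = Q" by (intro poly_eqI) (simp add: coeff_pderiv)
  moreover have "degree R \<le> Suc (degree Q)"
    unfolding R_def by (intro degree_sum_le) (auto intro!: order_trans[OF degree_monom_le])
  ultimately show ?thesis by blast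
qed

lemma integral_poly:
  fixes R :: "real poly"
  assumes "a \<le> x"
  shows "(LBINT y. poly (pderiv R) y * indicator {a..x} y) = poly R x - poly R a"
    "integrable lborel (\<lambda>y. poly (pderiv R) y * indicator {a..x} y)"
proof -
  show "(LBINT y. poly (pderiv R) y * indicator {a..x} y) = poly R x - poly R a"
    using assms by (intro integral_FTC_Icc_real) (auto intro: poly_DERIV)
  have "integrable lborel (\<lambda>y. indicator {a..x} y *\<^sub>R poly (pderiv R) y)"
    by (intro borel_integrable_compact) (auto intro: continuous_intros)
  then show "integrable lborel (\<lambda>y. poly (pderiv R) y * indicator {a..x} y)" by (simp add: mult.commute)
qed

text \<open>
  By \<open>steklov_increment\<close> an \<open>(n + 1)\<close>-fold mean of \<open>u\<close> is a constant plus the integral of an \<open>n\<close>-fold mean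
  of \<open>\<Delta>\<^sub>h u\<close> divided by \<open>h\<close>. Replacing the latter by its approximating polynomial and integrating raises the
  degree by one and multiplies the error by \<open>\<delta> / h\<close>. The bound for the values serves the induction;
  the Lipschitz bound is what sampling on a finer grid requires.
\<close>

lemma steklov_local_polynomial:
  assumes u: "integrable lborel u" and h: "0 < h" and d: "0 < \<delta>" "\<delta> \<le> c * h" and c: "1 \<le> c"
  shows "\<exists>P. degree P < Suc n \<and> (\<forall>x\<in>{a..a+\<delta>}.
      \<bar>(steklov h ^^ Suc n) u x - poly P x\<bar>
        \<le> \<delta> ^ n / h ^ Suc n * (LBINT y. \<bar>(fdiff h ^^ Suc n) u y\<bar> * indicator {a..a+\<delta>} y) \<and>
      \<bar>poly P x\<bar> \<le> (2 * c + 1) ^ n / h * (LBINT y. \<bar>u y\<bar>)) \<and>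
     (\<forall>x\<in>{a..a+\<delta>}. \<forall>y\<in>{a..a+\<delta>}. \<bar>poly P x - poly P y\<bar>
        \<le> (2 * c + 1) ^ n / h\<^sup>2 * (LBINT y. \<bar>u y\<bar>) * \<bar>x - y\<bar>)"
  using u
proof (induction n arbitrary: u)
  case 0
  let ?P = "[:steklov h u a:]"
  have i: "integrable lborel (\<lambda>y. fdiff h u y * indicator {a..x} y)" for x
    by (intro integrable_indicator_mult fdiff_integrable 0)
  have "\<bar>steklov h u x - poly ?P x\<bar> \<le> 1 / h * (LBINT y. \<bar>fdiff h u y\<bar> * indicator {a..a+\<delta>} y)"
    if "x \<in> {a..a+\<delta>}" for x
  proof -
    have "\<bar>LBINT y. fdiff h u y * indicator {a..x} y\<bar> \<le> (LBINT y. \<bar>fdiff h u y * indicator {a..x} y\<bar>)"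
      by (rule integral_abs_bound)
    also have "\<dots> \<le> (LBINT y. \<bar>fdiff h u y\<bar> * indicator {a..a+\<delta>} y)"
      using that by (intro integral_mono integrable_abs i integrable_indicator_mult fdiff_integrable 0)
        (auto simp: indicator_def)
    finally show ?thesis using steklov_increment[OF 0 h, of a x] that h by (simp add: divide_right_mono)
  qed
  moreover have "0 \<le> (LBINT y. \<bar>u y\<bar>)" by simp
  ultimately show ?case using steklov_bound[OF 0 h] h
    by (intro exI[of _ ?P]) auto
next
  case (Suc n)
  define V where "V = (LBINT y. \<bar>u y\<bar>)"
  have V: "0 \<le> V" by (simp add: V_def)
  define w where "w = (steklov h ^^ Suc n) u"
  define B where "B = (2 * c + 1) ^ n / h"
  have B: "0 \<le> B" using c h by (simp add: B_def)
  define E where "E = \<delta> ^ n / h ^ Suc n * (LBINT y. \<bar>(fdiff h ^^ Suc (Suc n)) u y\<bar> * indicator {a..a+\<delta>} y)"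
  have wi: "integrable lborel w" unfolding w_def by (intro steklov_funpow_integrable Suc.prems h)
  have dw: "fdiff h w = (steklov h ^^ Suc n) (fdiff h u)"
    unfolding w_def by (intro steklov_funpow_fdiff Suc.prems h)
  have V2: "(LBINT y. \<bar>fdiff h u y\<bar>) \<le> 2 * V" unfolding V_def by (rule fdiff_integrable[OF Suc.prems])
  obtain Q where Q: "degree Q < Suc n"
    "\<And>x. x \<in> {a..a+\<delta>} \<Longrightarrow> \<bar>fdiff h w x - poly Q x\<bar> \<le> E"
    "\<And>x. x \<in> {a..a+\<delta>} \<Longrightarrow> \<bar>poly Q x\<bar> \<le> B * (2 * V)"
  proof -
    obtain Q where "degree Q < Suc n" and Q: "\<forall>x\<in>{a..a+\<delta>}.
      \<bar>(steklov h ^^ Suc n) (fdiff h u) x - poly Q x\<bar>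
        \<le> \<delta> ^ n / h ^ Suc n * (LBINT y. \<bar>(fdiff h ^^ Suc n) (fdiff h u) y\<bar> * indicator {a..a+\<delta>} y) \<and>
      \<bar>poly Q x\<bar> \<le> (2 * c + 1) ^ n / h * (LBINT y. \<bar>fdiff h u y\<bar>)"
      using Suc.IH[OF fdiff_integrable(1)[OF Suc.prems]] by blast
    moreover have "(fdiff h ^^ Suc n) (fdiff h u) = (fdiff h ^^ Suc (Suc n)) u"
      by (simp only: funpow_Suc_right o_apply)
    moreover have "B * (LBINT y. \<bar>fdiff h u y\<bar>) \<le> B * (2 * V)" using B V2 by (rule mult_left_mono[rotated])
    ultimately show ?thesis using that[of Q] unfolding E_def dw B_def by fastforce
  qed
  obtain R where R: "pderiv R = Q" "degree R \<le> Suc (degree Q)" using poly_antiderivative by blast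
  define P where "P = smult (1 / h) R + [:steklov h w a - poly R a / h:]"
  have P: "poly P x = steklov h w a + (poly R x - poly R a) / h" for x
    by (simp add: P_def diff_divide_distrib)
  have RQ: "poly R x - poly R y = (LBINT z. poly Q z * indicator {y..x} z)" if "y \<le> x" for x y
    using integral_poly(1)[OF that, of R] R by simp
  have Qi: "integrable lborel (\<lambda>z. poly Q z * indicator {y..x} z)" if "y \<le> x" for x y
    using integral_poly(2)[OF that, of R] R by simp
  have wdi: "integrable lborel (\<lambda>z. fdiff h w z * indicator {y..x} z)" for x y
    by (intro integrable_indicator_mult fdiff_integrable wi)
  have E0: "0 \<le> E" using Q(2)[of a] d by (meson abs_ge_zero atLeastAtMost_iff less_eq_real_def less_add_same_cancel1 order_trans order_refl)
  have lip': "\<bar>poly R x - poly R y\<bar> \<le> B * (2 * V) * \<bar>x - y\<bar>" if "x \<in> {a..a+\<delta>}" "y \<in> {a..a+\<delta>}" "y \<le> x" for x y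
  proof -
    have "\<bar>poly R x - poly R y\<bar> \<le> (LBINT z. \<bar>poly Q z * indicator {y..x} z\<bar>)"
      unfolding RQ[OF that(3)] by (rule integral_abs_bound)
    also have "\<dots> \<le> (LBINT z. B * (2 * V) * indicator {y..x} z)"
    proof (rule integral_mono)
      show "integrable lborel (\<lambda>z. \<bar>poly Q z * indicator {y..x} z\<bar>)"
        using Qi[OF that(3)] by (rule integrable_abs)
      show "\<bar>poly Q z * indicator {y..x} z\<bar> \<le> B * (2 * V) * indicator {y..x} z" for z
        using that Q(3)[of z] by (auto simp: indicator_def)
    qed (use that in simp)
    also have "\<dots> = B * (2 * V) * \<bar>x - y\<bar>" using that by simp
    finally show ?thesis .
  qed
  have lipR: "\<bar>poly R x - poly R y\<bar> \<le> B * (2 * V) * \<bar>x - y\<bar>" if "x \<in> {a..a+\<delta>}" "y \<in> {a..a+\<delta>}" for x y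
    using lip'[of x y] lip'[of y x] that by (cases "y \<le> x") (auto simp: abs_minus_commute)
  have "degree P < Suc (Suc n)"
    unfolding P_def using R(2) Q(1) by (intro degree_add_less) (auto intro: le_less_trans[OF degree_smult_le])
  moreover have "\<bar>(steklov h ^^ Suc (Suc n)) u x - poly P x\<bar>
      \<le> \<delta> ^ Suc n / h ^ Suc (Suc n) * (LBINT y. \<bar>(fdiff h ^^ Suc (Suc n)) u y\<bar> * indicator {a..a+\<delta>} y)"
    if x: "x \<in> {a..a+\<delta>}" for x
  proof -
    have ax: "a \<le> x" using x by simp
    have "(steklov h ^^ Suc (Suc n)) u x - poly P x
       = ((LBINT z. fdiff h w z * indicator {a..x} z) - (LBINT z. poly Q z * indicator {a..x} z)) / h"
      using steklov_increment[OF wi h ax] RQ[OF ax] by (simp add: w_def P diff_divide_distrib)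
    also have "\<dots> = (LBINT z. (fdiff h w z - poly Q z) * indicator {a..x} z) / h"
      using wdi Qi[OF ax] by (simp add: left_diff_distrib)
    finally have eq: "\<bar>(steklov h ^^ Suc (Suc n)) u x - poly P x\<bar> = \<bar>LBINT z. (fdiff h w z - poly Q z) * indicator {a..x} z\<bar> / h"
      using h by simp
    have "\<bar>LBINT z. (fdiff h w z - poly Q z) * indicator {a..x} z\<bar>
       \<le> (LBINT z. \<bar>(fdiff h w z - poly Q z) * indicator {a..x} z\<bar>)" by (rule integral_abs_bound)
    also have "\<dots> \<le> (LBINT z. E * indicator {a..x} z)"
    proof (rule integral_mono)
      show "integrable lborel (\<lambda>z. \<bar>(fdiff h w z - poly Q z) * indicator {a..x} z\<bar>)"
        using wdi Qi[OF ax] by (simp add: left_diff_distrib)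
      show "\<bar>(fdiff h w z - poly Q z) * indicator {a..x} z\<bar> \<le> E * indicator {a..x} z" for z
        using Q(2)[of z] x by (auto simp: indicator_def)
    qed (use ax in simp)
    also have "\<dots> = E * (x - a)" using ax by simp
    also have "\<dots> \<le> E * \<delta>" using x E0 by (intro mult_left_mono) auto
    finally have "\<bar>(steklov h ^^ Suc (Suc n)) u x - poly P x\<bar> \<le> E * \<delta> / h"
      unfolding eq using h by (simp add: divide_right_mono)
    then show ?thesis by (simp add: E_def ac_simps)
  qed
  moreover have "\<bar>poly P x\<bar> \<le> (2 * c + 1) ^ Suc n / h * V" if x: "x \<in> {a..a+\<delta>}" for x
  proof -
    have "\<bar>steklov h w a\<bar> \<le> (LBINT y. \<bar>w y\<bar>) / h" by (rule steklov_bound[OF wi h])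
    also have "\<dots> \<le> V / h"
      unfolding w_def V_def using h steklov_funpow_integrable(2)[OF Suc.prems h, of "Suc n"] by (intro divide_right_mono) auto
    finally have 1: "\<bar>steklov h w a\<bar> \<le> V / h" .
    have "\<bar>poly R x - poly R a\<bar> \<le> B * (2 * V) * \<bar>x - a\<bar>" using x d by (intro lipR) auto
    also have "\<dots> \<le> B * (2 * V) * (c * h)" using x d B V by (intro mult_left_mono) auto
    finally have "\<bar>(poly R x - poly R a) / h\<bar> \<le> B * (2 * V) * c" using h by (simp add: field_simps)
    with 1 have "\<bar>poly P x\<bar> \<le> V / h + B * (2 * V) * c" unfolding P by linarith
    also have "\<dots> = (1 + 2 * c * (2 * c + 1) ^ n) / h * V" using h by (simp add: B_def field_simps)
    also have "\<dots> \<le> (2 * c + 1) ^ Suc n / h * V"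
    proof -
      have "1 \<le> (2 * c + 1) ^ n" using c by (intro one_le_power) simp
      then show ?thesis using h V by (intro mult_right_mono divide_right_mono) (auto simp: algebra_simps)
    qed
    finally show ?thesis .
  qed
  moreover have "\<bar>poly P x - poly P y\<bar> \<le> (2 * c + 1) ^ Suc n / h\<^sup>2 * V * \<bar>x - y\<bar>"
    if "x \<in> {a..a+\<delta>}" "y \<in> {a..a+\<delta>}" for x y
  proof -
    have "poly P x - poly P y = (poly R x - poly R y) / h" unfolding P by (simp add: diff_divide_distrib)
    then have "\<bar>poly P x - poly P y\<bar> = \<bar>poly R x - poly R y\<bar> / h" using h by simp
    also have "\<dots> \<le> B * (2 * V) * \<bar>x - y\<bar> / h" using lipR[OF that] h by (intro divide_right_mono) auto
    also have "\<dots> = 2 * (2 * c + 1) ^ n / h\<^sup>2 * V * \<bar>x - y\<bar>" by (simp add: B_def power2_eq_square)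
    also have "\<dots> \<le> (2 * c + 1) ^ Suc n / h\<^sup>2 * V * \<bar>x - y\<bar>"
    proof -
      have "2 * (2 * c + 1) ^ n \<le> (2 * c + 1) * (2 * c + 1) ^ n" using c by (intro mult_right_mono) auto
      then show ?thesis using V by (intro mult_right_mono divide_right_mono) auto
    qed
    finally show ?thesis .
  qed
  ultimately show ?case unfolding V_def by blast
qed

section \<open>Approximation by piecewise polynomials\<close>

lemma Lp_le_sum:
  assumes p: "1 \<le> p" and A: "A \<in> sets borel" and M: "0 \<le> M"
    and g: "\<And>j. g j \<in> borel_measurable borel" "\<And>j. j < n \<Longrightarrow> Lp_le p A (g j) M"
  shows "Lp_le p A (\<lambda>x. \<Sum>j<n. g j x) (4 ^ n * M)"
  using g(2)
proof (induction n)
  case 0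
  have "Lp_le p A (\<lambda>x. 0) M"
    using M by (simp add: Lp_le_def)
  then show ?case by simp
next
  case (Suc n)
  have "Lp_le p A (\<lambda>x. (\<Sum>j<n. g j x) + g n x) (2 * (4 ^ n * M + M))"
    using Suc g(1) M by (intro Lp_le_add p A) auto
  moreover have "0 \<le> 2 * (4 ^ n * M + M)" using M by simp
  moreover have "M \<le> 4 ^ n * M" using M mult_right_mono[of 1 "4 ^ n" M] by simp
  then have "2 * (4 ^ n * M + M) \<le> 4 ^ Suc n * M" by (simp add: algebra_simps)
  ultimately have "Lp_le p A (\<lambda>x. (\<Sum>j<n. g j x) + g n x) (4 ^ Suc n * M)"
    by (rule Lp_le_mono_bound)
  then show ?case by simp
qed

lemma steklov_affine:
  assumes "0 < j"
  shows "(LBINT \<sigma>. u (x + j * \<sigma>) * indicator {0..\<tau>} \<sigma>) / \<tau> = steklov (j * \<tau>) u x"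
proof -
  have "(LBINT s. u (x + s) * indicator {0..j * \<tau>} s)
     = j * (LBINT \<sigma>. u (x + j * \<sigma>) * indicator {0..j * \<tau>} (j * \<sigma>))"
    using lborel_integral_real_affine[of j "\<lambda>s. u (x + s) * indicator {0..j * \<tau>} s" 0] assms by simp
  also have "(LBINT \<sigma>. u (x + j * \<sigma>) * indicator {0..j * \<tau>} (j * \<sigma>))
     = (LBINT \<sigma>. u (x + j * \<sigma>) * indicator {0..\<tau>} \<sigma>)"
    using assms by (intro Bochner_Integration.integral_cong) (auto simp: indicator_def zero_le_mult_iff)
  finally show ?thesis using assms by (simp add: steklov_def)
qed

text \<open>
  The coefficients of the \<open>r\<close>-th difference, see \<open>fdiff_funpow\<close>.
\<close>

definition fdiff_coeff :: "nat \<Rightarrow> nat \<Rightarrow> real" where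
  "fdiff_coeff r j = (-1) ^ (r + j) * real (r choose j)"

text \<open>
  The terms with \<open>j \<ge> 1\<close> of \<open>\<Delta>\<^sub>s\<^sup>r f(x)\<close> after averaging \<open>k\<close> times in the variable \<open>s\<close> over windows of length
  \<open>\<tau>\<close>; averaging \<open>f(x + j s)\<close> in \<open>s\<close> amounts to a Steklov mean of \<open>f\<close> with window \<open>j \<tau>\<close>. The term with \<open>j = 0\<close>
  is a multiple of \<open>f(x)\<close> and is not affected by the averaging.
\<close>

definition steklov_sum :: "(real \<Rightarrow> real) \<Rightarrow> nat \<Rightarrow> real \<Rightarrow> nat \<Rightarrow> real \<Rightarrow> real \<Rightarrow> real" where
  "steklov_sum f r \<tau> k s x = (\<Sum>j=1..r. fdiff_coeff r j * (steklov (real j * \<tau>) ^^ k) f (x + real j * s))"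

context
  fixes f :: "real \<Rightarrow> real" and r :: nat and N \<tau> W :: real and p :: ennreal and L :: "real set"
  assumes p: "1 \<le> p" and f: "integrable lborel f" and r: "1 \<le> r" and N: "1 \<le> N"
    \<comment> \<open>with this \<open>\<tau>\<close> the points \<open>x + j s\<close> with \<open>x < 3/4\<close>, \<open>j \<le> r\<close> and \<open>s \<le> r \<tau>\<close> stay below 1\<close>
    and \<tau>: "\<tau> = 1 / (4 * (real r)\<^sup>2 * N)" and W: "0 \<le> W"
    and diff: "\<And>h. 0 < h \<Longrightarrow> h \<le> 1 / N \<Longrightarrow> Lp_le p {0..<1 - real r * h} ((fdiff h ^^ r) f) W"
    and L: "L \<subseteq> {0..<3/4}" "L \<in> sets borel"
begin

lemma tau_bounds: "0 < \<tau>" "real r * \<tau> \<le> 1 / N" "real r * (real r * \<tau>) \<le> 1 / 4"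
proof -
  have r0: "1 \<le> real r" using r by simp
  show "0 < \<tau>" using r0 N by (simp add: \<tau>)
  have "real r * \<tau> = 1 / (4 * real r) / N" using r0 N by (simp add: \<tau> power2_eq_square field_simps)
  also have "\<dots> \<le> 1 / N" using r0 N by (intro divide_right_mono) auto
  finally show "real r * \<tau> \<le> 1 / N" .
  have "real r * (real r * \<tau>) = (1 / 4) / N" using r0 N by (simp add: \<tau> power2_eq_square field_simps)
  also have "\<dots> \<le> 1 / 4" using N by (simp add: field_simps)
  finally show "real r * (real r * \<tau>) \<le> 1 / 4" .
qed

lemma steklov_j_integrable: "j \<in> {1..r} \<Longrightarrow> integrable lborel ((steklov (real j * \<tau>) ^^ k) f)"
  using tau_bounds by (intro steklov_funpow_integrable f) auto

lemma steklov_j_measurable: "j \<in> {1..r} \<Longrightarrow> (steklov (real j * \<tau>) ^^ k) f \<in> borel_measurable borel"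
  using steklov_j_integrable[of j k] by auto

lemma steklov_sum_integral: "integrable lborel (\<lambda>\<sigma>. steklov_sum f r \<tau> k (s + \<sigma>) x * indicator {0..\<tau>} \<sigma>)"
  "(LBINT \<sigma>. steklov_sum f r \<tau> k (s + \<sigma>) x * indicator {0..\<tau>} \<sigma>) / \<tau> = steklov_sum f r \<tau> (Suc k) s x"
proof -
  let ?v = "\<lambda>j. (steklov (real j * \<tau>) ^^ k) f"
  have i: "integrable lborel (\<lambda>\<sigma>. ?v j (x + real j * s + real j * \<sigma>) * indicator {0..\<tau>} \<sigma>)" if "j \<in> {1..r}" for j
    using lborel_integrable_real_affine[OF steklov_j_integrable[OF that, of k], of "real j" "x + real j * s"] that
    by (intro integrable_indicator_mult) auto
  have eq: "steklov_sum f r \<tau> k (s + \<sigma>) x * indicator {0..\<tau>} \<sigma>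
     = (\<Sum>j=1..r. fdiff_coeff r j * (?v j (x + real j * s + real j * \<sigma>) * indicator {0..\<tau>} \<sigma>))" for \<sigma>
    by (simp add: steklov_sum_def sum_distrib_right distrib_left add.assoc mult.assoc)
  show "integrable lborel (\<lambda>\<sigma>. steklov_sum f r \<tau> k (s + \<sigma>) x * indicator {0..\<tau>} \<sigma>)"
    unfolding eq by (intro Bochner_Integration.integrable_sum integrable_mult_right i)
  have "(LBINT \<sigma>. steklov_sum f r \<tau> k (s + \<sigma>) x * indicator {0..\<tau>} \<sigma>)
     = (\<Sum>j=1..r. fdiff_coeff r j * (LBINT \<sigma>. ?v j (x + real j * s + real j * \<sigma>) * indicator {0..\<tau>} \<sigma>))"
    unfolding eq using i by (subst Bochner_Integration.integral_sum) auto
  then have "(LBINT \<sigma>. steklov_sum f r \<tau> k (s + \<sigma>) x * indicator {0..\<tau>} \<sigma>) / \<tau>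
     = (\<Sum>j=1..r. fdiff_coeff r j * ((LBINT \<sigma>. ?v j (x + real j * s + real j * \<sigma>) * indicator {0..\<tau>} \<sigma>) / \<tau>))"
    by (simp add: sum_divide_distrib)
  also have "\<dots> = steklov_sum f r \<tau> (Suc k) s x"
    unfolding steklov_sum_def by (intro sum.cong refl) (simp add: steklov_affine)
  finally show "(LBINT \<sigma>. steklov_sum f r \<tau> k (s + \<sigma>) x * indicator {0..\<tau>} \<sigma>) / \<tau> = steklov_sum f r \<tau> (Suc k) s x" .
qed

text \<open>
  For \<open>k = 0\<close> the function is \<open>\<Delta>\<^sub>s\<^sup>r f\<close>, and each averaging step preserves the bound. For \<open>k = r\<close> and \<open>s = 0\<close>
  this compares \<open>f\<close> with a combination of \<open>r\<close>-fold Steklov means.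
\<close>

lemma steklov_sum_error:
  "k \<le> r \<Longrightarrow> 0 \<le> s \<Longrightarrow> s \<le> real (r - k) * \<tau> \<Longrightarrow> Lp_le p L (\<lambda>x. fdiff_coeff r 0 * f x + steklov_sum f r \<tau> k s x) W"
proof (induction k arbitrary: s)
  case 0
  have eq: "fdiff_coeff r 0 * f x + steklov_sum f r \<tau> 0 s x = (fdiff s ^^ r) f x" for x
  proof -
    have "{..r} = insert 0 {1..r}" by auto
    then show ?thesis unfolding fdiff_funpow steklov_sum_def fdiff_coeff_def
      by (simp only:) (subst sum.insert, auto)
  qed
  show ?case
  proof (cases "s = 0")
    case True
    have "(fdiff s ^^ r) f x = 0" for x
    proof -
      obtain r' where "r = Suc r'" using r by (cases r) auto
      then show ?thesis using True by (simp add: fdiff_def)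
    qed
    then show ?thesis unfolding eq using W by (simp add: Lp_le_def)
  next
    case False
    then have "Lp_le p {0..<1 - real r * s} ((fdiff s ^^ r) f) W"
      using 0 tau_bounds by (intro diff) auto
    moreover have "real r * s \<le> 1 / 4"
      using 0 tau_bounds(3) mult_left_mono[of s "real r * \<tau>" "real r"] by simp
    then have "L \<subseteq> {0..<1 - real r * s}" using L(1) by auto
    ultimately show ?thesis unfolding eq by (intro Lp_le_mono[where f = "(fdiff s ^^ r) f" and A = L]) auto
  qed
next
  case (Suc k)
  have [measurable]: "f \<in> borel_measurable borel" using f by auto
  have sm: "(\<lambda>(\<sigma>, x). steklov_sum f r \<tau> k (s + \<sigma>) x) \<in> borel_measurable (borel \<Otimes>\<^sub>M borel)"
  proof -
    have "(\<lambda>z. (steklov (real j * \<tau>) ^^ k) f (snd z + real j * (s + fst z))) \<in> borel_measurable (borel \<Otimes>\<^sub>M borel)"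
      if "j \<in> {1..r}" for j
      by (rule measurable_compose[OF _ steklov_j_measurable[OF that]]) measurable
    then show ?thesis unfolding steklov_sum_def case_prod_beta'
      by (intro borel_measurable_sum borel_measurable_times) auto
  qed
  have "Lp_le p L (\<lambda>x. (LBINT \<sigma>. (fdiff_coeff r 0 * f x + steklov_sum f r \<tau> k (s + \<sigma>) x) * indicator {0..\<tau>} \<sigma>) / (\<tau> - 0)) W"
  proof (rule Lp_le_mean[OF p tau_bounds(1) L(2) W])
    show "(\<lambda>(\<sigma>, x). fdiff_coeff r 0 * f x + steklov_sum f r \<tau> k (s + \<sigma>) x) \<in> borel_measurable (borel \<Otimes>\<^sub>M borel)"
      using sm unfolding case_prod_beta' by measurable
    show "Lp_le p L (\<lambda>x. fdiff_coeff r 0 * f x + steklov_sum f r \<tau> k (s + \<sigma>) x) W" if "0 \<le> \<sigma>" "\<sigma> \<le> \<tau>" for \<sigma>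
    proof (rule Suc.IH)
      have "real (r - k) = real (r - Suc k) + 1" using Suc.prems by linarith
      then have "real (r - k) * \<tau> = real (r - Suc k) * \<tau> + \<tau>" by (simp only: distrib_right mult_1)
      then show "s + \<sigma> \<le> real (r - k) * \<tau>" using Suc.prems(3) that by linarith
    qed (use Suc.prems that in auto)
  qed
  moreover have "(LBINT \<sigma>. (fdiff_coeff r 0 * f x + steklov_sum f r \<tau> k (s + \<sigma>) x) * indicator {0..\<tau>} \<sigma>) / (\<tau> - 0)
     = fdiff_coeff r 0 * f x + steklov_sum f r \<tau> (Suc k) s x" for x
  proof -
    have "(LBINT \<sigma>. (fdiff_coeff r 0 * f x + steklov_sum f r \<tau> k (s + \<sigma>) x) * indicator {0..\<tau>} \<sigma>)
      = (LBINT \<sigma>. fdiff_coeff r 0 * f x * indicator {0..\<tau>} \<sigma>) + (LBINT \<sigma>. steklov_sum f r \<tau> k (s + \<sigma>) x * indicator {0..\<tau>} \<sigma>)"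
      using steklov_sum_integral(1) tau_bounds(1) by (simp add: distrib_right)
    also have "(LBINT \<sigma>. fdiff_coeff r 0 * f x * indicator {0..\<tau>} \<sigma>) = fdiff_coeff r 0 * f x * \<tau>" using tau_bounds(1) by simp
    finally show ?thesis using steklov_sum_integral(2)[of k s x] tau_bounds(1) by (simp add: add_divide_distrib)
  qed
  ultimately show ?case by simp
qed

lemma Lp_le_fdiff_step:
  assumes "j \<in> {1..r}"
  shows "Lp_le p UNIV (\<lambda>y. \<bar>(fdiff (real j * \<tau>) ^^ r) f y\<bar> * indicator L y) W"
proof -
  let ?h = "real j * \<tau>"
  have h: "0 < ?h" "?h \<le> real r * \<tau>" using assms tau_bounds by (auto intro!: mult_right_mono)
  then have "real r * ?h \<le> real r * (real r * \<tau>)" by (intro mult_left_mono) auto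
  then have "real r * ?h \<le> 1 / 4" using tau_bounds by simp
  then have "L \<subseteq> {0..<1 - real r * ?h}" using L(1) by auto
  moreover have "Lp_le p {0..<1 - real r * ?h} ((fdiff ?h ^^ r) f) W"
    using h order_trans[OF h(2) tau_bounds(2)] by (intro diff)
  ultimately have "Lp_le p L ((fdiff ?h ^^ r) f) W"
    by (elim Lp_le_mono[rotated]) auto
  moreover have "(\<bar>v * indicator L y\<bar> powr P) * indicator UNIV y = (\<bar>v\<bar> powr P) * indicator L y" for v P y :: real
    by (simp add: indicator_def)
  then have "ennreal (\<bar>\<bar>v\<bar> * indicator L y\<bar> powr P) * indicator UNIV y = ennreal (\<bar>v\<bar> powr P) * indicator L y" for v P y :: real
    by (simp add: indicator_def)
  ultimately show ?thesis using W unfolding Lp_le_def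
    by (simp only: split: if_splits) (auto simp: indicator_def elim!: eventually_mono)
qed

end


definition jackson_const :: "nat \<Rightarrow> real" where
  "jackson_const r = 2 * (1 + 4 ^ r * (2 ^ r * (2 * (4 * (real r)\<^sup>2) ^ r)))"

definition lip_const :: "nat \<Rightarrow> real" where
  "lip_const r = real r * (2 ^ r * (2 * (4 * (real r)\<^sup>2) + 1) ^ (r - 1) * (4 * (real r)\<^sup>2)\<^sup>2)"

lemma jackson_lip_const_nonneg: "0 \<le> jackson_const r" "0 \<le> lip_const r"
  unfolding jackson_const_def lip_const_def
  by (intro mult_nonneg_nonneg add_nonneg_nonneg zero_le_power; simp)+

lemma abs_fdiff_coeff_le: "\<bar>fdiff_coeff r j\<bar> \<le> 2 ^ r"
proof -
  have "real (r choose j) \<le> real (2 ^ r)" by (intro of_nat_mono binomial_le_pow2)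
  then show ?thesis
    by (simp only: fdiff_coeff_def abs_mult power_abs abs_minus_cancel abs_one power_one mult_1 abs_of_nat
        of_nat_power of_nat_numeral)
qed

text \<open>
  The pieces are the combinations of the local polynomials of the \<open>r\<close> Steklov means that approximate \<open>f\<close>. The
  local error is an integral of \<open>\<bar>\<Delta>\<^sub>h\<^sup>r f\<bar>\<close> over a cell; it is enlarged to an integral over a window centred at \<open>x\<close>,
  so that it becomes an average of translates and \<open>Lp_le_mean\<close> applies for all \<open>p\<close> at once.
\<close>

lemma piecewise_poly_left:
  fixes f :: "real \<Rightarrow> real" and n K r :: nat
  assumes p: "1 \<le> p" and f: "integrable lborel f" and r: "1 \<le> r" and n: "1 \<le> n"
    and K: "real K / real n \<le> 3 / 4" and W: "0 \<le> W"
    and diff: "\<And>h. 0 < h \<Longrightarrow> h \<le> 1 / real n \<Longrightarrow> Lp_le p {0..<1 - real r * h} ((fdiff h ^^ r) f) W"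
    and V: "(LBINT x. \<bar>f x\<bar>) \<le> V"
  shows "\<exists>P. (\<forall>k. degree (P k) < r) \<and>
    (\<forall>k. \<forall>x\<in>{real k / real n..real (Suc k) / real n}. \<forall>y\<in>{real k / real n..real (Suc k) / real n}.
        \<bar>poly (P k) x - poly (P k) y\<bar> \<le> lip_const r * (real n)\<^sup>2 * V * \<bar>x - y\<bar>) \<and>
    Lp_le p {0..<real K / real n} (\<lambda>x. f x - poly (P (nat \<lfloor>real n * x\<rfloor>)) x) (jackson_const r * W)"
proof -
  define c where "c = 4 * (real r)\<^sup>2"
  define N where "N = real n"
  define \<delta> where "\<delta> = 1 / N"
  define \<tau> where "\<tau> = 1 / (4 * (real r)\<^sup>2 * N)"
  define L where "L = {0..<real K / real n}"
  have r0: "1 \<le> real r" using r by simp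
  have c1: "1 \<le> c" using one_le_power[OF r0, of 2] by (simp add: c_def)
  have N1: "1 \<le> N" using n by (simp add: N_def)
  have d0: "0 < \<delta>" using N1 by (simp add: \<delta>_def)
  have [measurable]: "f \<in> borel_measurable borel" using f by auto
  have L1: "L \<subseteq> {0..<3/4}" and L2[measurable]: "L \<in> sets borel" using K by (auto simp: L_def)
  note ctx = p f r N1 \<tau>_def W diff[folded N_def] L1 L2
  note tau = tau_bounds[OF ctx]
  have c\<tau>: "c * \<tau> = \<delta>" using r0 N1 by (simp add: c_def \<tau>_def \<delta>_def)
  let ?h = "\<lambda>j. real j * \<tau>"
  have h: "0 < ?h j" "\<tau> \<le> ?h j" "\<delta> \<le> c * ?h j" if "j \<in> {1..r}" for j
  proof -
    show "0 < ?h j" using that tau(1) by simp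
    show *: "\<tau> \<le> ?h j" using that tau(1) mult_right_mono[of 1 "real j" \<tau>] by simp
    show "\<delta> \<le> c * ?h j" unfolding c\<tau>[symmetric] using * c1 by (intro mult_left_mono) auto
  qed
  define Good where "Good j k P \<longleftrightarrow> degree P < r \<and> (\<forall>x\<in>{real k / N..real k / N + \<delta>}.
      \<bar>(steklov (?h j) ^^ r) f x - poly P x\<bar>
        \<le> \<delta> ^ (r - 1) / ?h j ^ r * (LBINT y. \<bar>(fdiff (?h j) ^^ r) f y\<bar> * indicator {real k / N..real k / N + \<delta>} y)) \<and>
     (\<forall>x\<in>{real k / N..real k / N + \<delta>}. \<forall>y\<in>{real k / N..real k / N + \<delta>}. \<bar>poly P x - poly P y\<bar>
        \<le> (2 * c + 1) ^ (r - 1) / (?h j)\<^sup>2 * (LBINT y. \<bar>f y\<bar>) * \<bar>x - y\<bar>)" for j and k :: nat and P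
  have "\<exists>P. Good j k P" if "j \<in> {1..r}" for j k
    using steklov_local_polynomial[OF f h(1)[OF that] d0 h(3)[OF that] c1, of "r - 1" "real k / N"] r
    unfolding Good_def by auto
  then obtain Q where Q: "\<And>j k. j \<in> {1..r} \<Longrightarrow> Good j k (Q j k)" by metis
  \<comment> \<open>the sign \<open>fdiff_coeff r 0\<close> is its own inverse\<close>
  define P where "P k = (\<Sum>j=1..r. smult (- fdiff_coeff r 0 * fdiff_coeff r j) (Q j k))" for k
  have Psum: "poly (P k) x = - fdiff_coeff r 0 * (\<Sum>j=1..r. fdiff_coeff r j * poly (Q j k) x)" for k x
    by (simp add: P_def poly_sum sum_distrib_left sum_negf mult.assoc)
  have "fdiff_coeff r 0 = 1 \<or> fdiff_coeff r 0 = -1" by (cases "even r") (simp_all add: fdiff_coeff_def)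
  then have cf0: "fdiff_coeff r 0 * fdiff_coeff r 0 = 1" "\<bar>fdiff_coeff r 0\<bar> = 1" by auto
  have deg: "degree (P k) < r" for k
    unfolding P_def using r Q by (intro degree_sum_less) (auto simp: Good_def intro: le_less_trans[OF degree_smult_le])
  have lip: "\<bar>poly (P k) x - poly (P k) y\<bar> \<le> lip_const r * N\<^sup>2 * V * \<bar>x - y\<bar>"
    if xy: "x \<in> {real k / N..real k / N + \<delta>}" "y \<in> {real k / N..real k / N + \<delta>}" for k x y
  proof -
    have V0: "0 \<le> V" using V order_trans[of 0 "LBINT x. \<bar>f x\<bar>" V] by simp
    have "poly (P k) x - poly (P k) y = - fdiff_coeff r 0 * (\<Sum>j=1..r. fdiff_coeff r j * (poly (Q j k) x - poly (Q j k) y))"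
      unfolding Psum by (simp add: right_diff_distrib sum_subtractf)
    then have "\<bar>poly (P k) x - poly (P k) y\<bar> = \<bar>\<Sum>j=1..r. fdiff_coeff r j * (poly (Q j k) x - poly (Q j k) y)\<bar>"
      using cf0 by (simp add: abs_mult)
    also have "\<dots> \<le> (\<Sum>j=1..r. \<bar>fdiff_coeff r j * (poly (Q j k) x - poly (Q j k) y)\<bar>)" by (rule sum_abs)
    also have "\<dots> \<le> (\<Sum>j=1..r. 2 ^ r * ((2 * c + 1) ^ (r - 1) / \<tau>\<^sup>2 * V * \<bar>x - y\<bar>))"
    proof (intro sum_mono)
      fix j assume j: "j \<in> {1..r}"
      have "\<bar>poly (Q j k) x - poly (Q j k) y\<bar> \<le> (2 * c + 1) ^ (r - 1) / (?h j)\<^sup>2 * (LBINT y. \<bar>f y\<bar>) * \<bar>x - y\<bar>"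
        using Q[OF j, of k] xy by (auto simp: Good_def)
      also have "\<dots> \<le> (2 * c + 1) ^ (r - 1) / \<tau>\<^sup>2 * V * \<bar>x - y\<bar>"
        using V c1 tau(1) h[OF j] by (intro mult_right_mono mult_mono divide_left_mono power_mono) auto
      finally show "\<bar>fdiff_coeff r j * (poly (Q j k) x - poly (Q j k) y)\<bar> \<le> 2 ^ r * ((2 * c + 1) ^ (r - 1) / \<tau>\<^sup>2 * V * \<bar>x - y\<bar>)"
        unfolding abs_mult by (intro mult_mono abs_fdiff_coeff_le) auto
    qed
    also have "\<dots> = lip_const r * N\<^sup>2 * V * \<bar>x - y\<bar>"
    proof -
      have "1 / \<tau> = c * N" using r0 N1 by (simp add: \<tau>_def c_def)
      then have "1 / \<tau>\<^sup>2 = c\<^sup>2 * N\<^sup>2" by (metis power_mult_distrib power_one_over)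
      then have "(2 * c + 1) ^ (r - 1) / \<tau>\<^sup>2 = (2 * c + 1) ^ (r - 1) * (c\<^sup>2 * N\<^sup>2)" by (metis times_divide_eq_right mult.right_neutral)
      then show ?thesis by (simp only: sum_constant card_atLeastAtMost lip_const_def c_def[symmetric]) simp
    qed
    finally show ?thesis .
  qed
  define v where "v j y = \<bar>(fdiff (?h j) ^^ r) f y\<bar> * indicator L y" for j y
  define \<mu> where "\<mu> j x = (LBINT \<sigma>. v j (x + \<sigma>) * indicator {-\<delta>..\<delta>} \<sigma>) / (\<delta> - (-\<delta>))" for j x
  have vm[measurable]: "v j \<in> borel_measurable borel" for j unfolding v_def by measurable
  have vi: "integrable lborel (v j)" for j
  proof -
    have "integrable lborel ((fdiff (?h j) ^^ i) f)" for i
      by (induction i) (auto intro: f fdiff_integrable)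
    from integrable_real_mult_indicator[OF _ integrable_abs[OF this[of r]], of L] show ?thesis
      unfolding v_def by simp
  qed
  have \<mu>m[measurable]: "\<mu> j \<in> borel_measurable borel" for j unfolding \<mu>_def by measurable
  have \<mu>le: "Lp_le p L (\<mu> j) W" if j: "j \<in> {1..r}" for j
    unfolding \<mu>_def
  proof (rule Lp_le_mean[OF p _ L2 W])
    show "Lp_le p L (\<lambda>x. v j (x + \<sigma>)) W" for \<sigma>
    proof -
      have "Lp_le p UNIV (v j) W" unfolding v_def by (rule Lp_le_fdiff_step[OF ctx j])
      from Lp_le_affine[OF vm _ _ this, of 1 \<sigma>] have "Lp_le p UNIV (\<lambda>x. v j (\<sigma> + x)) W" by simp
      then show ?thesis by (rule Lp_le_mono[rotated]) (auto simp: add.commute)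
    qed
  qed (use d0 in auto)
  define C where "C = 2 ^ r * (2 * c ^ r)"
  have C0: "0 \<le> C" using c1 by (simp add: C_def)
  have err: "\<bar>fdiff_coeff r j * ((steklov (?h j) ^^ r) f x - poly (Q j (nat \<lfloor>N * x\<rfloor>)) x)\<bar> \<le> C * \<mu> j x"
    if x: "x \<in> L" and j: "j \<in> {1..r}" for x j
  proof -
    define k where "k = nat \<lfloor>N * x\<rfloor>"
    define a where "a = real k / N"
    have x0: "0 \<le> x" "x < real K / N" using x by (auto simp: L_def N_def)
    have fl: "real k = of_int \<lfloor>N * x\<rfloor>" using x0 N1 by (simp add: k_def)
    then have k: "real k \<le> N * x" "N * x < real k + 1" by linarith+
    have "N * x < real K" using x0 N1 by (simp add: field_simps)
    then have "real k < real K" using k by linarith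
    then have "real (Suc k) \<le> real K" by (simp only: of_nat_less_iff of_nat_le_iff Suc_le_eq)
    then have kK: "real k + 1 \<le> real K" by simp
    have xa: "a \<le> x" "x < a + \<delta>" using k N1 by (auto simp: a_def \<delta>_def field_simps)
    have aL: "{a..<a+\<delta>} \<subseteq> L"
    proof -
      have "a + \<delta> = (real k + 1) / N" by (simp add: a_def \<delta>_def add_divide_distrib)
      also have "\<dots> \<le> real K / N" using kK N1 by (intro divide_right_mono) auto
      finally show ?thesis using N1 by (auto simp: L_def N_def[symmetric] a_def intro: order_trans)
    qed
    have "(LBINT y. \<bar>(fdiff (?h j) ^^ r) f y\<bar> * indicator {a..a+\<delta>} y)
      \<le> (LBINT y. v j y * indicator {x-\<delta>..x+\<delta>} y)"
    proof (rule integral_mono_AE)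
      show "integrable lborel (\<lambda>y. v j y * indicator {x-\<delta>..x+\<delta>} y)"
        by (intro integrable_indicator_mult vi)
      have "integrable lborel ((fdiff (?h j) ^^ i) f)" for i
        by (induction i) (auto intro: f fdiff_integrable)
      then show "integrable lborel (\<lambda>y. \<bar>(fdiff (?h j) ^^ r) f y\<bar> * indicator {a..a+\<delta>} y)"
        by (intro integrable_indicator_mult integrable_abs)
      show "AE y in lborel. \<bar>(fdiff (?h j) ^^ r) f y\<bar> * indicator {a..a+\<delta>} y \<le> v j y * indicator {x-\<delta>..x+\<delta>} y"
        using AE_lborel_singleton[of "a + \<delta>"]
      proof eventually_elim
        case (elim y)
        show ?case
        proof (cases "y \<in> {a..<a+\<delta>}")
          case True
          then have "y \<in> L" "y \<in> {x-\<delta>..x+\<delta>}" using aL xa by auto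
          then show ?thesis by (simp add: v_def indicator_def)
        next
          case False
          then have "y \<notin> {a..a+\<delta>}" using elim by auto
          then show ?thesis by (simp add: v_def)
        qed
      qed
    qed
    also have "\<dots> = (LBINT \<sigma>. v j (x + \<sigma>) * indicator {-\<delta>..\<delta>} \<sigma>)"
    proof -
      have "(LBINT y. v j y * indicator {x-\<delta>..x+\<delta>} y)
        = (LBINT \<sigma>. v j (x + \<sigma>) * indicator {x-\<delta>..x+\<delta>} (x + \<sigma>))"
        using lborel_integral_real_affine[of 1 "\<lambda>y. v j y * indicator {x-\<delta>..x+\<delta>} y" x] by simp
      also have "\<dots> = (LBINT \<sigma>. v j (x + \<sigma>) * indicator {-\<delta>..\<delta>} \<sigma>)"
        by (intro Bochner_Integration.integral_cong) (auto simp: indicator_def)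
      finally show ?thesis .
    qed
    also have "\<dots> = 2 * \<delta> * \<mu> j x" using d0 by (simp add: \<mu>_def)
    finally have I: "(LBINT y. \<bar>(fdiff (?h j) ^^ r) f y\<bar> * indicator {a..a+\<delta>} y) \<le> 2 * \<delta> * \<mu> j x" .
    have \<mu>0: "0 \<le> \<mu> j x" unfolding \<mu>_def using d0
      by (intro divide_nonneg_nonneg Bochner_Integration.integral_nonneg) (auto simp: v_def)
    have "\<bar>(steklov (?h j) ^^ r) f x - poly (Q j k) x\<bar>
        \<le> \<delta> ^ (r - 1) / ?h j ^ r * (LBINT y. \<bar>(fdiff (?h j) ^^ r) f y\<bar> * indicator {a..a+\<delta>} y)"
      using Q[OF j, of k] xa by (auto simp: Good_def a_def)
    also have "\<dots> \<le> \<delta> ^ (r - 1) / ?h j ^ r * (2 * \<delta> * \<mu> j x)"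
      using d0 h(1)[OF j] by (intro mult_left_mono I) auto
    also have "\<dots> = 2 * (\<delta> / ?h j) ^ r * \<mu> j x"
    proof -
      have "\<delta> ^ r = \<delta> ^ (r - 1) * \<delta>" using r by (cases r) auto
      then show ?thesis by (simp add: power_divide)
    qed
    also have "\<dots> \<le> 2 * c ^ r * \<mu> j x"
    proof -
      have "\<delta> / ?h j \<le> c" using h[OF j] by (simp add: field_simps)
      then show ?thesis using \<mu>0 d0 h(1)[OF j] by (intro mult_right_mono mult_left_mono power_mono) auto
    qed
    finally have "\<bar>(steklov (?h j) ^^ r) f x - poly (Q j k) x\<bar> \<le> 2 * c ^ r * \<mu> j x" .
    then have "\<bar>fdiff_coeff r j\<bar> * \<bar>(steklov (?h j) ^^ r) f x - poly (Q j k) x\<bar> \<le> 2 ^ r * (2 * c ^ r * \<mu> j x)"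
      by (intro mult_mono abs_fdiff_coeff_le) auto
    then show ?thesis by (simp add: abs_mult C_def k_def mult.assoc)
  qed
  have A: "Lp_le p L (\<lambda>x. fdiff_coeff r 0 * f x + steklov_sum f r \<tau> r 0 x) W"
    by (rule steklov_sum_error[OF ctx]) (use tau in auto)
  have Am: "(\<lambda>x. fdiff_coeff r 0 * f x + steklov_sum f r \<tau> r 0 x) \<in> borel_measurable borel"
  proof -
    have "(\<lambda>x. (steklov (real j * \<tau>) ^^ r) f (x + real j * 0)) \<in> borel_measurable borel" if "j \<in> {1..r}" for j
      using steklov_j_measurable[OF ctx that, of r] by simp
    then show ?thesis unfolding steklov_sum_def by (intro borel_measurable_add borel_measurable_sum borel_measurable_times) auto
  qed
  have B: "Lp_le p L (\<lambda>x. \<Sum>j<r. C * \<mu> (Suc j) x) (4 ^ r * (C * W))"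
    using C0 W by (intro Lp_le_sum p L2 Lp_le_scale \<mu>le) auto
  have "Lp_le p L (\<lambda>x. f x - poly (P (nat \<lfloor>N * x\<rfloor>)) x) (2 * (W + 4 ^ r * (C * W)))"
  proof (rule Lp_le_combine[OF p W _ Am L2 A _ L2 B])
    fix x assume x: "x \<in> L"
    let ?k = "nat \<lfloor>N * x\<rfloor>"
    let ?S = "\<lambda>j. (steklov (?h j) ^^ r) f x"
    have "fdiff_coeff r 0 * (f x - poly (P ?k) x) = fdiff_coeff r 0 * f x + (\<Sum>j=1..r. fdiff_coeff r j * poly (Q j ?k) x)"
    proof -
      have "fdiff_coeff r 0 * (fdiff_coeff r 0 * z) = z" for z using cf0(1) by (simp add: mult.assoc[symmetric])
      then show ?thesis unfolding Psum by (simp add: distrib_left)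
    qed
    also have "\<dots> = (fdiff_coeff r 0 * f x + steklov_sum f r \<tau> r 0 x) - (\<Sum>j=1..r. fdiff_coeff r j * (?S j - poly (Q j ?k) x))"
      by (simp add: steklov_sum_def right_diff_distrib sum_subtractf)
    finally have "\<bar>fdiff_coeff r 0 * (f x - poly (P ?k) x)\<bar>
      \<le> \<bar>fdiff_coeff r 0 * f x + steklov_sum f r \<tau> r 0 x\<bar> + \<bar>\<Sum>j=1..r. fdiff_coeff r j * (?S j - poly (Q j ?k) x)\<bar>" by simp
    also have "\<bar>\<Sum>j=1..r. fdiff_coeff r j * (?S j - poly (Q j ?k) x)\<bar> \<le> (\<Sum>j=1..r. \<bar>fdiff_coeff r j * (?S j - poly (Q j ?k) x)\<bar>)"
      by (rule sum_abs)
    also have "\<dots> \<le> (\<Sum>j=1..r. C * \<mu> j x)" by (intro sum_mono err x)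
    also have "\<dots> = (\<Sum>j<r. C * \<mu> (Suc j) x)"
      by (rule sum.reindex_bij_witness[of _ Suc "\<lambda>j. j - 1"]) auto
    also have "\<dots> \<le> \<bar>\<Sum>j<r. C * \<mu> (Suc j) x\<bar>" by simp
    finally show "\<bar>f x - poly (P ?k) x\<bar> \<le> \<bar>fdiff_coeff r 0 * f x + steklov_sum f r \<tau> r 0 x\<bar> * indicator L x
        + \<bar>\<Sum>j<r. C * \<mu> (Suc j) x\<bar> * indicator L x"
      using x cf0(2) by (simp add: abs_mult)
  qed (use C0 W in auto)
  moreover have "2 * (W + 4 ^ r * (C * W)) = jackson_const r * W"
    by (simp add: jackson_const_def C_def c_def algebra_simps)
  moreover have "real k / real n + \<delta> = real (Suc k) / real n" for k
    by (simp add: \<delta>_def N_def add_divide_distrib)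
  ultimately show ?thesis using deg lip unfolding L_def N_def by (intro exI[of _ P]) auto
qed

lemma fdiff_Suc: "(fdiff h ^^ Suc r) u x = (fdiff h ^^ r) u (x + h) - (fdiff h ^^ r) u x"
  by (simp add: fdiff_def[of h "(fdiff h ^^ r) u"])

lemma fdiff_reflect:
  "(fdiff h ^^ r) (\<lambda>x. f (a - x)) x = (-1) ^ r * (fdiff h ^^ r) f (a - x - real r * h)"
proof (induction r arbitrary: x)
  case (Suc r)
  have "(fdiff h ^^ Suc r) (\<lambda>x. f (a - x)) x
      = (-1) ^ r * (fdiff h ^^ r) f (a - (x + h) - real r * h) - (-1) ^ r * (fdiff h ^^ r) f (a - x - real r * h)"
    by (simp only: fdiff_Suc Suc.IH)
  also have "a - (x + h) - real r * h = a - x - real (Suc r) * h" by (simp add: algebra_simps)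
  also have "a - x - real r * h = a - x - real (Suc r) * h + h" by (simp add: algebra_simps)
  finally show ?case unfolding fdiff_Suc by (simp add: right_diff_distrib)
qed simp

text \<open>
  The first half of the cells (and the middle one) is covered by \<open>piecewise_poly_left\<close>, the others by the same
  lemma applied to the reflection of \<open>f\<close>. For \<open>n \<ge> 2\<close> the cells up to the
  middle one end at \<open>3/4\<close> or earlier. The polynomials of both halves are
  unrelated, as no continuity across cells is demanded.
\<close>

lemma piecewise_poly_approx:
  fixes f :: "real \<Rightarrow> real" and n r :: nat
  assumes p: "1 \<le> p" and f: "integrable lborel f" and r: "1 \<le> r" and n: "2 \<le> n" and W: "0 \<le> W"
    and diff: "\<And>h. 0 < h \<Longrightarrow> h \<le> 1 / real n \<Longrightarrow> Lp_le p {0..<1 - real r * h} ((fdiff h ^^ r) f) W"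
    and V: "(LBINT x. \<bar>f x\<bar>) \<le> V"
  shows "\<exists>P. (\<forall>k. degree (P k) < r) \<and>
    (\<forall>k<n. \<forall>x\<in>{real k / real n..real (Suc k) / real n}. \<forall>y\<in>{real k / real n..real (Suc k) / real n}.
        \<bar>poly (P k) x - poly (P k) y\<bar> \<le> lip_const r * (real n)\<^sup>2 * V * \<bar>x - y\<bar>) \<and>
    Lp_le p {0..<1} (\<lambda>x. f x - poly (P (nat \<lfloor>real n * x\<rfloor>)) x) (4 * jackson_const r * W)"
proof -
  define K where "K = (n + 1) div 2"
  define N where "N = real n"
  define g where "g x = f (1 - x)" for x
  have n1: "1 \<le> n" and N0: "0 < N" using n by (auto simp: N_def)
  have fm[measurable]: "f \<in> borel_measurable borel" using f by auto
  have K: "real K / real n \<le> 3 / 4"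
  proof -
    have "4 * K \<le> 3 * n" using n by (simp add: K_def)
    then have "4 * real K \<le> 3 * real n" by (metis of_nat_le_iff of_nat_mult of_nat_numeral)
    then show ?thesis using n by (simp add: field_simps)
  qed
  have K2: "n \<le> 2 * K" by (simp add: K_def)
  have gi: "integrable lborel g"
    using lborel_integrable_real_affine[OF f, of "-1" 1] by (simp add: g_def[abs_def])
  have gV: "(LBINT x. \<bar>g x\<bar>) \<le> V"
    using lborel_integral_real_affine[of "-1" "\<lambda>x. \<bar>f x\<bar>" 1] V by (simp add: g_def)
  have gdiff: "Lp_le p {0..<1 - real r * h} ((fdiff h ^^ r) g) W" if h: "0 < h" "h \<le> 1 / real n" for h
  proof -
    have m: "(fdiff h ^^ r) f \<in> borel_measurable borel" by measurable
    have "Lp_le p {x. (1 - real r * h) + (-1) * x \<in> {0..<1 - real r * h}} (\<lambda>x. (fdiff h ^^ r) f ((1 - real r * h) + (-1) * x)) W"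
      by (rule Lp_le_affine[OF m _ _ diff[OF h]]) auto
    moreover have "AE x in lborel. x \<noteq> (0::real)" by (rule AE_lborel_singleton)
    then have "AE x in lborel. x \<in> {0..<1 - real r * h} \<longrightarrow>
       x \<in> {x. (1 - real r * h) + (-1) * x \<in> {0..<1 - real r * h}} \<and>
       \<bar>(fdiff h ^^ r) g x\<bar> \<le> \<bar>(fdiff h ^^ r) f ((1 - real r * h) + (-1) * x)\<bar>"
    proof eventually_elim
      case (elim x)
      have "\<bar>(fdiff h ^^ r) g x\<bar> = \<bar>(fdiff h ^^ r) f (1 - x - real r * h)\<bar>"
        unfolding g_def[abs_def] fdiff_reflect by (simp add: abs_mult)
      also have "1 - x - real r * h = (1 - real r * h) + (-1) * x" by simp
      finally show ?case using elim by auto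
    qed
    ultimately show ?thesis by (rule Lp_le_mono_AE[rotated])
  qed
  let ?cell = "\<lambda>k. {real k / real n..real (Suc k) / real n}"
  obtain P1 where P1: "\<And>k. degree (P1 k) < r"
    "\<And>k x y. x \<in> ?cell k \<Longrightarrow> y \<in> ?cell k \<Longrightarrow> \<bar>poly (P1 k) x - poly (P1 k) y\<bar> \<le> lip_const r * (real n)\<^sup>2 * V * \<bar>x - y\<bar>"
    "Lp_le p {0..<real K / real n} (\<lambda>x. f x - poly (P1 (nat \<lfloor>real n * x\<rfloor>)) x) (jackson_const r * W)"
    using piecewise_poly_left[OF p f r n1 K W diff V] by blast
  obtain P2 where P2: "\<And>k. degree (P2 k) < r"
    "\<And>k x y. x \<in> ?cell k \<Longrightarrow> y \<in> ?cell k \<Longrightarrow> \<bar>poly (P2 k) x - poly (P2 k) y\<bar> \<le> lip_const r * (real n)\<^sup>2 * V * \<bar>x - y\<bar>"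
    "Lp_le p {0..<real K / real n} (\<lambda>x. g x - poly (P2 (nat \<lfloor>real n * x\<rfloor>)) x) (jackson_const r * W)"
    using piecewise_poly_left[OF p gi r n1 K W gdiff gV] by blast
  define P where "P k = (if k < K then P1 k else pcompose (P2 (n - 1 - k)) [:1, -1:])" for k
  have deg: "degree (P k) < r" for k
    using P1(1) P2(1)[of "n - 1 - k"] by (simp add: P_def degree_pcompose)
  have lip: "\<bar>poly (P k) x - poly (P k) y\<bar> \<le> lip_const r * (real n)\<^sup>2 * V * \<bar>x - y\<bar>"
    if k: "k < n" and xy: "x \<in> ?cell k" "y \<in> ?cell k" for k x y
  proof (cases "k < K")
    case True
    then show ?thesis using P1(2)[OF xy] by (simp add: P_def)
  next
    case False
    have "real (n - 1 - k) = real n - 1 - real k" using k by linarith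
    then have c: "real (n - 1 - k) / real n = 1 - real (Suc k) / real n" "real (Suc (n - 1 - k)) / real n = 1 - real k / real n"
      using n by (auto simp: field_simps)
    have "1 - x \<in> ?cell (n - 1 - k)" "1 - y \<in> ?cell (n - 1 - k)" unfolding c using xy by auto
    from P2(2)[OF this] show ?thesis using False by (simp add: P_def poly_pcompose abs_minus_commute)
  qed
  have sm: "(\<lambda>x. poly (R (nat \<lfloor>real n * x\<rfloor>)) x) \<in> borel_measurable borel" for R :: "nat \<Rightarrow> real poly"
  proof (rule measurable_compose_countable[of "\<lambda>i x. poly (R i) x"])
    show "(\<lambda>x. poly (R i) x) \<in> borel_measurable borel" for i
      by (intro borel_measurable_continuous_onI continuous_intros)
  qed measurable
  have left: "Lp_le p {0..<real K / real n} (\<lambda>x. f x - poly (P (nat \<lfloor>real n * x\<rfloor>)) x) (jackson_const r * W)"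
  proof (rule Lp_le_mono[OF _ P1(3)])
    fix x assume x: "x \<in> {0..<real K / real n}"
    then have "real n * x < real K" using n by (simp add: field_simps)
    then have "nat \<lfloor>real n * x\<rfloor> < K" using x by (simp add: nat_less_iff floor_less_iff)
    then show "x \<in> {0..<real K / real n} \<and> \<bar>f x - poly (P (nat \<lfloor>real n * x\<rfloor>)) x\<bar> \<le> \<bar>f x - poly (P1 (nat \<lfloor>real n * x\<rfloor>)) x\<bar>"
      using x by (simp add: P_def)
  qed
  have right: "Lp_le p {real K / real n..<1} (\<lambda>x. f x - poly (P (nat \<lfloor>real n * x\<rfloor>)) x) (jackson_const r * W)"
  proof -
    have gm[measurable]: "g \<in> borel_measurable borel" using gi by auto
    have "Lp_le p {x. 1 + (-1) * x \<in> {0..<real K / real n}}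
       (\<lambda>x. g (1 + (-1) * x) - poly (P2 (nat \<lfloor>real n * (1 + (-1) * x)\<rfloor>)) (1 + (-1) * x)) (jackson_const r * W)"
      by (rule Lp_le_affine[OF _ _ _ P2(3)]) (use sm in \<open>auto intro!: borel_measurable_diff\<close>)
    \<comment> \<open>away from the grid points, reflection maps half-open cells to half-open cells\<close>
    moreover have "countable {x. real n * x \<in> \<int>}"
    proof -
      have "{x. real n * x \<in> \<int>} \<subseteq> (\<lambda>i. of_int i / real n) ` (UNIV :: int set)"
      proof
        fix x assume "x \<in> {x. real n * x \<in> \<int>}"
        then obtain i where "real n * x = of_int i" by (auto elim: Ints_cases)
        then have "x = of_int i / real n" using n by (simp add: field_simps)
        then show "x \<in> (\<lambda>i. of_int i / real n) ` UNIV" by blast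
      qed
      then show ?thesis by (rule countable_subset) simp
    qed
    then have "AE x in lborel. x \<notin> {x. real n * x \<in> \<int>}"
      by (intro AE_not_in countable_imp_null_set_lborel)
    then have "AE x in lborel. x \<in> {real K / real n..<1} \<longrightarrow> x \<in> {x. 1 + (-1) * x \<in> {0..<real K / real n}} \<and>
       \<bar>f x - poly (P (nat \<lfloor>real n * x\<rfloor>)) x\<bar>
        \<le> \<bar>g (1 + (-1) * x) - poly (P2 (nat \<lfloor>real n * (1 + (-1) * x)\<rfloor>)) (1 + (-1) * x)\<bar>"
    proof eventually_elim
      case (elim x)
      show ?case
      proof (intro impI)
        assume x: "x \<in> {real K / real n..<1}"
        define z where "z = real n * x"
        have zZ: "z \<notin> \<int>" using elim by (simp add: z_def)
        have z: "real K \<le> z" "z < real n" using x n by (auto simp: z_def field_simps)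
        define k where "k = nat \<lfloor>z\<rfloor>"
        have kz: "of_int \<lfloor>z\<rfloor> = real k" using z by (simp add: k_def)
        have "real k \<noteq> z" using zZ by auto
        then have k: "real k < z" "z < real k + 1" using kz by linarith+
        have kK: "K \<le> k" using z(1) k(2) by linarith
        have kn: "k < n" using z(2) k(1) by linarith
        have "real n * (1 + (-1) * x) = real n - z" by (simp add: z_def algebra_simps)
        moreover have "\<lfloor>real n - z\<rfloor> = int (n - 1 - k)"
          using k kn by (intro floor_unique) (auto simp: of_nat_diff)
        ultimately have fl: "nat \<lfloor>real n * (1 + (-1) * x)\<rfloor> = n - 1 - k" by simp
        have "z \<noteq> real K" using zZ by auto
        then have "real K < z" using z by simp
        then have "real n - z < real K" using K2 by linarith
        then have "1 - x < real K / real n" using n by (simp add: z_def field_simps)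
        then have mem: "x \<in> {x. 1 + (-1) * x \<in> {0..<real K / real n}}" using x by auto
        have "poly (P (nat \<lfloor>real n * x\<rfloor>)) x = poly (P2 (n - 1 - k)) (1 + (-1) * x)"
          using kK by (simp add: P_def k_def[symmetric] z_def[symmetric] poly_pcompose)
        then show "x \<in> {x. 1 + (-1) * x \<in> {0..<real K / real n}} \<and>
         \<bar>f x - poly (P (nat \<lfloor>real n * x\<rfloor>)) x\<bar>
          \<le> \<bar>g (1 + (-1) * x) - poly (P2 (nat \<lfloor>real n * (1 + (-1) * x)\<rfloor>)) (1 + (-1) * x)\<bar>"
          using mem unfolding fl by (simp add: g_def)
      qed
    qed
    ultimately show ?thesis by (rule Lp_le_mono_AE[rotated])
  qed
  have "Lp_le p ({0..<real K / real n} \<union> {real K / real n..<1}) (\<lambda>x. f x - poly (P (nat \<lfloor>real n * x\<rfloor>)) x)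
     (2 * (jackson_const r * W + jackson_const r * W))"
    using W jackson_lip_const_nonneg[of r] sm by (intro Lp_le_Un p left right) auto
  moreover have "real K / real n \<le> 1" using K by linarith
  then have "{0..<real K / real n} \<union> {real K / real n..<1} = {0..<1}" by (intro ivl_disj_un) auto
  ultimately have "Lp_le p {0..<1} (\<lambda>x. f x - poly (P (nat \<lfloor>real n * x\<rfloor>)) x) (4 * jackson_const r * W)"
    by (simp add: algebra_simps)
  with deg lip show ?thesis by blast
qed

text \<open>
  A point and the grid point to its left differ by at most \<open>1 / (n q)\<close> and lie in the same cell of length \<open>1 / n\<close>,
  so the Lipschitz bound of the pieces controls the sampling error.
\<close>

lemma sampled_poly_approx:
  fixes f :: "real \<Rightarrow> real" and n q r :: nat
  assumes p: "1 \<le> p" and f: "integrable lborel f" and r: "1 \<le> r" and n: "2 \<le> n" and q: "1 \<le> q" and W: "0 \<le> W"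
    and diff: "\<And>h. 0 < h \<Longrightarrow> h \<le> 1 / real n \<Longrightarrow> Lp_le p {0..<1 - real r * h} ((fdiff h ^^ r) f) W"
    and V: "(LBINT x. \<bar>f x\<bar>) \<le> V"
  shows "\<exists>P. (\<forall>k. degree (P k) < r) \<and>
    Lp_le p {0..<1} (\<lambda>x. f x - poly (P (nat \<lfloor>real n * x\<rfloor>)) (of_int \<lfloor>real (n * q) * x\<rfloor> / real (n * q)))
      (2 * (4 * jackson_const r * W + lip_const r * (real n)\<^sup>2 * V / real (n * q)))"
proof -
  obtain P where P: "\<And>k. degree (P k) < r"
    "\<And>k x y. k < n \<Longrightarrow> x \<in> {real k / real n..real (Suc k) / real n} \<Longrightarrow> y \<in> {real k / real n..real (Suc k) / real n} \<Longrightarrow>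
        \<bar>poly (P k) x - poly (P k) y\<bar> \<le> lip_const r * (real n)\<^sup>2 * V * \<bar>x - y\<bar>"
    "Lp_le p {0..<1} (\<lambda>x. f x - poly (P (nat \<lfloor>real n * x\<rfloor>)) x) (4 * jackson_const r * W)"
    using piecewise_poly_approx[OF p f r n W diff V] by blast
  define E where "E = lip_const r * (real n)\<^sup>2 * V / real (n * q)"
  have V0: "0 \<le> V" using V order_trans[of 0 "LBINT x. \<bar>f x\<bar>" V] by simp
  have E0: "0 \<le> E" using V0 jackson_lip_const_nonneg[of r] by (simp add: E_def)
  have [measurable]: "f \<in> borel_measurable borel" using f by auto
  have sm: "(\<lambda>x. poly (P (nat \<lfloor>real n * x\<rfloor>)) x) \<in> borel_measurable borel"
  proof (rule measurable_compose_countable[of "\<lambda>i x. poly (P i) x"])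
    show "(\<lambda>x. poly (P i) x) \<in> borel_measurable borel" for i
      by (intro borel_measurable_continuous_onI continuous_intros)
  qed measurable
  have M: "0 < real (n * q)" using n q by simp
  have "Lp_le p {0..<1} (\<lambda>x. f x - poly (P (nat \<lfloor>real n * x\<rfloor>)) (of_int \<lfloor>real (n * q) * x\<rfloor> / real (n * q)))
      (2 * (4 * jackson_const r * W + E))"
  proof (rule Lp_le_combine[OF p _ E0 _ _ P(3), where g = "\<lambda>_. E" and B = "{0..<1}"])
    fix x :: real assume x: "x \<in> {0..<1}"
    define k where "k = nat \<lfloor>real n * x\<rfloor>"
    define y where "y = of_int \<lfloor>real (n * q) * x\<rfloor> / real (n * q)"
    have kf: "real k = of_int \<lfloor>real n * x\<rfloor>" using x by (simp add: k_def)
    then have k: "real k \<le> real n * x" "real n * x < real k + 1" by linarith+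
    have "real n * x < real n" using x n by simp
    then have "real k < real n" using k by linarith
    then have kn: "k < n" by simp
    have y1: "y \<le> x" "x - y \<le> 1 / real (n * q)"
    proof -
      have "of_int \<lfloor>real (n * q) * x\<rfloor> \<le> real (n * q) * x" "real (n * q) * x \<le> of_int \<lfloor>real (n * q) * x\<rfloor> + 1" by linarith+
      then have "of_int \<lfloor>real (n * q) * x\<rfloor> / real (n * q) \<le> x" "x \<le> (of_int \<lfloor>real (n * q) * x\<rfloor> + 1) / real (n * q)"
        using M by (simp_all only: pos_divide_le_eq pos_le_divide_eq mult.commute[of x])
      then show "y \<le> x" "x - y \<le> 1 / real (n * q)" by (simp_all add: y_def add_divide_distrib)
    qed
    have y2: "real k / real n \<le> y"
    proof -
      have "real (k * q) \<le> real (n * q) * x" using mult_right_mono[OF k(1), of "real q"] by (simp add: mult_ac)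
      then have "int (k * q) \<le> \<lfloor>real (n * q) * x\<rfloor>" by (subst le_floor_iff) simp
      then have "real (k * q) \<le> of_int \<lfloor>real (n * q) * x\<rfloor>" by (metis of_int_le_iff of_int_of_nat_eq)
      then have "real (k * q) / real (n * q) \<le> y" unfolding y_def using M by (intro divide_right_mono) auto
      then show ?thesis using q by simp
    qed
    have x2: "real k / real n \<le> x" "x \<le> real (Suc k) / real n" using k n by (simp_all add: field_simps)
    have "\<bar>poly (P k) x - poly (P k) y\<bar> \<le> lip_const r * (real n)\<^sup>2 * V * \<bar>x - y\<bar>"
      using x2 y1 y2 by (intro P(2) kn) auto
    also have "\<dots> \<le> lip_const r * (real n)\<^sup>2 * V * (1 / real (n * q))"
      using y1 V0 jackson_lip_const_nonneg[of r] by (intro mult_left_mono) auto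
    also have "\<dots> = E" by (simp add: E_def)
    finally have "\<bar>poly (P k) x - poly (P k) y\<bar> \<le> E" .
    then show "\<bar>f x - poly (P (nat \<lfloor>real n * x\<rfloor>)) (of_int \<lfloor>real (n * q) * x\<rfloor> / real (n * q))\<bar>
      \<le> \<bar>f x - poly (P (nat \<lfloor>real n * x\<rfloor>)) x\<bar> * indicator {0..<1} x + \<bar>E\<bar> * indicator {0..<1} x"
      using x E0 unfolding k_def[symmetric] y_def[symmetric] by simp
  qed (use W jackson_lip_const_nonneg[of r] sm E0 p in \<open>auto intro!: Lp_le_const\<close>)
  then show ?thesis using P(1) unfolding E_def by blast
qed

section \<open>Moduli of Lebesgue and Sobolev functions\<close>

lemma lebesgue_measurable_AE_eq:
  fixes f g :: "real \<Rightarrow> real"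
  assumes g: "g \<in> borel_measurable borel" and A: "A \<in> sets borel"
    and eq: "AE x in lborel. x \<in> A \<longrightarrow> f x = g x"
  shows "f \<in> borel_measurable (lebesgue_on A)"
proof -
  have "(\<lambda>x. if x \<in> A then f x else 0) \<in> borel_measurable lebesgue"
  proof (rule borel_measurable_AE)
    show "(\<lambda>x. if x \<in> A then g x else 0) \<in> borel_measurable lebesgue"
      using g A by (intro measurable_completion) auto
    show "AE x in lebesgue. (if x \<in> A then g x else 0) = (if x \<in> A then f x else 0)"
      using eq by (intro AE_completion) (auto elim!: eventually_mono)
  qed
  then show ?thesis using A by (simp add: borel_measurable_if)
qed

lemma fdiff_norm_le_iff:
  fixes f g :: "real \<Rightarrow> real"
  assumes p: "1 \<le> p" and h: "0 \<le> h" and M: "0 \<le> M" and g: "g \<in> borel_measurable borel"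
    and eq: "AE x in lborel. x \<in> {0..<1} \<longrightarrow> f x = g x"
  shows "Lp_norm p {0..<1 - real r * h} ((fdiff h ^^ r) f) \<le> ennreal M
     \<longleftrightarrow> Lp_le p {0..<1 - real r * h} ((fdiff h ^^ r) g) M"
proof -
  let ?A = "{0..<1 - real r * h}"
  have "AE x in lborel. \<forall>l::nat. x + real l * h \<in> {0..<1} \<longrightarrow> f (x + real l * h) = g (x + real l * h)"
    by (subst AE_all_countable) (intro allI AE_lborel_translate[OF eq])
  then have ae: "AE x in lborel. x \<in> ?A \<longrightarrow> (fdiff h ^^ r) f x = (fdiff h ^^ r) g x"
  proof eventually_elim
    case (elim x)
    show ?case
    proof
      assume x: "x \<in> ?A"
      have "f (x + real l * h) = g (x + real l * h)" if "l \<le> r" for l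
      proof -
        have "real l * h \<le> real r * h" "0 \<le> real l * h" using that h by (auto intro: mult_right_mono)
        then show ?thesis using elim[rule_format, of l] x by auto
      qed
      then show "(fdiff h ^^ r) f x = (fdiff h ^^ r) g x" by (simp add: fdiff_funpow)
    qed
  qed
  have gm: "(fdiff h ^^ r) g \<in> borel_measurable borel" using g by measurable
  have gl: "(fdiff h ^^ r) g \<in> borel_measurable (lebesgue_on ?A)"
    by (rule lebesgue_measurable_AE_eq[OF gm]) auto
  have fl: "(fdiff h ^^ r) f \<in> borel_measurable (lebesgue_on ?A)"
    by (rule lebesgue_measurable_AE_eq[OF gm _ ae]) auto
  have "Lp_norm p ?A ((fdiff h ^^ r) f) = Lp_norm p ?A ((fdiff h ^^ r) g)"
    by (rule Lp_norm_cong_AE[OF fl gl _ ae]) auto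
  then show ?thesis using Lp_norm_le_iff[OF gl _ M p] by simp
qed

lemma weak_integral_transfer:
  fixes F G \<phi> :: "real \<Rightarrow> real"
  assumes G: "G \<in> borel_measurable (lebesgue_on {0..<1})" and F: "F \<in> borel_measurable borel"
    and z: "\<And>x. x \<notin> {0<..<1} \<Longrightarrow> F x = 0" and eq: "AE x in lborel. x \<in> {0..<1} \<longrightarrow> G x = F x"
    and \<phi>: "\<phi> \<in> borel_measurable borel"
  shows "(\<integral>x. G x * \<phi> x \<partial>lebesgue_on {0<..<1}) = (LBINT x. F x * \<phi> x)"
proof -
  have Fl: "F \<in> borel_measurable (lebesgue_on {0<..<1})" "\<phi> \<in> borel_measurable (lebesgue_on {0<..<1})"
    using F \<phi> by (auto intro!: measurable_restrict_space1 measurable_completion)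
  have Gl: "G \<in> borel_measurable (lebesgue_on {0<..<1})"
    by (rule measurable_restrict_mono[OF G]) auto
  have "AE x in lebesgue_on {0<..<1}. G x * \<phi> x = F x * \<phi> x"
    using eq by (simp add: AE_restrict_space_iff AE_completion_iff) (auto elim!: eventually_mono)
  then have "(\<integral>x. G x * \<phi> x \<partial>lebesgue_on {0<..<1}) = (\<integral>x. F x * \<phi> x \<partial>lebesgue_on {0<..<1})"
    using Fl Gl by (intro integral_cong_AE) auto
  also have "\<dots> = (\<integral>x. indicator {0<..<1} x *\<^sub>R (F x * \<phi> x) \<partial>lebesgue)"
    by (intro integral_restrict_space) auto
  also have "\<dots> = (\<integral>x. F x * \<phi> x \<partial>lebesgue)"
  proof (intro Bochner_Integration.integral_cong refl)
    show "indicator {0<..<1} x *\<^sub>R (F x * \<phi> x) = F x * \<phi> x" for x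
      using z[of x] by (cases "x \<in> {0<..<1}") auto
  qed
  also have "\<dots> = (LBINT x. F x * \<phi> x)"
    using F \<phi> by (intro integral_completion) auto
  finally show ?thesis .
qed

lemma test_function_measurable:
  assumes "test_function \<psi>"
  shows "(deriv ^^ k) \<psi> \<in> borel_measurable borel"
proof -
  have "(deriv ^^ k) \<psi> differentiable at x" for x using assms unfolding test_function_def by blast
  then have "isCont ((deriv ^^ k) \<psi>) x" for x by (rule differentiable_imp_continuous_within)
  then show ?thesis
    by (intro borel_measurable_continuous_onI continuous_at_imp_continuous_on) blast
qed

lemma Lp_borel_version:
  assumes "f \<in> Lp p" "1 \<le> p"
  obtains g V where "g \<in> borel_measurable borel" "\<And>x. x \<notin> {0<..<1} \<Longrightarrow> g x = 0"
    "AE x in lborel. x \<in> {0..<1} \<longrightarrow> f x = g x" "integrable lborel g" "0 \<le> V"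
    "Lp_norm p {0..<1} f = ennreal V" "(LBINT x. \<bar>g x\<bar>) \<le> V" "Lp_le p {0..<1} g V"
proof -
  have f: "f \<in> borel_measurable (lebesgue_on {0..<1})" "Lp_norm p {0..<1} f < \<infinity>" using assms(1) by (auto simp: Lp_def)
  obtain V where V: "0 \<le> V" "Lp_norm p {0..<1} f = ennreal V"
    using f(2) by (cases "Lp_norm p {0..<1} f") auto
  obtain g where g: "g \<in> borel_measurable borel" "\<And>x. x \<notin> {0<..<1} \<Longrightarrow> g x = 0"
    "AE x in lborel. x \<in> {0..<1} \<longrightarrow> f x = g x"
    by (rule borel_version[OF f(1)]) (rule that)
  have "Lp_le p {0..<1} f V" using Lp_norm_le_iff[OF f(1) _ V(1) assms(2)] V(2) by simp
  then have le: "Lp_le p {0..<1} g V"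
    by (rule Lp_le_mono_AE[rotated]) (use g(3) in \<open>auto elim!: eventually_mono\<close>)
  have "integrable lborel g" "(LBINT x. \<bar>g x\<bar>) \<le> V"
    using Lp_le_imp_integrable[OF assms(2) g(1) V(1) le g(2)] by auto
  with g V le show ?thesis using that by blast
qed

text \<open>
  The weak derivatives of order 1 up to \<open>r\<close> form a chain in which each function is the first weak derivative of
  its predecessor; \<open>Lp_le_fdiff_weak\<close> is applied to Borel representatives of this chain.
\<close>

lemma sobolev_modulus:
  assumes p: "1 \<le> p" and r: "1 \<le> r" and f: "f \<in> fst (sobolev r p)" and t: "0 < t"
  shows "modulus r f t p \<le> ennreal (t ^ r) * Lp_norm p {0..<1} (weak_deriv r f)"
proof -
  define G where "G k = (if k = 0 then f else weak_deriv k f)" for k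
  have wd: "has_weak_deriv k f (weak_deriv k f)" if "k \<in> {1..r}" for k
  proof -
    have "\<exists>g. has_weak_deriv k f g" using f that by (auto simp: sobolev_def)
    then show ?thesis unfolding weak_deriv_def by (rule someI_ex)
  qed
  have GL: "G k \<in> Lp p" if "k \<le> r" for k
    using f that by (auto simp: G_def sobolev_def)
  have step: "has_weak_deriv 1 (G k) (G (Suc k))" if "k < r" for k
  proof (cases "k = 0")
    case True
    then show ?thesis using wd[of 1] that by (simp add: G_def)
  next
    case False
    then show ?thesis using has_weak_deriv_step[OF wd[of k] wd[of "Suc k"]] that by (simp add: G_def)
  qed
  define Rep where "Rep k F \<longleftrightarrow> F \<in> borel_measurable borel \<and> (\<forall>x. x \<notin> {0<..<1} \<longrightarrow> F x = 0) \<and>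
      (AE x in lborel. x \<in> {0..<1} \<longrightarrow> G k x = F x) \<and> integrable lborel F \<and>
      (\<exists>V\<ge>0. Lp_norm p {0..<1} (G k) = ennreal V \<and> Lp_le p {0..<1} F V)" for k F
  have "\<exists>F. Rep k F" if "k \<le> r" for k
  proof (rule Lp_borel_version[OF GL[OF that] p])
    fix g V
    assume "g \<in> borel_measurable borel" "\<And>x. x \<notin> {0<..<1} \<Longrightarrow> g x = 0"
      "AE x in lborel. x \<in> {0..<1} \<longrightarrow> G k x = g x" "integrable lborel g" "0 \<le> V"
      "Lp_norm p {0..<1} (G k) = ennreal V" "Lp_le p {0..<1} g V"
    then have "Rep k g" unfolding Rep_def by blast
    then show "\<exists>F. Rep k F" by blast
  qed
  then obtain F where Rep: "\<And>k. k \<le> r \<Longrightarrow> Rep k (F k)" by metis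
  then have F: "\<And>k. k \<le> r \<Longrightarrow> F k \<in> borel_measurable borel"
      "\<And>k x. k \<le> r \<Longrightarrow> x \<notin> {0<..<1} \<Longrightarrow> F k x = 0"
      "\<And>k. k \<le> r \<Longrightarrow> AE x in lborel. x \<in> {0..<1} \<longrightarrow> G k x = F k x"
      "\<And>k. k \<le> r \<Longrightarrow> integrable lborel (F k)"
      "\<And>k. k \<le> r \<Longrightarrow> \<exists>V\<ge>0. Lp_norm p {0..<1} (G k) = ennreal V \<and> Lp_le p {0..<1} (F k) V"
    unfolding Rep_def by blast+
  obtain V where V: "0 \<le> V" "Lp_norm p {0..<1} (G r) = ennreal V" "Lp_le p {0..<1} (F r) V"
    using F(5)[of r] by blast
  have weak: "(LBINT x. F k x * deriv \<psi> x) = - (LBINT x. F (Suc k) x * \<psi> x)"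
    if k: "k < r" and \<psi>: "test_function \<psi>" for k \<psi>
  proof -
    have m: "G j \<in> borel_measurable (lebesgue_on {0..<1})" if "j \<le> r" for j using GL[OF that] by (simp add: Lp_def)
    have "(\<integral>x. G k x * (deriv ^^ 1) \<psi> x \<partial>lebesgue_on {0<..<1}) = (LBINT x. F k x * (deriv ^^ 1) \<psi> x)"
      using k by (intro weak_integral_transfer m F test_function_measurable \<psi>) auto
    moreover have "(\<integral>x. G (Suc k) x * (deriv ^^ 0) \<psi> x \<partial>lebesgue_on {0<..<1}) = (LBINT x. F (Suc k) x * (deriv ^^ 0) \<psi> x)"
      using k by (intro weak_integral_transfer m F test_function_measurable \<psi>) auto
    moreover have "(\<integral>x. G k x * (deriv ^^ 1) \<psi> x \<partial>lebesgue_on {0<..<1}) = (-1) ^ 1 * (\<integral>x. G (Suc k) x * \<psi> x \<partial>lebesgue_on {0<..<1})"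
      using step[OF k] \<psi> unfolding has_weak_deriv_def by blast
    ultimately show ?thesis by simp
  qed
  have "Lp_norm p {0..<1 - real r * h} ((fdiff h ^^ r) f) \<le> ennreal (t ^ r * V)" if h: "h \<in> {0<..t}" for h
  proof -
    have h0: "0 < h" "h \<le> t" using h by auto
    have "Lp_le p {0..<1 - real r * h} ((fdiff h ^^ r) (F 0)) (h ^ r * V)"
    proof (rule Lp_le_fdiff_weak[where F = F and r = r, OF p h0(1) F(4) _ V(1,3)])
      show "AE x in lborel. 0 < x \<and> x + h < 1 \<longrightarrow> F i (x + h) - F i x = (LBINT s. F (Suc i) (x + s) * indicator {0..h} s)"
        if i: "i < r" for i
        using i by (intro weak_deriv_difference F h0 weak) auto
    qed
    moreover have "h ^ r * V \<le> t ^ r * V" using h0 V by (intro mult_right_mono power_mono) auto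
    ultimately have "Lp_le p {0..<1 - real r * h} ((fdiff h ^^ r) (F 0)) (t ^ r * V)"
      using h0 V by (elim Lp_le_mono_bound) auto
    then show ?thesis
      using fdiff_norm_le_iff[OF p _ _ F(1)[of 0], of h "t ^ r * V" f r] F(3)[of 0] h0 t V by (simp add: G_def)
  qed
  then have "modulus r f t p \<le> ennreal (t ^ r * V)" unfolding modulus_def by (intro SUP_least)
  also have "\<dots> = ennreal (t ^ r) * Lp_norm p {0..<1} (G r)" using t V by (simp add: ennreal_mult)
  finally show ?thesis using r by (simp add: G_def)
qed

section \<open>The direct estimate\<close>

definition jackson_bound :: "nat \<Rightarrow> real" where
  "jackson_bound r = 8 * jackson_const r + 2 * lip_const r + 1"

definition rank_bound :: "nat \<Rightarrow> nat" where
  "rank_bound r = 2 + 2 * r + 2 * r * (r + 1)"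

text \<open>
  With \<open>n = b\<^bsup>2e\<^esup>\<close> cells and sampling level \<open>D = 2 e (r + 2)\<close> the factor \<open>n\<^sup>2 / b\<^sup>D\<close> of the sampling error is
  \<open>b\<^bsup>-2er\<^esup>\<close>, which matches the decay of the modulus of the smoothest functions.
\<close>

lemma spline_network_approx:
  assumes b: "2 \<le> b" and \<phi>: "poly_basis m \<phi>" and p: "1 \<le> p" and r: "1 \<le> r" and e: "1 \<le> e"
    and f: "f \<in> Lp p" and fin: "modulus r f ((1 / (real b)\<^sup>2) ^ e) p < \<infinity>"
  shows "\<exists>v g. tn_wf v \<and> tn_realizes b m \<phi> v g \<and> compl_N b m v \<le> rank_bound r * b ^ e \<and>
    Lp_norm p {0..<1} (\<lambda>x. f x - g x) \<le> ennreal (jackson_bound r) *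
      (modulus r f ((1 / (real b)\<^sup>2) ^ e) p + ennreal (((1 / (real b)\<^sup>2) ^ e) ^ r) * Lp_norm p {0..<1} f)"
proof -
  define n where "n = b ^ (2 * e)"
  define D where "D = (r + 2) * (2 * e)"
  define q where "q = b ^ (D - 2 * e)"
  have nr: "real n = real b ^ (2 * e)" by (simp add: n_def)
  have tn: "(1 / (real b)\<^sup>2) ^ e = 1 / real n" by (simp add: nr power_one_over power_mult[symmetric] flip: power_mult)
  have nq: "n * q = b ^ D" by (simp add: n_def q_def D_def flip: power_add)
  have n2: "2 \<le> n"
  proof -
    have "2 ^ 1 \<le> b ^ 1" using b by simp
    also have "\<dots> \<le> b ^ (2 * e)" using b e by (intro power_increasing) auto
    finally show ?thesis by (simp add: n_def)
  qed
  have q1: "1 \<le> q" using b by (simp add: q_def)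
  obtain g V where g: "g \<in> borel_measurable borel" "\<And>x. x \<notin> {0<..<1} \<Longrightarrow> g x = 0"
    "AE x in lborel. x \<in> {0..<1} \<longrightarrow> f x = g x" "integrable lborel g" "0 \<le> V"
    "Lp_norm p {0..<1} f = ennreal V" "(LBINT x. \<bar>g x\<bar>) \<le> V"
    by (rule Lp_borel_version[OF f p]) (rule that)
  obtain W where W: "0 \<le> W" "modulus r f (1 / real n) p = ennreal W"
    using fin unfolding tn by (cases "modulus r f (1 / real n) p") auto
  have diff: "Lp_le p {0..<1 - real r * h} ((fdiff h ^^ r) g) W" if h: "0 < h" "h \<le> 1 / real n" for h
  proof -
    have "Lp_norm p {0..<1 - real r * h} ((fdiff h ^^ r) f) \<le> modulus r f (1 / real n) p"
      unfolding modulus_def using h by (intro SUP_upper) auto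
    then show ?thesis using fdiff_norm_le_iff[OF p _ W(1) g(1,3)] h W by simp
  qed
  obtain P where P: "\<And>k. degree (P k) < r"
    "Lp_le p {0..<1} (\<lambda>x. g x - poly (P (nat \<lfloor>real n * x\<rfloor>)) (of_int \<lfloor>real (n * q) * x\<rfloor> / real (n * q)))
      (2 * (4 * jackson_const r * W + lip_const r * (real n)\<^sup>2 * V / real (n * q)))"
    using sampled_poly_approx[OF p g(4) r n2 q1 W(1) diff g(7)] by blast
  define s where "s x = poly (P (nat \<lfloor>real b ^ (2 * e) * x\<rfloor>)) (of_int \<lfloor>real b ^ D * x\<rfloor> / real b ^ D)" for x
  have s: "poly (P (nat \<lfloor>real n * x\<rfloor>)) (of_int \<lfloor>real (n * q) * x\<rfloor> / real (n * q)) = s x" for x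
    by (simp only: nq s_def nr of_nat_power)
  have sm: "s \<in> borel_measurable borel"
    unfolding s_def
  proof (rule measurable_compose_countable[of "\<lambda>i x. poly (P i) (of_int \<lfloor>real b ^ D * x\<rfloor> / real b ^ D)"])
    show "(\<lambda>x. poly (P i) (of_int \<lfloor>real b ^ D * x\<rfloor> / real b ^ D)) \<in> borel_measurable borel" for i
    proof (rule measurable_compose[of _ _ borel "poly (P i)"])
      show "poly (P i) \<in> borel_measurable borel"
        by (intro borel_measurable_continuous_onI continuous_intros)
    qed measurable
  qed measurable
  have "real (n * q) = (real n)\<^sup>2 * real n ^ r"
  proof -
    have "D = 2 * (2 * e) + 2 * e * r" by (simp add: D_def algebra_simps)
    then have "b ^ D = n\<^sup>2 * n ^ r" by (simp add: n_def power_add power_mult mult.commute flip: power_mult)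
    then show ?thesis unfolding nq by simp
  qed
  then have Lq: "lip_const r * (real n)\<^sup>2 * V / real (n * q) = lip_const r * ((1 / real n) ^ r * V)"
    using n2 by (simp add: power_one_over field_simps)
  have c: "0 \<le> jackson_const r" "0 \<le> lip_const r" using jackson_lip_const_nonneg by auto
  have bound: "2 * (4 * jackson_const r * W + lip_const r * (real n)\<^sup>2 * V / real (n * q))
     \<le> jackson_bound r * (W + (1 / real n) ^ r * V)"
  proof -
    define Y where "Y = (1 / real n) ^ r * V"
    have Y: "0 \<le> Y" using g(5) by (simp add: Y_def)
    have "8 * jackson_const r * W \<le> jackson_bound r * W" "2 * lip_const r * Y \<le> jackson_bound r * Y"
      using c W Y by (auto simp: jackson_bound_def intro!: mult_right_mono)
    then show ?thesis unfolding Lq Y_def[symmetric] by (simp add: distrib_left)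
  qed
  have "Lp_le p {0..<1} (\<lambda>x. g x - s x) (jackson_bound r * (W + (1 / real n) ^ r * V))"
    using P(2) unfolding s
    by (rule Lp_le_mono_bound[OF _ _ bound]) (use c W g(5) in auto)
  then have le: "Lp_le p {0..<1} (\<lambda>x. f x - s x) (jackson_bound r * (W + (1 / real n) ^ r * V))"
    by (rule Lp_le_mono_AE[rotated]) (use g(3) in \<open>auto elim!: eventually_mono\<close>)
  have fs: "(\<lambda>x. f x - s x) \<in> borel_measurable (lebesgue_on {0..<1})"
    using g(3) by (intro lebesgue_measurable_AE_eq[OF borel_measurable_diff[OF g(1) sm]]) (auto elim!: eventually_mono)
  have jb: "0 \<le> jackson_bound r" using c by (simp add: jackson_bound_def)
  have "Lp_norm p {0..<1} (\<lambda>x. f x - s x) \<le> ennreal (jackson_bound r * (W + (1 / real n) ^ r * V))"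
    using Lp_norm_le_iff[OF fs _ _ p] le jb W g(5) by simp
  also have "\<dots> = ennreal (jackson_bound r) * (ennreal W + ennreal ((1 / real n) ^ r) * ennreal V)"
    using jb W g(5) by (simp add: ennreal_mult ennreal_plus)
  finally have est: "Lp_norm p {0..<1} (\<lambda>x. f x - s x) \<le> ennreal (jackson_bound r) *
      (modulus r f (1 / real n) p + ennreal ((1 / real n) ^ r) * Lp_norm p {0..<1} f)"
    by (simp add: W(2) g(6))
  have "\<exists>v. tn_wf v \<and> tn_realizes b m \<phi> v s \<and> compl_N b m v \<le> rank_bound r * b ^ e"
    unfolding s_def[abs_def] rank_bound_def by (rule sampled_spline_realized[OF b \<phi> r e P(1) D_def])
  then obtain v where "tn_wf v" "tn_realizes b m \<phi> v s" "compl_N b m v \<le> rank_bound r * b ^ e" by blast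
  with est show ?thesis unfolding tn by (intro exI[of _ v] exI[of _ s] conjI)
qed

lemma best_error_le:
  assumes b: "2 \<le> b" and \<phi>: "poly_basis m \<phi>" and p: "1 \<le> p" and r: "1 \<le> r" and e: "1 \<le> e" and f: "f \<in> Lp p"
    and c: "\<And>v. tn_wf v \<Longrightarrow> compl_N b m v \<le> rank_bound r * b ^ e \<Longrightarrow> c b m v \<le> n" and n: "1 \<le> n"
  shows "best_error (tn_Phi c b m \<phi>) p n f \<le> ennreal (jackson_bound r) *
      (modulus r f ((1 / (real b)\<^sup>2) ^ e) p + ennreal (((1 / (real b)\<^sup>2) ^ e) ^ r) * Lp_norm p {0..<1} f)"
proof (cases "modulus r f ((1 / (real b)\<^sup>2) ^ e) p < \<infinity>")
  case True
  obtain v g where "tn_wf v" "tn_realizes b m \<phi> v g" "compl_N b m v \<le> rank_bound r * b ^ e" and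
    le: "Lp_norm p {0..<1} (\<lambda>x. f x - g x) \<le> ennreal (jackson_bound r) *
      (modulus r f ((1 / (real b)\<^sup>2) ^ e) p + ennreal (((1 / (real b)\<^sup>2) ^ e) ^ r) * Lp_norm p {0..<1} f)"
    using spline_network_approx[OF b \<phi> p r e f True] by blast
  then have "g \<in> tn_Phi c b m \<phi> n" using c n by (auto simp: tn_Phi_def)
  then have "best_error (tn_Phi c b m \<phi>) p n f \<le> Lp_norm p {0..<1} (\<lambda>x. f x - g x)"
    unfolding best_error_def by (rule INF_lower)
  with le show ?thesis by (rule order_trans[rotated])
next
  case False
  have "0 < jackson_bound r" using jackson_lip_const_nonneg[of r] by (simp add: jackson_bound_def)
  then show ?thesis using False by (simp add: ennreal_mult_top less_top[symmetric])
qed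

lemma best_error_le_norm: "best_error (tn_Phi c b m \<phi>) p n f \<le> Lp_norm p {0..<1} f"
  unfolding best_error_def by (rule INF_lower2[of "\<lambda>_. 0"]) (auto simp: tn_Phi_def)

lemma modulus_mono: "s \<le> t \<Longrightarrow> modulus r f s p \<le> modulus r f t p"
  unfolding modulus_def by (intro SUP_subset_mono) auto

text \<open>
  Both complexity measures are treated at once: \<open>K B\<^sup>e\<close> bounds the complexity at level \<open>e\<close>, with \<open>B = b\<close> for
  the sum of ranks and \<open>B = b\<^sup>2\<close> for the number of parameters, and \<open>\<gamma>\<close> is the exponent of the approximation class,
  so that \<open>B\<^sup>\<gamma> = b\<^bsup>2\<alpha>\<^esup>\<close> in both cases.
\<close>

context
  fixes b m r K B :: nat and \<phi> :: "nat \<Rightarrow> real poly" and p :: ennreal and \<alpha> \<gamma> :: real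
    and c :: "nat \<Rightarrow> nat \<Rightarrow> tensor_network \<Rightarrow> nat"
  assumes b: "2 \<le> b" and \<phi>: "poly_basis m \<phi>" and p: "1 \<le> p" and r: "1 \<le> r"
    and K: "1 \<le> K" and B: "2 \<le> B" and \<alpha>: "0 < \<alpha>" "\<alpha> \<le> real r" and \<gamma>: "0 < \<gamma>"
    and Bb: "real B powr \<gamma> = (1 / (real b)\<^sup>2) powr (-\<alpha>)"
    and c: "\<And>v e. tn_wf v \<Longrightarrow> compl_N b m v \<le> rank_bound r * b ^ e \<Longrightarrow> c b m v \<le> K * B ^ e"
begin

abbreviation "\<beta> \<equiv> 1 / (real b)\<^sup>2"
abbreviation "\<Phi> \<equiv> tn_Phi c b m \<phi>"
abbreviation "\<theta> \<equiv> \<beta> powr (real r - \<alpha>)"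
abbreviation "Tseq f e \<equiv> ennreal ((\<beta> ^ e) powr (-\<alpha>)) * modulus r f (\<beta> ^ e) p"

lemma beta_range: "0 < \<beta>" "\<beta> < 1"
proof -
  have "1 < (real b)\<^sup>2" using b by (intro one_less_power) auto
  moreover from this have "0 < (real b)\<^sup>2" by linarith
  ultimately show "0 < \<beta>" "\<beta> < 1" by (simp_all only: zero_less_divide_1_iff divide_less_eq_1_pos)
qed

lemma theta_range: "0 < \<theta>" "\<theta> \<le> 1" "\<alpha> < real r \<Longrightarrow> \<theta> < 1"
proof -
  show "0 < \<theta>" using beta_range by simp
  show "\<theta> \<le> 1" using beta_range \<alpha> powr_mono2[of "real r - \<alpha>" \<beta> 1] by auto
  show "\<theta> < 1" if "\<alpha> < real r" using beta_range that powr_less_mono2[of "real r - \<alpha>" \<beta> 1] by auto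
qed

lemma jackson_bound_ge_1: "1 \<le> jackson_bound r"
  using jackson_lip_const_nonneg[of r] by (simp add: jackson_bound_def)

lemma weighted_error_le:
  assumes f: "f \<in> Lp p" and e: "1 \<le> e" and n: "K * B ^ e \<le> n"
  shows "ennreal (real B powr (\<gamma> * real e)) * best_error \<Phi> p n f
     \<le> ennreal (jackson_bound r) * (Tseq f e + ennreal \<theta> ^ e * Lp_norm p {0..<1} f)"
proof -
  have n1: "1 \<le> n"
  proof -
    have "1 \<le> K * B ^ e" using K B by simp
    then show ?thesis using n by (rule le_trans)
  qed
  have pe: "\<beta> ^ k = \<beta> powr real k" for k
    using powr_realpow[OF beta_range(1), of k] by simp
  have w: "real B powr (\<gamma> * real e) = (\<beta> ^ e) powr (-\<alpha>)"
  proof -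
    have "real B powr (\<gamma> * real e) = (real B powr \<gamma>) powr real e" by (simp add: powr_powr)
    also have "\<dots> = \<beta> powr (-\<alpha> * real e)" unfolding Bb by (simp add: powr_powr)
    also have "\<dots> = (\<beta> ^ e) powr (-\<alpha>)" by (simp only: pe powr_powr mult.commute)
    finally show ?thesis .
  qed
  have th: "(\<beta> ^ e) powr (-\<alpha>) * (\<beta> ^ e) ^ r = \<theta> ^ e"
  proof -
    have "\<theta> ^ e = \<beta> powr ((real r - \<alpha>) * real e)" 
      by (simp only: powr_realpow[OF theta_range(1), symmetric] powr_powr)
    also have "(real r - \<alpha>) * real e = (-\<alpha>) * real e + real e * real r" by (simp add: algebra_simps)
    also have "\<beta> powr \<dots> = (\<beta> ^ e) powr (-\<alpha>) * (\<beta> ^ e) ^ r"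
    proof -
      have "(\<beta> ^ e) ^ r = \<beta> ^ (e * r)" by (rule power_mult[symmetric])
      also have "\<dots> = \<beta> powr real (e * r)" by (rule pe)
      finally have "(\<beta> ^ e) ^ r = \<beta> powr (real e * real r)" by (simp only: of_nat_mult)
      then show ?thesis by (simp only: powr_add pe powr_powr mult.commute)
    qed
    finally show ?thesis by simp
  qed
  have "best_error \<Phi> p n f \<le> ennreal (jackson_bound r) *
      (modulus r f (\<beta> ^ e) p + ennreal ((\<beta> ^ e) ^ r) * Lp_norm p {0..<1} f)"
    using n c by (intro best_error_le b \<phi> p r e f n1) (auto intro: order_trans)
  then have "ennreal (real B powr (\<gamma> * real e)) * best_error \<Phi> p n f
     \<le> ennreal ((\<beta> ^ e) powr (-\<alpha>)) * (ennreal (jackson_bound r) *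
      (modulus r f (\<beta> ^ e) p + ennreal ((\<beta> ^ e) ^ r) * Lp_norm p {0..<1} f))"
    unfolding w by (rule mult_left_mono) simp
  also have "\<dots> = ennreal (jackson_bound r) * (Tseq f e + (ennreal ((\<beta> ^ e) powr (-\<alpha>)) * ennreal ((\<beta> ^ e) ^ r)) * Lp_norm p {0..<1} f)"
    by (simp only: distrib_left mult_ac)
  also have "ennreal ((\<beta> ^ e) powr (-\<alpha>)) * ennreal ((\<beta> ^ e) ^ r) = ennreal \<theta> ^ e"
    using beta_range theta_range by (simp add: ennreal_power th flip: ennreal_mult)
  finally show ?thesis .
qed

lemma approx_norm_infinity_bound:
  "\<exists>C>0. \<forall>f\<in>Lp p. \<forall>S. (\<forall>e\<ge>1. Tseq f e \<le> S) \<longrightarrow>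
      approx_norm \<Phi> p \<gamma> \<infinity> f \<le> ennreal C * (Lp_norm p {0..<1} f + S)"
proof (intro exI conjI ballI allI impI)
  fix f S assume f: "f \<in> Lp p" and S: "\<forall>e\<ge>1. Tseq f e \<le> S"
  show "approx_norm \<Phi> p \<gamma> \<infinity> f \<le> ennreal (jackson_bound r * real (K * B) powr \<gamma>) * (Lp_norm p {0..<1} f + S)"
    using weighted_sup_bound[OF K B \<gamma> jackson_bound_ge_1 theta_range(1,2) best_error_le_norm weighted_error_le[OF f], where S = S]
S
    by (simp add: approx_norm_def block_const_def)
next
  show "0 < jackson_bound r * real (K * B) powr \<gamma>" using jackson_bound_ge_1 K B by simp
qed

text \<open>
  Here \<open>\<alpha> < r\<close> is essential: it makes \<open>\<theta> < 1\<close>, and the geometric series in \<open>weighted_sum_bound\<close> converges.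
\<close>

lemma approx_norm_finite_bound:
  assumes q: "0 < q" "q \<noteq> \<infinity>" and \<alpha>r: "\<alpha> < real r"
  shows "\<exists>C>0. \<forall>f\<in>Lp p. approx_norm \<Phi> p \<gamma> q f \<le> ennreal C *
     (Lp_norm p {0..<1} f + epowr (\<integral>\<^sup>+t\<in>{0<..<1}. epowr (ennreal (t powr (-\<alpha>)) * modulus r f t p) (enn2real q)
                          * ennreal (1 / t) \<partial>lborel) (1 / enn2real q))"
proof -
  define Q where "Q = enn2real q"
  have Q: "0 < Q" using q by (simp add: Q_def enn2real_positive_iff less_top)
  define A where "A = real (K * B) * (jackson_bound r * real (K * B) powr \<gamma>) powr Q * (2 powr Q + 1) / (1 - \<theta> powr Q)"
  define H where "H = \<beta> powr (-\<alpha> * Q) / (1 - \<beta>)"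
  have H0: "0 < H" using beta_range by (simp add: H_def)
  have tq: "\<theta> powr Q < 1" using theta_range(1) theta_range(3)[OF \<alpha>r] Q powr_less_mono2[of Q \<theta> 1] by auto
  have A0: "0 < A"
  proof -
    have "0 < real (K * B)" using K B by simp
    then show ?thesis unfolding A_def using tq jackson_bound_ge_1 K B
      by (intro divide_pos_pos mult_pos_pos) (auto intro: add_pos_pos)
  qed
  define M where "M = max 1 H"
  define C where "C = (A * M) powr (1 / Q) * 2 powr (1 / Q)"
  have M: "1 \<le> M" "H \<le> M" by (auto simp: M_def)
  have "0 < C" using A0 M by (simp add: C_def)
  moreover have "approx_norm \<Phi> p \<gamma> q f \<le> ennreal C *
     (Lp_norm p {0..<1} f + epowr (\<integral>\<^sup>+t\<in>{0<..<1}. epowr (ennreal (t powr (-\<alpha>)) * modulus r f t p) Q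
                          * ennreal (1 / t) \<partial>lborel) (1 / Q))" if f: "f \<in> Lp p" for f
  proof -
    define F where "F = Lp_norm p {0..<1} f"
    define I where "I = (\<integral>\<^sup>+t\<in>{0<..<1}. epowr (ennreal (t powr (-\<alpha>)) * modulus r f t p) Q * ennreal (1 / t) \<partial>lborel)"
    note block = K B \<gamma> jackson_bound_ge_1 theta_range(1,2) best_error_le_norm weighted_error_le[OF f]
    have "(\<Sum>n. epowr (ennreal (real (Suc n) powr \<gamma>) * best_error \<Phi> p n f) Q * ennreal (1 / real (Suc n)))
      \<le> ennreal A * (epowr F Q + (\<Sum>e. epowr (Tseq f (Suc e)) Q))"
      using weighted_sum_bound[OF block Q theta_range(3)[OF \<alpha>r]] unfolding block_const_def A_def F_def by simp
    also have "(\<Sum>e. epowr (Tseq f (Suc e)) Q) \<le> ennreal H * I"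
      unfolding H_def I_def using besov_sum_le[OF beta_range \<alpha>(1) Q, of "\<lambda>t. modulus r f t p"] by (simp add: modulus_mono)
    also have "ennreal A * (epowr F Q + ennreal H * I) \<le> ennreal A * (ennreal M * (epowr F Q + I))"
    proof (intro mult_left_mono)
      have "epowr F Q + ennreal H * I \<le> ennreal M * epowr F Q + ennreal M * I"
        using M mult_right_mono[of 1 "ennreal M" "epowr F Q"]
        by (intro add_mono mult_right_mono) (auto intro: ennreal_leI)
      then show "epowr F Q + ennreal H * I \<le> ennreal M * (epowr F Q + I)" by (simp add: distrib_left)
    qed simp
    also have "\<dots> = ennreal (A * M) * (epowr F Q + I)" using A0 M by (simp add: ennreal_mult mult.assoc)
    finally have sum: "(\<Sum>n. epowr (ennreal (real (Suc n) powr \<gamma>) * best_error \<Phi> p n f) Q * ennreal (1 / real (Suc n)))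
       \<le> ennreal (A * M) * (epowr F Q + I)" by (simp add: mult_left_mono add_left_mono)
    have iQ: "0 < 1 / Q" using Q by simp
    have "approx_norm \<Phi> p \<gamma> q f \<le> epowr (ennreal (A * M) * (epowr F Q + I)) (1 / Q)"
      unfolding approx_norm_def Q_def[symmetric] using q epowr_mono[OF sum iQ] by simp
    also have "\<dots> = ennreal ((A * M) powr (1 / Q)) * epowr (epowr F Q + I) (1 / Q)"
      using A0 M iQ by (simp add: epowr_mult epowr_ennreal)
    also have "\<dots> \<le> ennreal ((A * M) powr (1 / Q)) * (ennreal (2 powr (1 / Q)) * (epowr (epowr F Q) (1 / Q) + epowr I (1 / Q)))"
      by (intro mult_left_mono epowr_add_le iQ) simp
    also have "\<dots> = ennreal C * (F + epowr I (1 / Q))"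
      using Q by (simp add: C_def epowr_epowr ennreal_mult mult.assoc)
    finally show ?thesis unfolding F_def I_def .
  qed
  ultimately show ?thesis unfolding Q_def by blast
qed

lemma besov_embedding:
  assumes q: "0 < q" and \<alpha>r: "r = nat \<lfloor>\<alpha>\<rfloor> + 1"
  shows "besov \<alpha> p q \<hookrightarrow> approx_class \<Phi> p \<gamma> q"
proof -
  have lt: "\<alpha> < real r" using \<alpha> by (simp add: \<alpha>r) linarith
  have "\<exists>C>0. \<forall>f\<in>Lp p. approx_norm \<Phi> p \<gamma> q f \<le> ennreal C * besov_norm \<alpha> p q f"
  proof (cases "q = \<infinity>")
    case True
    obtain C where C: "0 < C" "\<And>f S. f \<in> Lp p \<Longrightarrow> (\<And>e. e \<ge> 1 \<Longrightarrow> Tseq f e \<le> S) \<Longrightarrow>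
      approx_norm \<Phi> p \<gamma> \<infinity> f \<le> ennreal C * (Lp_norm p {0..<1} f + S)"
      using approx_norm_infinity_bound by blast
    have "approx_norm \<Phi> p \<gamma> q f \<le> ennreal C * besov_norm \<alpha> p q f" if f: "f \<in> Lp p" for f
      unfolding True besov_norm_def
    proof (rule C(2)[OF f])
      fix e :: nat
      have "\<beta> ^ e \<in> {0<..1}" using beta_range by (simp add: power_le_one)
      then show "Tseq f e \<le> besov_seminorm \<alpha> p \<infinity> f"
        unfolding besov_seminorm_def Let_def \<alpha>r[symmetric] by (simp del: power_one_over) (rule SUP_upper, simp)
    qed
    then show ?thesis using C(1) by blast
  next
    case False
    have "besov_seminorm \<alpha> p q f = epowr (\<integral>\<^sup>+t\<in>{0<..<1}. epowr (ennreal (t powr (-\<alpha>)) * modulus r f t p) (enn2real q)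
                          * ennreal (1 / t) \<partial>lborel) (1 / enn2real q)" for f
      unfolding besov_seminorm_def Let_def \<alpha>r[symmetric] using False by simp
    then show ?thesis
      using approx_norm_finite_bound[OF q False lt] by (simp only: besov_norm_def)
  qed
  then obtain C where C: "0 < C" "\<And>f. f \<in> Lp p \<Longrightarrow> approx_norm \<Phi> p \<gamma> q f \<le> ennreal C * besov_norm \<alpha> p q f" by blast
  have "approx_norm \<Phi> p \<gamma> q f < \<infinity>" if "f \<in> Lp p" "besov_norm \<alpha> p q f < \<infinity>" for f
    using C(2)[OF that(1)] that(2) by (auto simp: ennreal_mult_less_top intro: le_less_trans)
  with C show ?thesis unfolding cont_embedded_def besov_def approx_class_def by auto
qed

lemma sobolev_embedding:
  assumes \<alpha>r: "\<alpha> = real r"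
  shows "sobolev r p \<hookrightarrow> approx_class \<Phi> p \<gamma> \<infinity>"
proof -
  obtain C where C: "0 < C" "\<And>f S. f \<in> Lp p \<Longrightarrow> (\<And>e. e \<ge> 1 \<Longrightarrow> Tseq f e \<le> S) \<Longrightarrow>
      approx_norm \<Phi> p \<gamma> \<infinity> f \<le> ennreal C * (Lp_norm p {0..<1} f + S)"
    using approx_norm_infinity_bound by blast
  have le: "approx_norm \<Phi> p \<gamma> \<infinity> f \<le> ennreal C * snd (sobolev r p) f" if f: "f \<in> fst (sobolev r p)" for f
  proof -
    have fL: "f \<in> Lp p" using f by (simp add: sobolev_def)
    have "Tseq f e \<le> Lp_norm p {0..<1} (weak_deriv r f)" for e
    proof -
      have be: "0 < \<beta> ^ e" using beta_range by simp
      have "Tseq f e \<le> ennreal ((\<beta> ^ e) powr (-\<alpha>)) * (ennreal ((\<beta> ^ e) ^ r) * Lp_norm p {0..<1} (weak_deriv r f))"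
        by (intro mult_left_mono sobolev_modulus p r f be) simp
      also have "\<dots> = ennreal ((\<beta> ^ e) powr (-\<alpha>) * (\<beta> ^ e) ^ r) * Lp_norm p {0..<1} (weak_deriv r f)"
        using be by (simp add: ennreal_mult mult.assoc)
      also have "(\<beta> ^ e) powr (-\<alpha>) * (\<beta> ^ e) ^ r = 1"
      proof -
        have "x powr (- real r) * x ^ r = 1" if "0 < x" for x :: real
          using that by (simp add: powr_minus powr_realpow)
        then show ?thesis unfolding \<alpha>r using be .
      qed
      finally show ?thesis by simp
    qed
    then have "approx_norm \<Phi> p \<gamma> \<infinity> f \<le> ennreal C * (Lp_norm p {0..<1} f + Lp_norm p {0..<1} (weak_deriv r f))"
      by (intro C(2) fL)
    also have "Lp_norm p {0..<1} (weak_deriv r f) \<le> (\<Sum>k=1..r. Lp_norm p {0..<1} (weak_deriv k f))"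
      using r by (intro member_le_sum) auto
    finally show ?thesis by (simp add: sobolev_def add_left_mono mult_left_mono)
  qed
  have "approx_norm \<Phi> p \<gamma> \<infinity> f < \<infinity>" if f: "f \<in> fst (sobolev r p)" for f
  proof -
    have "snd (sobolev r p) f < \<infinity>"
      using f by (auto simp: sobolev_def Lp_def less_top[symmetric])
    then show ?thesis using le[OF f] by (auto simp: ennreal_mult_less_top intro: le_less_trans)
  qed
  with C(1) le show ?thesis unfolding cont_embedded_def approx_class_def
    by (auto simp: sobolev_def)
qed

end

section \<open>Comparison of the classes\<close>

lemma approx_norm_antimono:
  assumes "\<And>n. U n \<subseteq> U' n" "0 < q"
  shows "approx_norm U' p \<alpha> q f \<le> approx_norm U p \<alpha> q f"
proof -
  have E: "best_error U' p n f \<le> best_error U p n f" for n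
    unfolding best_error_def by (intro INF_superset_mono assms) auto
  show ?thesis
  proof (cases "q = \<infinity>")
    case True
    then show ?thesis unfolding approx_norm_def by (auto intro!: SUP_mono' mult_left_mono E)
  next
    case False
    then have "0 < enn2real q" using assms(2) by (simp add: enn2real_positive_iff less_top)
    then show ?thesis using False unfolding approx_norm_def
      by (auto intro!: epowr_mono suminf_le mult_right_mono mult_left_mono E summableI)
  qed
qed

lemma C_class_embedded_S_class:
  assumes "0 < q"
  shows "C_class b m \<phi> \<alpha> q p \<hookrightarrow> S_class b m \<phi> \<alpha> q p"
proof -
  have "tn_Phi compl_C b m \<phi> n \<subseteq> tn_Phi compl_S b m \<phi> n" for n
    unfolding tn_Phi_def using compl_S_le_compl_C[of b m] by (auto intro: order_trans)
  then have "approx_norm (tn_Phi compl_S b m \<phi>) p \<alpha> q f \<le> approx_norm (tn_Phi compl_C b m \<phi>) p \<alpha> q f" for f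
    by (intro approx_norm_antimono assms)
  then show ?thesis
    unfolding cont_embedded_def C_class_def S_class_def approx_class_def
    by (auto intro!: exI[of _ 1] intro: le_less_trans)
qed

lemma compl_C_le_if_compl_N_le:
  assumes "tn_wf v" "compl_N b m v \<le> rank_bound r * b ^ e"
  shows "compl_C b m v \<le> ((2 * b + m + 1) * (rank_bound r)\<^sup>2) * (b\<^sup>2) ^ e"
proof -
  have "compl_C b m v \<le> (2 * b + m + 1) * (compl_N b m v)\<^sup>2" by (rule compl_C_le_compl_N_squared[OF assms(1)])
  also have "\<dots> \<le> (2 * b + m + 1) * (rank_bound r * b ^ e)\<^sup>2" using assms(2) by (intro mult_left_mono power_mono) auto
  also have "(rank_bound r * b ^ e)\<^sup>2 = (rank_bound r)\<^sup>2 * (b\<^sup>2) ^ e"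
    by (simp only: power_mult_distrib power_mult[symmetric] mult.commute)
  finally show ?thesis by (simp only: mult.assoc)
qed

theorem mainTheorem1:
  fixes b m :: nat and \<phi> :: "nat \<Rightarrow> real poly" and p :: ennreal
  assumes "b \<ge> 2" and "poly_basis m \<phi>" and "1 \<le> p"
  shows "(\<forall>r::nat. r \<ge> 1 \<longrightarrow>
            sobolev r p \<hookrightarrow> N_class b m \<phi> (2 * real r) \<infinity> p \<and>
            sobolev r p \<hookrightarrow> C_class b m \<phi> (real r) \<infinity> p \<and>
            C_class b m \<phi> (real r) \<infinity> p \<hookrightarrow> S_class b m \<phi> (real r) \<infinity> p) \<and>
         (\<forall>(q::ennreal) (\<alpha>::real). 0 < q \<and> 0 < \<alpha> \<longrightarrow>
            besov \<alpha> p q \<hookrightarrow> N_class b m \<phi> (2 * \<alpha>) q p \<and>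
            besov \<alpha> p q \<hookrightarrow> C_class b m \<phi> \<alpha> q p \<and>
            C_class b m \<phi> \<alpha> q p \<hookrightarrow> S_class b m \<phi> \<alpha> q p)"
proof -
  have b0: "0 < real b" using assms(1) by simp
  have \<beta>: "(1 / (real b)\<^sup>2) powr (-\<alpha>) = real b powr (2 * \<alpha>)" for \<alpha>
  proof -
    have "1 / (real b)\<^sup>2 = real b powr (-2)" using b0 by (simp add: powr_minus powr_numeral divide_inverse)
    then show ?thesis by (simp only: powr_powr) simp
  qed
  have BN: "real b powr (2 * \<alpha>) = (1 / (real b)\<^sup>2) powr (-\<alpha>)" for \<alpha> using \<beta> by simp
  have BC: "real (b\<^sup>2) powr \<alpha> = (1 / (real b)\<^sup>2) powr (-\<alpha>)" for \<alpha>
    unfolding \<beta> using b0 by (simp add: powr_powr flip: powr_numeral)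
  have K: "1 \<le> rank_bound r" "1 \<le> (2 * b + m + 1) * (rank_bound r)\<^sup>2" for r
    by (simp_all add: rank_bound_def Suc_le_eq)
  have b2: "2 \<le> b\<^sup>2" using assms(1) by (simp add: power2_eq_square) (metis le_trans mult_le_mono one_le_numeral mult_1)
  show ?thesis
  proof (intro conjI allI impI)
    fix r :: nat assume r: "r \<ge> 1"
    then have r0: "0 < real r" "0 < 2 * real r" by simp_all
    show "sobolev r p \<hookrightarrow> N_class b m \<phi> (2 * real r) \<infinity> p"
      unfolding N_class_def
      by (rule sobolev_embedding[OF assms r K(1) assms(1) r0(1) order_refl r0(2) BN _ refl]) simp
    show "sobolev r p \<hookrightarrow> C_class b m \<phi> (real r) \<infinity> p"
      unfolding C_class_def
      by (rule sobolev_embedding[OF assms r K(2) b2 r0(1) order_refl r0(1) BC _ refl]) (rule compl_C_le_if_compl_N_le)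
    show "C_class b m \<phi> (real r) \<infinity> p \<hookrightarrow> S_class b m \<phi> (real r) \<infinity> p"
      by (rule C_class_embedded_S_class) simp
  next
    fix q :: ennreal and \<alpha> :: real assume q\<alpha>: "0 < q \<and> 0 < \<alpha>"
    define r where "r = nat \<lfloor>\<alpha>\<rfloor> + 1"
    have r: "1 \<le> r" and \<alpha>r: "\<alpha> \<le> real r" using q\<alpha> by (auto simp: r_def) linarith
    have \<alpha>: "0 < \<alpha>" "0 < 2 * \<alpha>" and q: "0 < q" using q\<alpha> by auto
    show "besov \<alpha> p q \<hookrightarrow> N_class b m \<phi> (2 * \<alpha>) q p"
      unfolding N_class_def
      by (rule besov_embedding[OF assms r K(1) assms(1) \<alpha>(1) \<alpha>r \<alpha>(2) BN _ q r_def]) simp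
    show "besov \<alpha> p q \<hookrightarrow> C_class b m \<phi> \<alpha> q p"
      unfolding C_class_def
      by (rule besov_embedding[OF assms r K(2) b2 \<alpha>(1) \<alpha>r \<alpha>(1) BC _ q r_def]) (rule compl_C_le_if_compl_N_le)
    show "C_class b m \<phi> \<alpha> q p \<hookrightarrow> S_class b m \<phi> \<alpha> q p"
      by (rule C_class_embedded_S_class) (rule q)
  qed
qed

end
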